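(* Let $\alpha,\beta\in(0,1]$ and $\mu,\nu\in\mathcal{P}(\mathbb{R}_+)$. (1) $\mathbf{M}_\alpha^+(\mu)$ is characterized by $F_{\mathbf{M}_\alpha^+(\mu)}(z)=-\big(-F_\mu(-(-z)^\alpha)\big)^{1/\alpha}$ for $z<0$. Moreover $\mathbf{M}_\alpha^+\circ\mathbf{M}_\beta^+=\mathbf{M}_{\alpha\beta}^+$ and $\mathbf{M}_\alpha^+(\mu\rhd\nu)=\mathbf{M}_\alpha^+(\mu)\rhd\mathbf{M}_\alpha^+(\nu)$. (2) $\mathbf{U}_\alpha^+(\mu)$ is characterized by $\eta_{\mathbf{U}_\alpha^+(\mu)}(z)=-\big(-\eta_\mu(-(-z)^\alpha)\big)^{1/\alpha}$ for $z<0$. Moreover $\mathbf{U}_\alpha^+\circ\mathbf{U}_\beta^+=\mathbf{U}_{\alpha\beta}^+$, $\mathbf{U}_\alpha^+(\mu\circlearrowright\nu)=\mathbf{U}_\alpha^+(\mu)\circlearrowright\mathbf{U}_\alpha^+(\nu)$, and $\mathbf{U}_\alpha^+(\mu\boxtimes\nu)=\mathbf{U}_\alpha^+(\mu)\boxtimes\mathbf{U}_\alpha^+(\nu)$.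
   Context: For $\mu\in\mathcal{P}(\mathbb{R}_+)$: $G_\mu(z)=\int\frac{1}{z-x}\mu(dx)$, $F_\mu=1/G_\mu$, $\eta_\mu(z)=1-zF_\mu(1/z)$ on $\mathbb{C}\setminus\mathbb{R}_+$; for $\mu\neq\delta_0$, $\Sigma_\mu(z)=\eta_\mu^{-1}(z)/z$ on $(\eta_\mu(-\infty),0)$. Powers $z^p$ are principal values. $\boxtimes$: multiplicative free convolution, $\Sigma_{\mu\boxtimes\nu}=\Sigma_\mu\Sigma_\nu$ near $0^-$; $\mu^{\boxtimes t}$ ($t\ge1$) satisfies $\Sigma_{\mu^{\boxtimes t}}=\Sigma_\mu^t$. $\circlearrowright$: multiplicative monotone convolution, $\eta_{\mu\circlearrowright\nu}=\eta_\mu\circ\eta_\nu$ on $(-\infty,0)$. $\rhd$: additive monotone convolution, $F_{\mu\rhd\nu}=F_\mu\circ F_\nu$. For $\sigma\in\mathcal{P}(\mathbb{R}_+)\setminus\{\delta_0\}$, $\mathbb{B}_\sigma(\mu)$ is the unique probability measure on $\mathbb{R}_+$ with $\sigma\boxtimes\mu=\sigma\circlearrowright\mathbb{B}_\sigma(\mu)$ (for $\mu\ne\delta_0$: $\Sigma_{\mathbb{B}_\sigma(\mu)}=\Sigma_\mu\circ\eta_\sigma$ near $0^-$). Distributions: $\bm{\beta}_\alpha$ is the beta law with density $\frac{1}{B(\alpha,1-\alpha)}x^{\alpha-1}(1-x)^{-\alpha}$ on $(0,1)$ ($\bm\beta_1=\delta_1$), with $\eta_{\bm\beta_\alpha}(z)=1-(1-z)^\alpha$;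 $\mathbf{b}_\alpha^+$ is the positive Boolean $\alpha$-stable law, $\eta_{\mathbf{b}_\alpha^+}(z)=-(-z)^\alpha$ ($z<0$); $\mathbf{m}_\alpha^+$ is the positive monotone $\alpha$-stable law, $F_{\mathbf{m}_\alpha^+}(z)=-((-z)^\alpha+1)^{1/\alpha}$ ($z<0$). Maps: $\mathbf{M}_\alpha^+(\mu):=\mathbb{B}_{\bm\beta_\alpha}(\mu)^{\boxtimes1/\alpha}\boxtimes\mathbf{m}_\alpha^+$ and $\mathbf{U}_\alpha^+(\mu):=\mathbb{B}_{\mathbf{b}_\alpha^+}(\mu)^{\boxtimes1/\alpha}$. *)

theory Defs
  imports "HOL-Probability.Probability"
begin

definition Pplus :: "real measure set" where
  "Pplus = {mu. prob_space mu \<and> sets mu = sets borel \<and> emeasure mu {..<0} = 0}"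

definition delta0 :: "real measure" where
  "delta0 = return borel 0"

definition cauchyG :: "real measure \<Rightarrow> complex \<Rightarrow> complex" where
  "cauchyG mu z = (\<integral>x. inverse (z - complex_of_real x) \<partial>mu)"

definition Ftr :: "real measure \<Rightarrow> complex \<Rightarrow> complex" where
  "Ftr mu z = 1 / cauchyG mu z"

definition etatr :: "real measure \<Rightarrow> complex \<Rightarrow> complex" where
  "etatr mu z = (if z = 0 then 0 else 1 - z * Ftr mu (1 / z))"

text \<open>S-transform Sigma(z) = eta^{-1}(z)/z, for real z in (eta(-infinity),0).\<close>
definition Sigmatr :: "real measure \<Rightarrow> real \<Rightarrow> real" where
  "Sigmatr mu x = (THE w. w < 0 \<and> etatr mu (complex_of_real w) = complex_of_real x) / x"

definition free_mult_conv :: "real measure \<Rightarrow> real measure \<Rightarrow> real measure" where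
  "free_mult_conv mu nu = (THE rho. rho \<in> Pplus \<and>
     (if mu = delta0 \<or> nu = delta0 then rho = delta0
      else rho \<noteq> delta0 \<and>
        (\<forall>\<^sub>F x in at_left 0. Sigmatr rho x = Sigmatr mu x * Sigmatr nu x)))"

text \<open>Free multiplicative convolution power mu^{boxtimes t}, t \<ge> 1.\<close>
definition free_mult_pow :: "real measure \<Rightarrow> real \<Rightarrow> real measure" where
  "free_mult_pow mu t = (THE rho. rho \<in> Pplus \<and>
     (if mu = delta0 then rho = delta0
      else rho \<noteq> delta0 \<and>
        (\<forall>\<^sub>F x in at_left 0. Sigmatr rho x = Sigmatr mu x powr t)))"

definition mono_mult_conv :: "real measure \<Rightarrow> real measure \<Rightarrow> real measure" where
  "mono_mult_conv mu nu = (THE rho. rho \<in> Pplus \<and>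
     (\<forall>x::real. x < 0 \<longrightarrow>
        etatr rho (complex_of_real x) = etatr mu (etatr nu (complex_of_real x))))"

definition mono_add_conv :: "real measure \<Rightarrow> real measure \<Rightarrow> real measure" where
  "mono_add_conv mu nu = (THE rho. rho \<in> Pplus \<and>
     (\<forall>z. Im z > 0 \<longrightarrow> Ftr rho z = Ftr mu (Ftr nu z)))"

definition Bmap :: "real measure \<Rightarrow> real measure \<Rightarrow> real measure" where
  "Bmap sg mu = (THE rho. rho \<in> Pplus \<and>
     free_mult_conv sg mu = mono_mult_conv sg rho)"

definition beta_law :: "real \<Rightarrow> real measure" where
  "beta_law a = (if a = 1 then return borel 1
     else density lborel (\<lambda>x. ennreal (indicator {0<..<1} x *
        x powr (a - 1) * (1 - x) powr (- a) / Beta a (1 - a))))"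

definition boolean_stable :: "real \<Rightarrow> real measure" where
  "boolean_stable a = (THE rho. rho \<in> Pplus \<and>
     (\<forall>x::real. x < 0 \<longrightarrow>
        etatr rho (complex_of_real x) = complex_of_real (- ((- x) powr a))))"

definition monotone_stable :: "real \<Rightarrow> real measure" where
  "monotone_stable a = (THE rho. rho \<in> Pplus \<and>
     (\<forall>x::real. x < 0 \<longrightarrow>
        Ftr rho (complex_of_real x) = complex_of_real (- (((- x) powr a + 1) powr (1 / a)))))"

definition Mplus :: "real \<Rightarrow> real measure \<Rightarrow> real measure" where
  "Mplus a mu = free_mult_conv (free_mult_pow (Bmap (beta_law a) mu) (1 / a)) (monotone_stable a)"

definition Uplus :: "real \<Rightarrow> real measure \<Rightarrow> real measure" where
  "Uplus a mu = free_mult_pow (Bmap (boolean_stable a) mu) (1 / a)"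

end

theory Submission
  imports Defs "HOL-Complex_Analysis.Complex_Analysis"
begin

text \<open>
  Put \<open>s = - z > 0\<close>. Then \<open>F(- 1/s) = - q(s)/s\<close> and \<open>\<eta>(- s) = - e(s)\<close>, where
  \<open>1/q(s)\<close> is the integral of \<open>1/(1 + x s)\<close> and \<open>e = q - 1\<close>. Both \<open>q\<close> and (unless it
  vanishes) \<open>e\<close> are complete Bernstein functions: they extend to the plane slit along the negative axis with
  \<open>0 \<le> arg f(z) \<le> arg z\<close> on the upper half-plane. This class is visibly closed under composition,
  \<open>f(z\<^sup>a)\<^bsup>1/a\<^esup>\<close>, geometric means and \<open>z f(w(z))/w(z)\<close>.

  In the variable \<open>u = \<surd>z\<close> the condition implies that \<open>u/f(u\<^sup>2)\<close> has nonnegative real part on the right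
  half-plane, so Poisson's formula on the disc and Helly's theorem represent \<open>1/f\<close> as a mixture of
  \<open>1/(1 - p + p s)\<close> over \<open>p\<close> in the compact interval \<open>[0,1]\<close>. Hence the class is closed under
  pointwise limits on the positive axis, and its members with the right value at \<open>0\<close> come from
  probability measures.

  The subordination functions of free convolution and of free powers solve monotone fixed-point
  equations on the positive axis. Iterating from \<open>w(s) = s\<close> stays in the class, which yields the
  measures defining all the convolutions. The two explicit formulas are then checked on Sigma-transforms near \<open>0\<close>,
  and the remaining identities follow from them.
\<close>

section \<open>The slit plane and complete Bernstein functions\<close>

text \<open>Every operation involved is a definite description over \<open>Pplus\<close>, so nothing
  can be said about a convolution, a power or a stable law before a measure with the right transform
  has been exhibited and shown to be unique. Producing measures is the real obstacle, and it shapes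
  the choice of class. Arguments suit it because powers and quotients act linearly on
  \<open>Arg\<close>, while sums behave badly there. The one sum that matters, q = 1 + e, is handled
  by a weaker condition, additive in q: \<open>csqrt z * cnj (q z)\<close> has nonnegative real
  part. This is the only positivity off the real axis that the Poisson argument uses. The interval
  [0,1] arises from p = x/(1+x), which compactifies the half-line: an atom at p = 1 would be mass at
  infinity, and the limit 1 of q at 0 is what excludes it. The measure \<open>delta0\<close>, whose
  e vanishes identically and which has no Sigma-transform, is split off throughout.\<close>

lemma eventually_at_right_0I:
  "(\<And>s. 0 < s \<Longrightarrow> P s) \<Longrightarrow> \<forall>\<^sub>F s in at_right (0::real). P s"
  by (rule eventually_mono[OF eventually_at_right_less])

lemmas at_right_0_pos = eventually_at_right_less[of "0::real"]

lemma filterlim_at_right_0I: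
  fixes f :: "real \<Rightarrow> real"
  assumes "(f \<longlongrightarrow> 0) (at_right 0)" "\<And>s. 0 < s \<Longrightarrow> 0 < f s"
  shows "filterlim f (at_right 0) (at_right 0)"
  using assms by (auto simp: filterlim_at less_imp_neq[THEN not_sym] intro!: eventually_at_right_0I)

definition slit :: "complex set" where "slit = - \<real>\<^sub>\<le>\<^sub>0"

lemma open_slit: "open slit"
  unfolding slit_def using closed_nonpos_Reals_complex by blast

lemma slit_iff: "z \<in> slit \<longleftrightarrow> Im z \<noteq> 0 \<or> Re z > 0"
  by (auto simp: slit_def complex_nonpos_Reals_iff)

lemma of_real_slit [simp]: "complex_of_real s \<in> slit \<longleftrightarrow> s > 0"
  by (simp add: slit_iff)

lemma cnj_slit [simp]: "cnj z \<in> slit \<longleftrightarrow> z \<in> slit"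
  by (simp add: slit_iff)

lemma slit_Re_csqrt: "z \<in> slit \<longleftrightarrow> Re (csqrt z) > 0"
proof -
  have "cmod z \<le> - Re z \<longleftrightarrow> Im z = 0 \<and> Re z \<le> 0"
    using abs_Re_le_cmod[of z] cmod_power2[of z]
    by (smt (verit) zero_le_power2 power2_eq_iff zero_eq_power2 cmod_eq_Re)
  then have "0 < cmod z + Re z \<longleftrightarrow> Im z \<noteq> 0 \<or> 0 < Re z" by linarith
  then show ?thesis by (simp add: slit_iff)
qed

lemma connected_slit: "connected slit"
proof -
  have "slit = - (complex_of_real ` {..0})" by (auto simp: slit_def nonpos_Reals_def)
  then show ?thesis using starlike_imp_connected[OF starlike_slotted_complex_plane_left[of 0]] by simp
qed

lemma slit_nz: "z \<in> slit \<Longrightarrow> z \<noteq> 0" by (auto simp: slit_iff)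

lemma slit_nonpos: "z \<in> slit \<Longrightarrow> z \<notin> \<real>\<^sub>\<le>\<^sub>0" by (auto simp: slit_def)

lemma Arg_nonneg_iff: "0 \<le> Arg z \<longleftrightarrow> 0 \<le> Im z"
  using Arg_neg_iff[of z] by linarith

lemma slit_Arg: "z \<in> slit \<longleftrightarrow> z \<noteq> 0 \<and> Arg z < pi"
  using Arg_eq_pi[of z] Arg_le_pi[of z] by (auto simp: slit_iff complex_eq_iff)

text \<open>On the positive axis \<open>Arg z = 0\<close>, so the two bounds force \<open>f\<close>
  to be positive there. With the reflection symmetry, a condition on the closed upper half controls
  the whole slit plane. The zero function is excluded.\<close>

definition cbf :: "(complex \<Rightarrow> complex) \<Rightarrow> bool" where
  "cbf f \<longleftrightarrow> f holomorphic_on slit \<and> (\<forall>z\<in>slit. f (cnj z) = cnj (f z)) \<and>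
     (\<forall>z\<in>slit. 0 \<le> Im z \<longrightarrow> f z \<noteq> 0 \<and> 0 \<le> Arg (f z) \<and> Arg (f z) \<le> Arg z)"

lemma cbf_holo: "cbf f \<Longrightarrow> f holomorphic_on slit"
  and cbf_cnj: "cbf f \<Longrightarrow> z \<in> slit \<Longrightarrow> f (cnj z) = cnj (f z)"
  and cbf_Arg0: "cbf f \<Longrightarrow> z \<in> slit \<Longrightarrow> 0 \<le> Im z \<Longrightarrow> 0 \<le> Arg (f z)"
  and cbf_Arg: "cbf f \<Longrightarrow> z \<in> slit \<Longrightarrow> 0 \<le> Im z \<Longrightarrow> Arg (f z) \<le> Arg z"
  by (auto simp: cbf_def)

lemma cbf_Im: "cbf f \<Longrightarrow> z \<in> slit \<Longrightarrow> 0 \<le> Im z \<Longrightarrow> 0 \<le> Im (f z)"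
  using cbf_Arg0[of f z] Arg_neg_iff[of "f z"] by linarith

lemma cbf_in_slit:
  assumes "cbf f" "z \<in> slit" shows "f z \<in> slit"
proof -
  have *: "f w \<in> slit" if "w \<in> slit" "0 \<le> Im w" for w
    using assms(1) that unfolding cbf_def by (force simp: slit_Arg)
  show ?thesis
  proof (cases "0 \<le> Im z")
    case True then show ?thesis using * assms by blast
  next
    case False
    then have "f (cnj z) \<in> slit" using *[of "cnj z"] assms by simp
    then show ?thesis using cbf_cnj[OF assms] by simp
  qed
qed

lemma cbf_nz: "cbf f \<Longrightarrow> z \<in> slit \<Longrightarrow> f z \<noteq> 0"
  using cbf_in_slit slit_nz by blast

lemma cbf_real:
  assumes "cbf f" "s > 0"
  shows "f (of_real s) = of_real (Re (f (of_real s)))" "Re (f (of_real s)) > 0"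
proof -
  have "f (cnj (of_real s)) = cnj (f (of_real s))" by (rule cbf_cnj) (use assms in auto)
  then have 1: "Im (f (of_real s)) = 0" by (simp add: complex_eq_iff)
  show "f (of_real s) = of_real (Re (f (of_real s)))" by (rule complex_eqI) (simp_all add: 1)
  have "f (of_real s) \<in> slit" by (rule cbf_in_slit) (use assms in auto)
  then show "Re (f (of_real s)) > 0" using 1 by (simp add: slit_iff)
qed

lemma cbfI:
  assumes "f holomorphic_on slit" "\<And>z. z \<in> slit \<Longrightarrow> f (cnj z) = cnj (f z)"
    "\<And>z. z \<in> slit \<Longrightarrow> 0 \<le> Im z \<Longrightarrow> f z \<noteq> 0 \<and> 0 \<le> Arg (f z) \<and> Arg (f z) \<le> Arg z"
  shows "cbf f"
  using assms by (auto simp: cbf_def)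

lemma cbf_id: "cbf (\<lambda>z. z)"
  by (intro cbfI) (auto simp: slit_nz Arg_nonneg_iff intro: holomorphic_intros)

lemma cbf_comp:
  assumes "cbf f" "cbf g" shows "cbf (\<lambda>z. f (g z))"
proof (rule cbfI)
  show "(\<lambda>z. f (g z)) holomorphic_on slit"
    using holomorphic_on_compose_gen[OF cbf_holo[OF assms(2)] cbf_holo[OF assms(1)]] cbf_in_slit[OF assms(2)]
    by (auto simp: o_def)
  show "f (g (cnj z)) = cnj (f (g z))" if "z \<in> slit" for z
    using that assms by (simp add: cbf_cnj cbf_in_slit)
  fix z assume z: "z \<in> slit" "0 \<le> Im z"
  then have "g z \<in> slit" "0 \<le> Im (g z)" "Arg (g z) \<le> Arg z"
    using assms(2) by (auto intro: cbf_in_slit cbf_Im cbf_Arg)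
  then show "f (g z) \<noteq> 0 \<and> 0 \<le> Arg (f (g z)) \<and> Arg (f (g z)) \<le> Arg z"
    using assms(1) by (auto simp: cbf_nz cbf_Arg0 intro: order_trans cbf_Arg)
qed

lemma Arg_powr_of_real:
  assumes "z \<noteq> 0" "- pi < a * Arg z" "a * Arg z \<le> pi"
  shows "Arg (z powr of_real a) = a * Arg z"
  using assms by (simp add: powr_def Arg_exp Arg_eq_Im_Ln)

lemma cnj_powr_of_real:
  assumes "z \<notin> \<real>\<^sub>\<le>\<^sub>0"
  shows "cnj z powr of_real a = cnj (z powr of_real a)"
  using assms by (subst cnj_powr) (auto simp: complex_nonpos_Reals_iff complex_is_Real_iff)

text \<open>The argument of the product is the convex combination of the two arguments, which stays
  in \<open>[0, Arg z]\<close>; as \<open>Arg z < pi\<close>, no branch is crossed.\<close>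

lemma cbf_geometric_mean:
  assumes "cbf f" "cbf g" and a: "0 \<le> a" "a \<le> 1"
  shows "cbf (\<lambda>z. f z powr of_real a * g z powr of_real (1 - a))"
proof (rule cbfI)
  have *: "f z \<notin> \<real>\<^sub>\<le>\<^sub>0" "g z \<notin> \<real>\<^sub>\<le>\<^sub>0" if "z \<in> slit" for z
    using that assms cbf_in_slit slit_nonpos by blast+
  show "(\<lambda>z. f z powr of_real a * g z powr of_real (1 - a)) holomorphic_on slit"
    using * by (intro holomorphic_intros cbf_holo assms) auto
  show "f (cnj z) powr of_real a * g (cnj z) powr of_real (1 - a)
      = cnj (f z powr of_real a * g z powr of_real (1 - a))" if "z \<in> slit" for z
    using that assms *[of z] by (simp add: cbf_cnj cnj_powr_of_real del: of_real_diff)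
  fix z assume z: "z \<in> slit" "0 \<le> Im z"
  have nz: "f z \<noteq> 0" "g z \<noteq> 0" using z assms cbf_nz by auto
  have A: "0 \<le> Arg (f z)" "Arg (f z) \<le> Arg z" "0 \<le> Arg (g z)" "Arg (g z) \<le> Arg z" "Arg z < pi"
    using z assms by (auto intro: cbf_Arg0 cbf_Arg simp: slit_Arg)
  have b: "a * Arg (f z) \<le> a * Arg z" "(1 - a) * Arg (g z) \<le> (1 - a) * Arg z"
      "0 \<le> a * Arg (f z)" "0 \<le> (1 - a) * Arg (g z)"
    using A a by (auto intro!: mult_left_mono)
  have c: "a * Arg z + (1 - a) * Arg z = Arg z" by (simp add: algebra_simps)
  have e: "0 \<le> a * Arg z" "0 \<le> (1-a) * Arg z" using A a by (auto intro!: mult_nonneg_nonneg)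
  have d: "Arg (f z powr of_real a) = a * Arg (f z)"
          "Arg (g z powr of_real (1 - a)) = (1 - a) * Arg (g z)"
    using b c A pi_gt_zero e nz by (auto intro!: Arg_powr_of_real simp del: of_real_diff)
  have "Arg (f z powr of_real a * g z powr of_real (1 - a)) = a * Arg (f z) + (1 - a) * Arg (g z)"
    using nz d b c A pi_gt_zero by (subst Arg_times) auto
  then show "f z powr of_real a * g z powr of_real (1 - a) \<noteq> 0 \<and>
    0 \<le> Arg (f z powr of_real a * g z powr of_real (1 - a)) \<and>
    Arg (f z powr of_real a * g z powr of_real (1 - a)) \<le> Arg z"
    using nz b c by auto
qed

text \<open>The new argument is \<open>Arg z - (Arg (w z) - Arg (f (w z)))\<close>, and the
  subtracted difference lies between 0 and \<open>Arg (w z)\<close>, hence between 0 and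
  \<open>Arg z\<close>. The fixed-point equations of free convolution are built from this
  step.\<close>

lemma cbf_subordination_step:
  assumes "cbf f" "cbf w"
  shows "cbf (\<lambda>z. z * f (w z) / w z)"
proof (rule cbfI)
  have fw: "cbf (\<lambda>z. f (w z))" by (rule cbf_comp[OF assms])
  show "(\<lambda>z. z * f (w z) / w z) holomorphic_on slit"
    by (intro holomorphic_intros cbf_holo assms fw) (simp add: assms cbf_nz)
  show "cnj z * f (w (cnj z)) / w (cnj z) = cnj (z * f (w z) / w z)" if "z \<in> slit" for z
    using that assms by (simp add: cbf_cnj cbf_in_slit)
  fix z assume z: "z \<in> slit" "0 \<le> Im z"
  have wz: "w z \<in> slit" "0 \<le> Im (w z)" using z assms by (auto intro: cbf_in_slit cbf_Im)
  have nz: "z \<noteq> 0" "w z \<noteq> 0" "f (w z) \<noteq> 0" using z wz assms cbf_nz slit_nz by auto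
  have A: "0 \<le> Arg (f (w z))" "Arg (f (w z)) \<le> Arg (w z)" "Arg (w z) \<le> Arg z" "0 \<le> Arg (w z)" "Arg z < pi"
    using z wz assms by (auto intro: cbf_Arg0 cbf_Arg simp: slit_Arg)
  have i: "Arg (inverse (w z)) = - Arg (w z)"
  proof (cases "w z \<in> \<real>")
    case True then show ?thesis using wz by (simp add: Arg_inverse Arg_real slit_iff complex_is_Real_iff)
  qed (simp add: Arg_inverse)
  have 1: "Arg (f (w z) * inverse (w z)) = Arg (f (w z)) - Arg (w z)"
    using nz A pi_gt_zero i by (subst Arg_times) auto
  have "Arg (z * (f (w z) * inverse (w z))) = Arg z + (Arg (f (w z)) - Arg (w z))"
    using nz A 1 pi_gt_zero by (subst Arg_times) auto
  then show "z * f (w z) / w z \<noteq> 0 \<and> 0 \<le> Arg (z * f (w z) / w z) \<and> Arg (z * f (w z) / w z) \<le> Arg z"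
    using nz A by (auto simp: field_simps)
qed

lemma cbf_one: "cbf (\<lambda>_. 1)"
  by (rule cbfI) (auto simp: Arg_nonneg_iff)

lemma cbf_quotient: "cbf f \<Longrightarrow> cbf (\<lambda>z. z / f z)"
  using cbf_subordination_step[OF cbf_one, of f] by simp

text \<open>The inner power multiplies the argument by \<open>a\<close>, \<open>f\<close> does not
  increase it, and the outer power divides by \<open>a\<close>, which restores exactly the bound
  \<open>Arg z\<close>.\<close>

lemma cbf_power_conj:
  assumes "cbf f" and a: "0 < a" "a \<le> 1"
  shows "cbf (\<lambda>z. f (z powr of_real a) powr of_real (1 / a))"
proof (rule cbfI)
  have za: "z powr of_real a \<in> slit" "0 \<le> Im z \<Longrightarrow> Arg (z powr of_real a) = a * Arg z"
    if "z \<in> slit" for z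
  proof -
    have "\<bar>a * Arg z\<bar> \<le> \<bar>Arg z\<bar>" using a by (simp add: abs_mult mult_left_le_one_le)
    moreover have "\<bar>Arg z\<bar> < pi" using that mpi_less_Arg[of z] by (auto simp: slit_Arg)
    ultimately have "\<bar>a * Arg z\<bar> < pi" by linarith
    then have "Arg (z powr of_real a) = a * Arg z" "a * Arg z < pi"
      using that slit_nz[of z] by (auto intro!: Arg_powr_of_real)
    then show "z powr of_real a \<in> slit" "0 \<le> Im z \<Longrightarrow> Arg (z powr of_real a) = a * Arg z"
      using that by (auto simp: slit_Arg)
  qed
  have *: "z \<notin> \<real>\<^sub>\<le>\<^sub>0" "f (z powr of_real a) \<notin> \<real>\<^sub>\<le>\<^sub>0" if "z \<in> slit" for z
    using that za assms cbf_in_slit slit_nonpos by blast+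
  have h: "(\<lambda>z. z powr of_real a) holomorphic_on slit"
    using * by (intro holomorphic_intros) auto
  have h2: "(\<lambda>z. f (z powr of_real a)) holomorphic_on slit"
    using holomorphic_on_compose_gen[OF h cbf_holo[OF assms(1)]] za by (auto simp: o_def)
  show "(\<lambda>z. f (z powr of_real a) powr of_real (1 / a)) holomorphic_on slit"
    using * h2 by (intro holomorphic_intros) auto
  show "f (cnj z powr of_real a) powr of_real (1/a) = cnj (f (z powr of_real a) powr of_real (1/a))"
    if "z \<in> slit" for z
  proof -
    have "cnj z powr of_real a = cnj (z powr of_real a)"
      using *[OF that] by (simp add: cnj_powr_of_real)
    then show ?thesis
      using that za[OF that] *[OF that] assms by (simp add: cbf_cnj cnj_powr_of_real del: of_real_divide)
  qed
  fix z assume z: "z \<in> slit" "0 \<le> Im z"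
  let ?v = "z powr of_real a" let ?y = "f ?v"
  have 1: "Arg ?v = a * Arg z" "?v \<in> slit" using za z by auto
  have 2: "0 \<le> Arg z" "Arg z < pi" using z by (auto simp: Arg_nonneg_iff slit_Arg)
  have 3: "0 \<le> Im ?v" using 1 2 a by (metis Arg_nonneg_iff less_eq_real_def mult_nonneg_nonneg)
  have 4: "0 \<le> Arg ?y" "Arg ?y \<le> a * Arg z" "?y \<noteq> 0"
    using 1 3 assms cbf_Arg0 cbf_Arg cbf_nz by (blast, metis, blast)
  have 5: "1/a * Arg ?y \<le> Arg z" "0 \<le> 1/a * Arg ?y" using 4 a by (auto simp: field_simps)
  have 6: "Arg (?y powr of_real (1/a)) = 1/a * Arg ?y"
    using 4 5 2 pi_gt_zero by (intro Arg_powr_of_real) auto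
  show "?y powr of_real (1 / a) \<noteq> 0 \<and> 0 \<le> Arg (?y powr of_real (1 / a)) \<and> Arg (?y powr of_real (1 / a)) \<le> Arg z"
    unfolding 6 using 4 5 by auto
qed

text \<open>With \<theta> = Arg z the product has argument \<theta>/2 - Arg (f z), which lies in
  [-\<theta>/2, \<theta>/2], where the cosine is nonnegative. The condition means that sqrt z / f z
  has nonnegative real part, written in a form additive in \<open>f\<close>.\<close>

lemma cbf_Re_csqrt:
  assumes "cbf f" "z \<in> slit"
  shows "0 \<le> Re (csqrt z * cnj (f z))"
proof -
  have *: "0 \<le> Re (csqrt w * cnj (f w))" if w: "w \<in> slit" "0 \<le> Im w" for w
  proof -
    have A: "0 \<le> Arg (f w)" "Arg (f w) \<le> Arg w" "Arg w < pi"
      using w assms by (auto intro: cbf_Arg0 cbf_Arg simp: slit_Arg)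
    have "csqrt w = exp (Ln w / 2)" by (rule csqrt_exp_Ln) (use w slit_nz in auto)
    then have c: "csqrt w = rcis (exp (Re (Ln w) / 2)) (Arg w / 2)"
      using w by (simp only: exp_eq_polar rcis_def Arg_eq_Im_Ln slit_nz Re_divide_numeral Im_divide_numeral not_False_eq_True)
    have "cnj (f w) = rcis (cmod (f w)) (- Arg (f w))"
      by (metis rcis_cmod_Arg rcis_cnj)
    then have "csqrt w * cnj (f w) = rcis (exp (Re (Ln w) / 2) * cmod (f w)) (Arg w / 2 - Arg (f w))"
      using c by (simp add: rcis_mult)
    then have "Re (csqrt w * cnj (f w)) = exp (Re (Ln w) / 2) * cmod (f w) * cos (Arg w / 2 - Arg (f w))"
      by simp
    moreover have "cos (Arg w / 2 - Arg (f w)) \<ge> 0"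
      by (rule cos_ge_zero) (use A in linarith)+
    ultimately show ?thesis by simp
  qed
  show ?thesis
  proof (cases "0 \<le> Im z")
    case True then show ?thesis using * assms by blast
  next
    case False
    then have "0 \<le> Re (csqrt (cnj z) * cnj (f (cnj z)))" using *[of "cnj z"] assms by simp
    moreover have "csqrt (cnj z) = cnj (csqrt z)"
      using assms slit_nonpos by (intro csqrt_unique) (auto simp flip: complex_cnj_power simp: slit_Re_csqrt simp del: csqrt.sel)
    ultimately show ?thesis using assms by (simp add: cbf_cnj del: csqrt.sel)
  qed
qed

section \<open>Stieltjes transforms\<close>

lemma slit_obtain_sqrt:
  assumes "z \<in> slit"
  obtains u where "z = u^2" "Re u > 0" "u = csqrt z"
  using assms slit_Re_csqrt[of z] by (metis power2_csqrt)

text \<open>A lower bound for |a + b z| / (a + b), uniform over a, b \<ge> 0 with a + b \<ge> 1.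
  With z = u^2 one has a + b z = u (a/u + b u), and the second factor has real part Re u (a/|u|^2 +
  b).\<close>

definition kernel_gap :: "complex \<Rightarrow> real" where
  "kernel_gap z = Re (csqrt z) * min (1 / cmod (csqrt z)) (cmod (csqrt z))"

lemma kernel_gap_pos: "z \<in> slit \<Longrightarrow> kernel_gap z > 0"
  using slit_Re_csqrt[of z] slit_nz[of z] by (auto simp: kernel_gap_def simp del: csqrt.sel norm_csqrt intro!: mult_pos_pos)

lemma continuous_on_kernel_gap: "continuous_on slit kernel_gap"
proof -
  have "continuous_on slit csqrt" unfolding slit_def by (rule continuous_on_csqrt)
  then show ?thesis
    unfolding kernel_gap_def by (auto intro!: continuous_intros simp: slit_nz simp del: csqrt.sel norm_csqrt)
qed

lemma Re_kernel_pos: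
  assumes "Re u > 0" "0 \<le> a" "0 \<le> b" "1 \<le> a + (b::real)"
  shows "Re (of_real a / u + of_real b * u) \<ge> Re u * (a / (cmod u)^2 + b)"
        "Re u * (a / (cmod u)^2 + b) > 0"
proof -
  have "u \<noteq> 0" using assms by auto
  have "Re (of_real a / u + of_real b * u) = Re u * (a / (cmod u)^2 + b)"
    by (simp add: Re_divide cmod_def algebra_simps)
  then show "Re (of_real a / u + of_real b * u) \<ge> Re u * (a / (cmod u)^2 + b)" by simp
  have "a / (cmod u)^2 + b > 0"
    using assms \<open>u \<noteq> 0\<close> by (cases "b = 0") (auto intro!: add_nonneg_pos)
  then show "Re u * (a / (cmod u)^2 + b) > 0" using assms by simp
qed

lemma kernel_bound:
  assumes "z \<in> slit" "0 \<le> a" "0 \<le> b" "1 \<le> a + (b::real)"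
  shows "(a + b) * kernel_gap z \<le> cmod (of_real a + of_real b * z)" "of_real a + of_real b * z \<noteq> 0"
proof -
  obtain u where u: "z = u^2" "Re u > 0" "u = csqrt z" using assms slit_obtain_sqrt by blast
  then have nz: "u \<noteq> 0" by auto
  then have eq: "of_real a + of_real b * z = u * (of_real a / u + of_real b * u)"
    by (simp add: u(1) field_simps power2_eq_square)
  have "(a + b) * min (1 / cmod u) (cmod u) \<le> a * (1 / cmod u) + b * cmod u"
    using assms unfolding distrib_right by (intro add_mono mult_left_mono) auto
  then have "Re u * ((a + b) * min (1 / cmod u) (cmod u)) \<le> Re u * (a * (1 / cmod u) + b * cmod u)"
    by (rule mult_left_mono) (use u(2) in linarith)
  also have "\<dots> = cmod u * (Re u * (a / (cmod u)^2 + b))" using nz by (simp add: field_simps power2_eq_square)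
  also have "\<dots> \<le> cmod u * cmod (of_real a / u + of_real b * u)"
    using order_trans[OF Re_kernel_pos(1)[OF u(2) assms(2-4)] complex_Re_le_cmod]
    by (intro mult_left_mono) auto
  also have "\<dots> = cmod (of_real a + of_real b * z)" by (simp add: eq norm_mult)
  finally show 1: "(a + b) * kernel_gap z \<le> cmod (of_real a + of_real b * z)"
    by (simp add: kernel_gap_def u(3)[symmetric] mult.commute mult.left_commute del: csqrt.sel norm_csqrt)
  have "0 < (a + b) * kernel_gap z" using assms kernel_gap_pos[OF assms(1)] by (intro mult_pos_pos) auto
  with 1 show "of_real a + of_real b * z \<noteq> 0" by auto
qed

text \<open>Since Im (q cnj z) = |q| |z| sin (Arg q - Arg z), the sign condition rules out a
  difference strictly between 0 and pi. A difference of exactly pi would mean z > 0 and q < 0, which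
  the last hypothesis excludes.\<close>

lemma Arg_le_I:
  assumes z: "z \<in> slit" "0 \<le> Im z" and q: "q \<noteq> 0" "0 \<le> Im q" "Im (q * cnj z) \<le> 0" "Im z = 0 \<Longrightarrow> 0 < Re q"
  shows "0 \<le> Arg q \<and> Arg q \<le> Arg z"
proof -
  have A: "0 \<le> Arg q" "Arg q \<le> pi" "0 \<le> Arg z" "Arg z < pi"
    using z q Arg_le_pi[of q] by (auto simp: Arg_nonneg_iff slit_Arg)
  have "Arg q \<le> Arg z"
  proof (rule ccontr)
    assume c: "\<not> Arg q \<le> Arg z"
    have "q * cnj z = rcis (cmod q * cmod z) (Arg q - Arg z)"
      by (metis rcis_cmod_Arg rcis_cnj rcis_mult diff_conv_add_uminus)
    then have "cmod q * cmod z * sin (Arg q - Arg z) \<le> 0" using q(3) by simp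
    then have "sin (Arg q - Arg z) \<le> 0" using q z slit_nz[of z]
      by (metis mult_pos_pos zero_less_norm_iff not_le)
    then have "\<not> (Arg q - Arg z < pi)" using c sin_gt_zero[of "Arg q - Arg z"] by linarith
    then have "Arg z = 0" "Arg q = pi" using A by linarith+
    then have "Im z = 0" "Re q < 0" using Arg_eq_0[of z] Arg_eq_pi[of q] by (auto simp: complex_is_Real_iff)
    then show False using q by auto
  qed
  with A show ?thesis by auto
qed

text \<open>Two kernels are covered at once: 1/(1 + x z) for x on the half-line, and its
  compactified form 1/(1 - p + p z) for p in [0,1]. The condition \<open>1 \<le> a x + b x\<close>
  makes the lower bound on the denominator uniform in x.\<close>

locale stieltjes = prob_space M for M :: "'a measure" +
  fixes a b :: "'a \<Rightarrow> real"
  assumes a_meas [measurable]: "a \<in> borel_measurable M" and b_meas [measurable]: "b \<in> borel_measurable M"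
    and ab: "AE x in M. 0 \<le> a x \<and> 0 \<le> b x \<and> 1 \<le> a x + b x"
begin

abbreviation ker :: "complex \<Rightarrow> 'a \<Rightarrow> complex" where
  "ker z x \<equiv> 1 / (of_real (a x) + of_real (b x) * z)"

definition W :: "complex \<Rightarrow> complex" where
  "W z = (\<integral>x. ker z x \<partial>M)"

lemma kernel_le:
  assumes "z \<in> slit"
  shows "AE x in M. cmod (ker z x) \<le> 1 / kernel_gap z"
    "AE x in M. b x * cmod (ker z x) \<le> 1 / kernel_gap z"
proof -
  have "cmod (ker z x) \<le> 1 / kernel_gap z \<and>
      b x * cmod (ker z x) \<le> 1 / kernel_gap z"
    if "0 \<le> a x \<and> 0 \<le> b x \<and> 1 \<le> a x + b x" for x
  proof -
    let ?n = "cmod (of_real (a x) + of_real (b x) * z)"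
    have k: "(a x + b x) * kernel_gap z \<le> ?n" "?n > 0"
      using kernel_bound[OF assms, of "a x" "b x"] that by auto
    have g: "kernel_gap z > 0" by (rule kernel_gap_pos[OF assms])
    have "1 * kernel_gap z \<le> (a x + b x) * kernel_gap z" "b x * kernel_gap z \<le> (a x + b x) * kernel_gap z"
      using that g by (auto intro!: mult_right_mono simp del: mult_1)
    then have "kernel_gap z \<le> ?n" "b x * kernel_gap z \<le> ?n" using k by linarith+
    then show ?thesis using k g by (simp add: norm_divide field_simps)
  qed
  with ab show "AE x in M. cmod (ker z x) \<le> 1 / kernel_gap z"
    "AE x in M. b x * cmod (ker z x) \<le> 1 / kernel_gap z"
    by (auto elim!: AE_mp)
qed

lemma integrable_kernel: "z \<in> slit \<Longrightarrow> integrable M (\<lambda>x. ker z x)"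
  by (rule integrable_const_bound[OF kernel_le(1)]) auto

text \<open>Forming the difference quotient under the integral reduces differentiability to
  dominated convergence for a product of two kernels. The factor \<open>b x\<close> is harmless
  because the denominator is bounded below by a multiple of \<open>a x + b x\<close>.\<close>

lemma W_difference:
  assumes z: "z \<in> slit" and w: "w \<in> slit"
  shows "W w - W z = (w - z) * (\<integral>x. - of_real (b x) * ker w x
      * ker z x \<partial>M)"
proof -
  have "W w - W z = (\<integral>x. ker w x - ker z x \<partial>M)"
    unfolding W_def using z w by (subst Bochner_Integration.integral_diff) (auto intro: integrable_kernel)
  also have "\<dots> = (\<integral>x. (w - z) * (- of_real (b x) * ker w x
      * ker z x) \<partial>M)"
  proof (rule integral_cong_AE)
    show "AE x in M. ker w x - ker z x
       = (w - z) * (- of_real (b x) * ker w x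
      * ker z x)"
      using ab
    proof (eventually_elim)
      case (elim x)
      then show ?case using kernel_bound(2)[OF z, of "a x" "b x"] kernel_bound(2)[OF w, of "a x" "b x"]
        by (simp add: divide_simps) (simp add: algebra_simps)
    qed
  qed auto
  finally show ?thesis by (simp only: integral_mult_right_zero)
qed

lemma W_holomorphic: "W holomorphic_on slit"
  unfolding holomorphic_on_def
proof
  fix z assume z: "z \<in> slit"
  define h where "h w = (\<integral>x. - of_real (b x) * ker w x
      * ker z x \<partial>M)" for w
  have lim: "(h \<longlongrightarrow> h z) (at z within slit)"
    unfolding tendsto_at_iff_sequentially
  proof (intro allI impI)
    fix X assume X: "\<forall>i. X i \<in> slit - {z}" "X \<longlonglongrightarrow> z"
    \<comment> \<open>The gap is continuous and positive at \<open>z\<close>, so its reciprocals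
      along the sequence are bounded; this yields a constant dominating function.\<close>
    have "(\<lambda>i. kernel_gap (X i)) \<longlonglongrightarrow> kernel_gap z"
      using X z by (intro continuous_on_tendsto_compose[OF continuous_on_kernel_gap]) auto
    then have "(\<lambda>i. 1 / kernel_gap (X i)) \<longlonglongrightarrow> 1 / kernel_gap z"
      using kernel_gap_pos[OF z] by (intro tendsto_intros) auto
    then have "Bseq (\<lambda>i. 1 / kernel_gap (X i))" by (intro convergent_imp_Bseq) (auto simp: convergent_def)
    then obtain B where B: "B > 0" "\<And>i. norm (1 / kernel_gap (X i)) \<le> B" by (auto simp: Bseq_def)
    show "(h \<circ> X) \<longlonglongrightarrow> h z"
      unfolding o_def h_def
    proof (rule integral_dominated_convergence[where w = "\<lambda>_. B * (1 / kernel_gap z)"])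
      show "AE x in M. (\<lambda>i. - of_real (b x) * (ker (X i) x) *
             (ker z x))
         \<longlonglongrightarrow> - of_real (b x) * ker z x *
            (ker z x)"
        using ab
      proof (eventually_elim)
        case (elim x)
        then show ?case using X(2) kernel_bound(2)[OF z, of "a x" "b x"] by (intro tendsto_intros) auto
      qed
      fix i
      have Xi: "X i \<in> slit" using X by auto
      show "AE x in M. cmod (- of_real (b x) *
                   (ker (X i) x) *
                   (ker z x))
           \<le> B * (1 / kernel_gap z)"
        using kernel_le(2)[OF Xi] kernel_le(1)[OF z] ab
      proof (eventually_elim)
        case (elim x)
        have "cmod (- of_real (b x) *
                   (ker (X i) x) *
                   (ker z x))
           = b x * cmod (ker (X i) x) *
             cmod (ker z x)"
          using elim by (simp add: norm_mult norm_divide)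
        also have "\<dots> \<le> B * (1 / kernel_gap z)"
        proof (rule mult_mono)
          show "b x * cmod (ker (X i) x) \<le> B"
            using elim(1) B(2)[of i] kernel_gap_pos[OF Xi] by simp
        qed (use elim B in auto)
        finally show ?case .
      qed
    qed auto
  qed
  have "(W has_field_derivative h z) (at z within slit)"
    unfolding has_field_derivative_iff
  proof (rule Lim_transform_eventually[OF lim])
    show "\<forall>\<^sub>F w in at z within slit. h w = (W w - W z) / (w - z)"
      using z by (auto simp: eventually_at_filter W_difference h_def)
  qed
  then show "W field_differentiable at z within slit"
    unfolding field_differentiable_def by blast
qed

lemma W_cnj:
  assumes "z \<in> slit" shows "W (cnj z) = cnj (W z)"
proof -
  have "cnj (W z) = (\<integral>x. cnj (ker z x) \<partial>M)"
    unfolding W_def by (rule Bochner_Integration.integral_cnj[symmetric])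
  then show ?thesis by (simp add: W_def)
qed

lemma kernel_of_real:
  "1 / (of_real (a x) + of_real (b x) * of_real s) = complex_of_real (1 / (a x + b x * s))"
  by simp

lemma integrable_kernel_real:
  assumes "s > 0" shows "integrable M (\<lambda>x. 1 / (a x + b x * s))"
proof -
  have "integrable M (\<lambda>x. Re (1 / (of_real (a x) + of_real (b x) * complex_of_real s)))"
    using assms by (intro integrable_Re integrable_kernel) auto
  then show ?thesis by (simp only: kernel_of_real Re_complex_of_real)
qed

lemma W_of_real: "W (of_real s) = of_real (\<integral>x. 1 / (a x + b x * s) \<partial>M)"
  unfolding W_def kernel_of_real by (rule integral_complex_of_real)

text \<open>Multiplied by u = \<open>csqrt z\<close>, the kernel becomes 1/(a/u + b u), which has
  positive real part. In particular \<open>W\<close> has no zeros and may be inverted.\<close>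

lemma Re_csqrt_W_pos:
  assumes z: "z \<in> slit" shows "Re (csqrt z * W z) > 0"
proof -
  let ?u = "csqrt z"
  have u: "z = ?u^2" "Re ?u > 0" using z slit_Re_csqrt by (simp_all del: csqrt.sel)
  then have nz: "?u \<noteq> 0" by (metis less_irrefl zero_complex.sel(1))
  have "csqrt z * W z = (\<integral>x. ?u * ker z x \<partial>M)"
    unfolding W_def by (rule integral_mult_right_zero[symmetric])
  then have "Re (csqrt z * W z) = (\<integral>x. Re (?u * ker z x) \<partial>M)"
    using z by (simp only:) (intro integral_Re[symmetric] integrable_mult_right integrable_kernel)
  moreover have "(\<integral>x. 0 \<partial>M) < (\<integral>x. Re (?u * ker z x) \<partial>M)"
  proof (rule integral_less_AE_space)
    show "integrable M (\<lambda>x. Re (?u * ker z x))"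
      using z by (intro integrable_Re integrable_mult_right integrable_kernel)
    show "AE x in M. 0 < Re (?u * ker z x)"
      using ab
    proof eventually_elim
      case (elim x)
      let ?v = "of_real (a x) / ?u + of_real (b x) * ?u"
      have "?u * ker z x = 1 / ?v"
        using nz by (subst u(1)) (simp add: field_simps power2_eq_square del: csqrt.sel power2_csqrt)
      moreover have "Re ?v > 0" using Re_kernel_pos[OF u(2), of "a x" "b x"] elim by linarith
      moreover then have "?v \<noteq> 0" by (metis less_irrefl zero_complex.sel(1))
      ultimately show ?case by (simp only: Re_divide) (auto simp: sum_power2_gt_zero_iff complex_eq_iff simp del: csqrt.sel intro!: divide_pos_pos)
    qed
    show "emeasure M (space M) \<noteq> 0" using emeasure_space_1 by simp
  qed auto
  ultimately show ?thesis by (simp del: csqrt.sel)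
qed

lemma W_nz: "z \<in> slit \<Longrightarrow> W z \<noteq> 0"
  using Re_csqrt_W_pos[of z] by auto

lemma W_of_real_pos: "s > 0 \<Longrightarrow> (\<integral>x. 1 / (a x + b x * s) \<partial>M) > 0"
  using Re_csqrt_W_pos[of "of_real s"] by (simp add: W_of_real zero_less_mult_iff)

text \<open>In the closed upper half-plane Im (1/(a + b z)) \<le> 0 and Im (z/(a + b z)) \<ge> 0.
  Both signs survive integration, and together they say 0 \<le> Arg (1/W z) \<le> Arg z.\<close>

lemma cbf_inverse_W: "cbf (\<lambda>z. 1 / W z)"
proof (rule cbfI)
  show "(\<lambda>z. 1 / W z) holomorphic_on slit"
    by (intro holomorphic_intros W_holomorphic W_nz)
  show "1 / W (cnj z) = cnj (1 / W z)" if "z \<in> slit" for z using that by (simp add: W_cnj)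
  fix z assume z: "z \<in> slit" "0 \<le> Im z"
  have k: "Im (ker z x) \<le> 0 \<and> 0 \<le> Im (z * ker z x)"
    if "0 \<le> a x \<and> 0 \<le> b x \<and> 1 \<le> a x + b x" for x
  proof -
    let ?d = "of_real (a x) + of_real (b x) * z"
    have "Im (1 / ?d) = - (b x * Im z) / (cmod ?d)\<^sup>2"
      by (simp add: Im_divide cmod_power2)
    moreover have "Im (z * (1 / ?d)) = (a x * Im z) / (cmod ?d)\<^sup>2"
      by (simp add: Im_divide cmod_power2 algebra_simps)
    ultimately show ?thesis using that z by simp
  qed
  have 1: "Im (W z) \<le> 0"
  proof -
    have "Im (W z) = (\<integral>x. Im (ker z x) \<partial>M)"
      unfolding W_def using z by (intro integral_Im[symmetric] integrable_kernel)
    also have "\<dots> \<le> (\<integral>x. 0 \<partial>M)"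
      using z by (intro integral_mono_AE integrable_Im integrable_kernel) (use ab k in \<open>auto elim!: AE_mp\<close>)
    finally show ?thesis by simp
  qed
  have 2: "0 \<le> Im (z * W z)"
  proof -
    have "z * W z = (\<integral>x. z * ker z x \<partial>M)" unfolding W_def by (rule integral_mult_right_zero[symmetric])
    then have "Im (z * W z) = (\<integral>x. Im (z * ker z x) \<partial>M)"
      using z by (simp only:) (intro integral_Im[symmetric] integrable_mult_right integrable_kernel)
    moreover have "0 \<le> (\<integral>x. Im (z * ker z x) \<partial>M)"
      by (rule integral_nonneg_AE) (use ab k in \<open>auto elim!: AE_mp\<close>)
    ultimately show ?thesis by simp
  qed
  have nz: "W z \<noteq> 0" using z W_nz by blast
  have pos: "(Re (W z))\<^sup>2 + (Im (W z))\<^sup>2 > 0" using nz by (auto simp: sum_power2_gt_zero_iff complex_eq_iff)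
  have "0 \<le> Arg (1 / W z) \<and> Arg (1 / W z) \<le> Arg z"
  proof (rule Arg_le_I[OF z])
    show "1 / W z \<noteq> 0" using nz by simp
    show "0 \<le> Im (1 / W z)" using 1 by (simp add: Im_divide divide_nonpos_nonneg)
    have "1 / W z * cnj z = cnj (z * W z) / of_real ((cmod (W z))^2)"
      unfolding complex_norm_square using nz by (simp add: field_simps)
    then have "Im (1 / W z * cnj z) = - Im (z * W z) / (cmod (W z))^2"
      by (simp only: Im_divide_of_real cnj.sel)
    then show "Im (1 / W z * cnj z) \<le> 0" using 2 by (simp only:) (intro divide_nonpos_nonneg, auto)
    assume "Im z = 0"
    then have s: "z = of_real (Re z)" "Re z > 0" using z by (auto simp: complex_eq_iff slit_iff)
    have "1 / W z = of_real (1 / (\<integral>x. 1 / (a x + b x * Re z) \<partial>M))"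
      by (subst s(1), subst W_of_real) simp
    then show "0 < Re (1 / W z)" using W_of_real_pos[OF s(2)] by (simp only: Re_complex_of_real) simp
  qed
  then show "1 / W z \<noteq> 0 \<and> 0 \<le> Arg (1 / W z) \<and> Arg (1 / W z) \<le> Arg z" using nz by simp
qed

end

section \<open>Weak compactness and the Poisson formula\<close>

abbreviation unit_tr :: "real measure \<Rightarrow> real \<Rightarrow> real" where
  "unit_tr T s \<equiv> \<integral>p. 1 / (1 - p + p * s) \<partial>T"

lemma unit_kernel_bound:
  assumes "(s::real) > 0" "0 \<le> p" "p \<le> 1"
  shows "min 1 s \<le> 1 - p + p * s"
proof -
  have "min 1 s = (1 - p) * min 1 s + p * min 1 s" by (simp add: algebra_simps)
  also have "\<dots> \<le> (1 - p) * 1 + p * s" using assms by (intro add_mono mult_left_mono) auto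
  finally show ?thesis by simp
qed

text \<open>All mass sits in [0,1], so tightness is automatic. Pushing the weak limit forward by the
  clamp \<open>c\<close> settles its support, and the kernel composed with \<open>c\<close> is
  bounded and continuous on the whole line, so weak convergence applies to it.\<close>

lemma unit_kernel_helly:
  fixes T :: "nat \<Rightarrow> real measure"
  assumes T: "\<And>n. real_distribution (T n)" and supp: "\<And>n. AE p in T n. p \<in> {0..1}"
  obtains r :: "nat \<Rightarrow> nat" and T' where "strict_mono r" "real_distribution T'" "AE p in T'. p \<in> {0..1}"
    "\<And>s. s > 0 \<Longrightarrow> (\<lambda>n. unit_tr (T (r n)) s) \<longlonglongrightarrow> unit_tr T' s"
proof -
  interpret T: real_distribution "T n" for n by (rule T)
  \<comment> \<open>\<open>tight\<close> speaks of intervals open on the left; starting at -1 keeps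
    a possible atom at 0 inside.\<close>
  have one: "measure (T n) {-1<..1} = 1" for n
    by (rule T.prob_eq_1[THEN iffD2]) (use supp[of n] in \<open>auto elim!: AE_mp\<close>)
  have "tight T"
    unfolding tight_def
  proof (intro conjI allI impI T)
    fix e :: real assume "e > 0"
    then show "\<exists>a b. a < b \<and> (\<forall>n. 1 - e < measure (T n) {a<..b})"
      by (intro exI[of _ "-1"] exI[of _ 1]) (simp add: one)
  qed
  from tight_imp_convergent_subsubsequence[OF this strict_mono_id]
  obtain r M where r: "strict_mono r" and M: "real_distribution M" and conv: "weak_conv_m (T \<circ> id \<circ> r) M"
    by blast
  interpret M: real_distribution M by (rule M)
  define c :: "real \<Rightarrow> real" where "c p = max 0 (min 1 p)" for p
  have c: "0 \<le> c p" "c p \<le> 1" "c (c p) = c p" for p by (auto simp: c_def)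
  have cc: "continuous_on UNIV c" unfolding c_def by (intro continuous_intros)
  have [measurable]: "c \<in> borel_measurable borel" by (intro borel_measurable_continuous_onI cc)
  define T' where "T' = distr M borel c"
  have T': "real_distribution T'" unfolding T'_def by (rule M.real_distribution_distr) simp
  have supp': "AE p in T'. p \<in> {0..1}" unfolding T'_def by (subst AE_distr_iff) (auto simp: c)
  show thesis
  proof (rule that[OF r T' supp'])
    fix s :: real assume s: "s > 0"
    define k where "k p = 1 / (1 - c p + c p * s)" for p
    have kpos: "min 1 s \<le> 1 - c p + c p * s" "0 < 1 - c p + c p * s" for p
      using unit_kernel_bound[OF s c(1,2)[of p]] s by auto
    have kb: "norm (k p) \<le> 1 / min 1 s" for p
      using kpos[of p] s by (simp add: k_def field_simps)
    have "continuous_on UNIV k"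
      unfolding k_def using kpos(2) by (intro continuous_intros cc) (auto simp: less_imp_neq[symmetric])
    then have kc: "isCont k p" for p by (simp add: continuous_on_eq_continuous_at)
    have [measurable]: "k \<in> borel_measurable borel"
      using \<open>continuous_on UNIV k\<close> by (rule borel_measurable_continuous_onI)
    have "(\<lambda>n. integral\<^sup>L ((T \<circ> id \<circ> r) n) k) \<longlonglongrightarrow> integral\<^sup>L M k"
      by (rule weak_conv_imp_integral_bdd_continuous_conv[OF _ M conv kc kb]) (simp add: T)
    moreover have "integral\<^sup>L ((T \<circ> id \<circ> r) n) k = unit_tr (T (r n)) s" for n
      unfolding o_def id_def
      by (rule integral_cong_AE) (use supp[of "r n"] in \<open>auto elim!: AE_mp simp: k_def c_def\<close>)
    moreover have "integral\<^sup>L M k = unit_tr T' s"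
      unfolding T'_def by (subst integral_distr) (auto simp: k_def[abs_def])
    ultimately show "(\<lambda>n. unit_tr (T (r n)) s) \<longlonglongrightarrow> unit_tr T' s"
      by simp
  qed
qed

text \<open>The Poisson formula, obtained by adding to Cauchy's formula the vanishing integral of
  \<open>F u * x / (1 - x * u)\<close>.\<close>
lemma Poisson_formula_real_point:
  fixes x :: real
  assumes F: "F holomorphic_on cball 0 1" and x: "\<bar>x\<bar> < 1"
  shows "((\<lambda>t. of_real ((1 - x\<^sup>2) / (1 - 2 * x * cos (2 * pi * t) + x\<^sup>2)) * F (cis (2 * pi * t)))
           has_integral F (of_real x)) {0..1}"
proof -
  have xu: "1 - of_real x * u \<noteq> 0" if "norm u \<le> 1" for u :: complex
  proof
    assume "1 - of_real x * u = 0"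
    then have "norm (of_real x * u) = 1" by (metis norm_one right_minus_eq)
    moreover have "norm (of_real x * u) \<le> \<bar>x\<bar> * 1" using that by (simp add: norm_mult mult_left_le)
    ultimately show False using x by simp
  qed
  have 1: "((\<lambda>u. F u / (u - of_real x)) has_contour_integral (2 * of_real pi * \<i> * F (of_real x))) (circlepath 0 1)"
    by (rule Cauchy_integral_circlepath_simple[OF F]) (use x in simp)
  have "(\<lambda>u. F u * of_real x / (1 - of_real x * u)) holomorphic_on cball 0 1"
    using xu by (intro holomorphic_intros F) auto
  then have 2: "((\<lambda>u. F u * of_real x / (1 - of_real x * u)) has_contour_integral 0) (circlepath 0 1)"
    by (intro Cauchy_theorem_convex_simple[of _ "cball 0 1"]) auto
  have "((\<lambda>u. F u / (u - of_real x) + F u * of_real x / (1 - of_real x * u)) has_contour_integral (2 * of_real pi * \<i> * F (of_real x))) (circlepath 0 1)"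
    using has_contour_integral_add[OF 1 2] by simp
  then have "((\<lambda>t. (F (circlepath 0 1 t) / (circlepath 0 1 t - of_real x) + F (circlepath 0 1 t) * of_real x / (1 - of_real x * circlepath 0 1 t))
     * vector_derivative (circlepath 0 1) (at t)) has_integral (2 * of_real pi * \<i> * F (of_real x))) {0..1}"
    unfolding has_contour_integral .
  then have "((\<lambda>t. (1 / (2 * of_real pi * \<i>)) * ((F (circlepath 0 1 t) / (circlepath 0 1 t - of_real x) + F (circlepath 0 1 t) * of_real x / (1 - of_real x * circlepath 0 1 t))
     * vector_derivative (circlepath 0 1) (at t))) has_integral (1 / (2 * of_real pi * \<i>)) * (2 * of_real pi * \<i> * F (of_real x))) {0..1}"
    by (rule has_integral_mult_right)
  moreover have "(1 / (2 * of_real pi * \<i>)) * (2 * of_real pi * \<i> * F (of_real x)) = F (of_real x)" by simp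
  moreover have "(1 / (2 * of_real pi * \<i>)) * ((F (circlepath 0 1 t) / (circlepath 0 1 t - of_real x) + F (circlepath 0 1 t) * of_real x / (1 - of_real x * circlepath 0 1 t))
     * vector_derivative (circlepath 0 1) (at t)) = of_real ((1 - x\<^sup>2) / (1 - 2 * x * cos (2 * pi * t) + x\<^sup>2)) * F (cis (2 * pi * t))" for t
  proof -
    let ?u = "cis (2 * pi * t)"
    have c: "circlepath 0 1 t = ?u" by (simp add: circlepath cis_conv_exp mult_ac)
    have d: "vector_derivative (circlepath 0 1) (at t) = 2 * of_real pi * \<i> * ?u"
      by (simp add: vector_derivative_circlepath cis_conv_exp mult_ac)
    have nu: "norm ?u = 1" by simp
    have n1: "1 - of_real x * ?u \<noteq> 0" using xu[of ?u] by simp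
    have n2: "?u - of_real x \<noteq> 0"
    proof
      assume "?u - of_real x = 0"
      then have "norm ?u = \<bar>x\<bar>" by (metis eq_iff_diff_eq_0 norm_of_real)
      then show False using x by simp
    qed
    have uc: "?u * cnj ?u = 1" using complex_norm_square[of ?u] by simp
    \<comment> \<open>Because u cnj u = 1, the product of the two denominators is u |u - x|^2, which
      contains the real denominator of the Poisson kernel.\<close>
    have den: "(?u - of_real x) * (1 - of_real x * ?u) = ?u * of_real (1 - 2 * x * cos (2 * pi * t) + x\<^sup>2)"
    proof -
      have C: "2 * complex_of_real (cos (2 * pi * t)) = ?u + cnj ?u" by (simp add: complex_eq_iff)
      have "complex_of_real (1 - 2 * x * cos (2 * pi * t) + x\<^sup>2)
          = 1 - of_real x * (2 * complex_of_real (cos (2 * pi * t))) + (of_real x)\<^sup>2"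
        by simp
      then have "?u * of_real (1 - 2 * x * cos (2 * pi * t) + x\<^sup>2) = ?u * (1 - of_real x * (?u + cnj ?u) + (of_real x)\<^sup>2)"
        unfolding C by (rule arg_cong)
      also have "\<dots> = ?u - of_real x * ?u * ?u - of_real x * (?u * cnj ?u) + ?u * (of_real x)\<^sup>2"
        by (simp add: algebra_simps)
      also have "\<dots> = (?u - of_real x) * (1 - of_real x * ?u)"
        unfolding uc by (simp add: algebra_simps power2_eq_square)
      finally show ?thesis by simp
    qed
    then have dn: "of_real (1 - 2 * x * cos (2 * pi * t) + x\<^sup>2) \<noteq> (0::complex)"
      using n1 n2 by (metis mult_eq_0_iff)
    have "1 / (?u - of_real x) + of_real x / (1 - of_real x * ?u)
       = (1 - (of_real x)\<^sup>2) / ((?u - of_real x) * (1 - of_real x * ?u))"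
      using n1 n2 by (simp add: divide_simps) (simp add: algebra_simps power2_eq_square)
    also have "\<dots> = (1 - (of_real x)\<^sup>2) / (?u * of_real (1 - 2 * x * cos (2 * pi * t) + x\<^sup>2))"
      unfolding den ..
    finally have e: "(1 / (?u - of_real x) + of_real x / (1 - of_real x * ?u)) * ?u = of_real ((1 - x\<^sup>2) / (1 - 2 * x * cos (2 * pi * t) + x\<^sup>2))"
      using dn by (simp only: of_real_divide of_real_diff[of 1] of_real_1 of_real_power) (simp only: divide_simps, simp)
    have "(1 / (2 * of_real pi * \<i>)) * ((F ?u / (?u - of_real x) + F ?u * of_real x / (1 - of_real x * ?u)) * (2 * of_real pi * \<i> * ?u))
       = F ?u * ((1 / (?u - of_real x) + of_real x / (1 - of_real x * ?u)) * ?u)"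
      by (simp add: field_simps)
    then show ?thesis unfolding c d e by (simp only: mult.commute)
  qed
  ultimately show ?thesis by (simp only:)
qed

section \<open>Integral representation\<close>

text \<open>\<open>T\<close> is the boundary density Re F / m, carried from the circle to [0,1] by p
  = (1 - cos)/2. At x = (u-1)/(u+1) the Poisson kernel equals u/(1 - p + p u^2), so the formula at
  real points of the disc is already the transform of \<open>T\<close> at u^2.\<close>

lemma Poisson_measure:
  assumes F: "F holomorphic_on cball 0 1" and pos: "\<And>u. norm u = 1 \<Longrightarrow> 0 \<le> Re (F u)"
    and m: "F 0 = of_real m" "m > 0"
  obtains T where "real_distribution T" "AE p in T. p \<in> {0..1}"
    "\<And>u. u > 0 \<Longrightarrow> Re (F (of_real ((u - 1) / (u + 1)))) = m * (u * (\<integral>p. 1 / (1 - p + p * u\<^sup>2) \<partial>T))"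
proof -
  define R where "R t = Re (F (cis (2 * pi * t)))" for t
  define P where "P t = (1 - cos (2 * pi * t)) / 2" for t
  have "continuous_on (cball 0 1) F" using F by (rule holomorphic_on_imp_continuous_on)
  then have "continuous_on {0..1} (\<lambda>t. F (cis (2 * pi * t)))"
    by (rule continuous_on_compose2) (auto intro!: continuous_intros)
  then have Rc: "continuous_on {0..1} R" unfolding R_def by (intro continuous_intros)
  have Rpos: "0 \<le> R t" for t unfolding R_def by (intro pos) simp
  have Pc: "continuous_on A P" for A unfolding P_def by (intro continuous_intros) auto
  have P01: "0 \<le> P t" "P t \<le> 1" for t
    using cos_ge_minus_one[of "2*pi*t"] cos_le_one[of "2*pi*t"] by (auto simp: P_def field_simps simp del: cos_ge_minus_one cos_le_one)
  define D where "D t = indicator {0..1} t * (R t / m)" for t :: real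
  have int: "integrable lborel (\<lambda>t. indicator {0..1} t * g t)" and
    val: "(\<integral>t. indicator {0..1} t * g t \<partial>lborel) = integral {0..1} g"
    if "continuous_on {0..1} g" for g :: "real \<Rightarrow> real"
    using borel_integrable_atLeastAtMost'[OF that] set_borel_integral_eq_integral(2)[of "{0..1}" g]
    by (auto simp: set_integrable_def set_lebesgue_integral_def)
  have Dc: "continuous_on {0..1} (\<lambda>t. R t / m)" using m by (intro continuous_intros Rc) auto
  have D0: "0 \<le> D t" for t using Rpos m by (auto simp: D_def indicator_def)
  have Di: "integrable lborel D" unfolding D_def by (rule int[OF Dc])
  then have [measurable]: "D \<in> borel_measurable borel" by auto
  have formula: "Re (F (of_real x)) = integral {0..1} (\<lambda>t. (1 - x\<^sup>2) / (1 - 2 * x * cos (2 * pi * t) + x\<^sup>2) * R t)"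
    if "\<bar>x\<bar> < 1" for x
  proof -
    from has_integral_Re[OF Poisson_formula_real_point[OF F that]]
    have "((\<lambda>t. (1 - x\<^sup>2) / (1 - 2 * x * cos (2 * pi * t) + x\<^sup>2) * R t) has_integral Re (F (of_real x))) {0..1}"
      unfolding R_def by (simp only: Re_complex_of_real times_complex.sel Im_complex_of_real mult_zero_left diff_zero)
    then show ?thesis by (simp add: integral_unique)
  qed
  \<comment> \<open>At x = 0 the Poisson formula is the mean value property; it gives the density
    R/m total mass 1.\<close>
  have "m = integral {0..1} R" using formula[of 0] m by simp
  moreover have "integral {0..1} (\<lambda>t. R t / m) = integral {0..1} R / m" by simp
  ultimately have D1: "(\<integral>t. D t \<partial>lborel) = 1"
    unfolding D_def val[OF Dc] using m by simp
  define N where "N = density lborel (\<lambda>t. ennreal (D t))"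
  have "emeasure N (space N) = (\<integral>\<^sup>+ t. ennreal (D t) \<partial>lborel)"
    unfolding N_def by (simp add: emeasure_density)
  also have "\<dots> = ennreal (\<integral>t. D t \<partial>lborel)" using Di D0 by (intro nn_integral_eq_integral) auto
  finally interpret N: prob_space N using D1 by (intro prob_spaceI) simp
  have [measurable]: "P \<in> borel_measurable borel" by (intro borel_measurable_continuous_onI Pc)
  have [measurable]: "P \<in> borel_measurable N" by (simp add: N_def)
  define T where "T = distr N borel P"
  show thesis
  proof (rule that)
    show "real_distribution T" unfolding T_def by (rule N.real_distribution_distr) simp
    show "AE p in T. p \<in> {0..1}" unfolding T_def by (subst AE_distr_iff) (auto simp: P01)
    fix u :: real assume u: "u > 0"
    define x where "x = (u - 1) / (u + 1)"
    have x: "\<bar>x\<bar> < 1" using u by (simp add: x_def field_simps abs_if)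
    have kp: "0 < 1 - P t + P t * u\<^sup>2" for t
      by (rule less_le_trans[OF _ unit_kernel_bound[of "u\<^sup>2" "P t"]]) (use P01[of t] u in auto)
    have k: "(1 - x\<^sup>2) / (1 - 2 * x * cos (2 * pi * t) + x\<^sup>2) = u * (1 / (1 - P t + P t * u\<^sup>2))" for t
    proof -
      have c: "cos (2 * pi * t) = 1 - 2 * P t" by (simp add: P_def field_simps)
      have 1: "1 - x\<^sup>2 = 4 * u / (u + 1)\<^sup>2" using u by (simp add: x_def power_divide divide_simps) (simp add: algebra_simps power2_eq_square)
      have 2: "1 - 2 * x * cos (2 * pi * t) + x\<^sup>2 = 4 * (1 - P t + P t * u\<^sup>2) / (u + 1)\<^sup>2"
        unfolding c using u by (simp add: x_def power_divide divide_simps) (simp add: algebra_simps power2_eq_square)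
      show ?thesis unfolding 1 2 using u kp[of t] by (simp add: divide_simps)
    qed
    have gc: "continuous_on {0..1} (\<lambda>t. R t / m * (1 / (1 - P t + P t * u\<^sup>2)))"
      using m kp by (intro continuous_intros Rc Pc) (auto simp: less_imp_neq[symmetric])
    have "(\<integral>p. 1 / (1 - p + p * u\<^sup>2) \<partial>T) = (\<integral>t. 1 / (1 - P t + P t * u\<^sup>2) \<partial>N)"
      unfolding T_def by (rule integral_distr) simp_all
    also have "\<dots> = (\<integral>t. D t * (1 / (1 - P t + P t * u\<^sup>2)) \<partial>lborel)"
      unfolding N_def by (subst integral_density) (auto simp: D0)
    also have "\<dots> = (\<integral>t. indicator {0..1} t * (R t / m * (1 / (1 - P t + P t * u\<^sup>2))) \<partial>lborel)"
      by (simp add: D_def mult.assoc)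
    also have "\<dots> = integral {0..1} (\<lambda>t. R t / m * (1 / (1 - P t + P t * u\<^sup>2)))" by (rule val[OF gc])
    finally have "m * (u * (\<integral>p. 1 / (1 - p + p * u\<^sup>2) \<partial>T))
        = (m * u) * integral {0..1} (\<lambda>t. R t / m * (1 / (1 - P t + P t * u\<^sup>2)))" by simp
    also have "\<dots> = integral {0..1} (\<lambda>t. (m * u) * (R t / m * (1 / (1 - P t + P t * u\<^sup>2))))"
      by (rule integral_mult_right[symmetric])
    also have "\<dots> = integral {0..1} (\<lambda>t. (1 - x\<^sup>2) / (1 - 2 * x * cos (2 * pi * t) + x\<^sup>2) * R t)"
      unfolding k using m by (intro integral_cong) simp
    also have "\<dots> = Re (F (of_real x))" by (rule formula[OF x, symmetric])
    finally show "Re (F (of_real ((u - 1) / (u + 1)))) = m * (u * (\<integral>p. 1 / (1 - p + p * u\<^sup>2) \<partial>T))"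
      by (simp only: x_def)
  qed
qed

lemma Re_Cayley_pos:
  assumes "norm w < 1" shows "w \<noteq> 1" "Re ((1 + w) / (1 - w)) > 0"
proof -
  show "w \<noteq> 1" using assms by auto
  then have nz: "1 - w \<noteq> 0" by simp
  have "Re ((1 + w) * cnj (1 - w)) = 1 - (cmod w)\<^sup>2"
    unfolding cmod_power2 by (simp add: algebra_simps power2_eq_square)
  moreover have "(cmod w)\<^sup>2 < 1" using assms by (simp add: power_less_one_iff)
  ultimately have "Re ((1 + w) * cnj (1 - w)) > 0" by simp
  then show "Re ((1 + w) / (1 - w)) > 0"
    by (simp only: Re_complex_div_gt_0)
qed

text \<open>The Cayley map \<open>C\<close> sends the disc to the right half-plane and its square
  sends the disc to the slit plane, so h = C/q(C^2) has nonnegative real part there. As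
  \<open>h\<close> may fail to extend to the circle, measures are formed on smaller radii and a
  limit is extracted. The hypotheses are phrased without \<open>cbf\<close> so that functions of the
  form 1 + f qualify.\<close>

theorem stieltjes_representation:
  assumes holo: "q holomorphic_on slit" and nz: "\<And>z. z \<in> slit \<Longrightarrow> q z \<noteq> 0"
    and Req: "\<And>z. z \<in> slit \<Longrightarrow> 0 \<le> Re (csqrt z * cnj (q z))"
    and real: "\<And>s. s > 0 \<Longrightarrow> q (of_real s) = of_real (Q s)" and pos: "\<And>s. s > 0 \<Longrightarrow> 0 < Q s"
  obtains T where "real_distribution T" "AE p in T. p \<in> {0..1}"
    "\<And>s. s > 0 \<Longrightarrow> 1 / Q s = 1 / Q 1 * unit_tr T s"
proof -
  define C :: "complex \<Rightarrow> complex" where "C w = (1 + w) / (1 - w)" for w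
  define h where "h w = C w / q ((C w)\<^sup>2)" for w
  have C: "Re (C w) > 0" "C w \<noteq> 0" "(C w)\<^sup>2 \<in> slit" "csqrt ((C w)\<^sup>2) = C w" if "w \<in> ball 0 1" for w
  proof -
    show 1: "Re (C w) > 0" using that Re_Cayley_pos[of w] by (simp add: C_def)
    then show "C w \<noteq> 0" by auto
    show 2: "csqrt ((C w)\<^sup>2) = C w" using 1 by (intro csqrt_square) simp
    show "(C w)\<^sup>2 \<in> slit" using 1 2 by (simp only: slit_Re_csqrt)
  qed
  have Ch: "C holomorphic_on ball 0 1" unfolding C_def by (intro holomorphic_intros) auto
  have "(\<lambda>w. q ((C w)\<^sup>2)) holomorphic_on ball 0 1"
    using holomorphic_on_compose_gen[OF holomorphic_on_power[OF Ch] holo, of 2] C(3) by (fastforce simp: o_def)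
  then have hh: "h holomorphic_on ball 0 1"
    unfolding h_def using C nz by (intro holomorphic_intros Ch) auto
  have hRe: "0 \<le> Re (h w)" if "w \<in> ball 0 1" for w
  proof -
    have "0 \<le> Re (C w * cnj (q ((C w)\<^sup>2)))" using Req[OF C(3)[OF that]] C(4)[OF that] by simp
    then show ?thesis unfolding h_def by (simp only: Re_complex_div_ge_0)
  qed
  define m where "m = 1 / Q 1"
  have m: "m > 0" "h 0 = of_real m" using pos[of 1] real[of 1] by (auto simp: m_def h_def C_def)
  \<comment> \<open>The shift by 2 keeps the radius strictly between 0 and 1 also at n = 0.\<close>
  define \<rho> :: "nat \<Rightarrow> real" where "\<rho> n = 1 - 1 / (real n + 2)" for n
  have \<rho>: "0 < \<rho> n" "\<rho> n < 1" for n by (auto simp: \<rho>_def)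
  have \<rho>lim: "\<rho> \<longlonglongrightarrow> 1" unfolding \<rho>_def by real_asymp
  have in_ball: "complex_of_real (\<rho> n) * w \<in> ball 0 1" if "norm w \<le> 1" for n and w :: complex
  proof -
    have "norm (complex_of_real (\<rho> n) * w) \<le> \<rho> n * 1" using that \<rho>(1)[of n] by (simp add: norm_mult mult_left_le)
    then show ?thesis using \<rho>(2)[of n] by (simp add: norm_mult)
  qed
  have "\<exists>T. real_distribution T \<and> (AE p in T. p \<in> {0..1}) \<and>
    (\<forall>u>0. Re (h (of_real (\<rho> n) * of_real ((u - 1) / (u + 1)))) = m * (u * (\<integral>p. 1 / (1 - p + p * u\<^sup>2) \<partial>T)))" for n
  proof -
    have hol: "(\<lambda>w. h (of_real (\<rho> n) * w)) holomorphic_on cball 0 1"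
      using holomorphic_on_compose_gen[of "\<lambda>w. of_real (\<rho> n) * w" "cball 0 1" h "ball 0 1"] hh in_ball
      by (fastforce simp: o_def intro: holomorphic_intros)
    have A: "0 \<le> Re (h (of_real (\<rho> n) * u))" if "norm u = 1" for u
      using hRe in_ball that by simp
    have B: "h (of_real (\<rho> n) * 0) = of_real m" using m by simp
    show ?thesis by (rule Poisson_measure[OF hol A B m(1)]) blast+
  qed
  then obtain T where "\<forall>n. real_distribution (T n) \<and> (AE p in T n. p \<in> {0..1}) \<and>
    (\<forall>u>0. Re (h (of_real (\<rho> n) * of_real ((u - 1) / (u + 1)))) = m * (u * (\<integral>p. 1 / (1 - p + p * u\<^sup>2) \<partial>(T n))))"
    by (rule choice[OF allI, THEN exE])
  then have T: "\<And>n. real_distribution (T n)" "\<And>n. AE p in T n. p \<in> {0..1}"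
    and Tu: "\<And>n u. u > 0 \<Longrightarrow> Re (h (of_real (\<rho> n) * of_real ((u - 1) / (u + 1)))) = m * (u * (\<integral>p. 1 / (1 - p + p * u\<^sup>2) \<partial>(T n)))"
    by blast+
  show thesis
  proof (rule unit_kernel_helly[of T, OF T])
    fix r T' assume r: "strict_mono r" and T': "real_distribution T'" "AE p in T'. p \<in> {0..1}"
      and lim: "\<And>s. s > 0 \<Longrightarrow> (\<lambda>n. unit_tr (T (r n)) s) \<longlonglongrightarrow> unit_tr T' s"
    show thesis
  proof (rule that[OF T'])
    fix s :: real assume s: "s > 0"
    define u where "u = sqrt s"
    have u: "u > 0" "u\<^sup>2 = s" using s by (auto simp: u_def)
    define x where "x = (u - 1) / (u + 1)"
    have "\<bar>x\<bar> < 1" using u by (simp add: x_def field_simps abs_if)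
    then have x: "of_real x \<in> ball (0::complex) 1" by simp
    have Cx: "C (of_real x) = of_real u"
    proof -
      have "(1 + x) / (1 - x) = u" using u by (simp add: x_def divide_simps)
      then have "complex_of_real ((1 + x) / (1 - x)) = of_real u" by simp
      then show ?thesis by (simp add: C_def)
    qed
    have "(\<lambda>n. of_real (\<rho> (r n)) * complex_of_real x) \<longlonglongrightarrow> of_real 1 * complex_of_real x"
      using LIMSEQ_subseq_LIMSEQ[OF \<rho>lim r] by (intro tendsto_intros) (simp add: o_def)
    then have "(\<lambda>n. Re (h (of_real (\<rho> (r n)) * of_real x))) \<longlonglongrightarrow> Re (h (of_real 1 * of_real x))"
      using x in_ball[of "of_real x"]
      by (intro tendsto_Re continuous_on_tendsto_compose[OF holomorphic_on_imp_continuous_on[OF hh]]) auto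
    moreover have "(\<lambda>n. m * (u * (\<integral>p. 1 / (1 - p + p * u\<^sup>2) \<partial>(T (r n))))) \<longlonglongrightarrow> m * (u * (\<integral>p. 1 / (1 - p + p * u\<^sup>2) \<partial>T'))"
      using u s by (intro tendsto_intros) (simp add: lim)
    ultimately have "Re (h (of_real x)) = m * (u * (\<integral>p. 1 / (1 - p + p * u\<^sup>2) \<partial>T'))"
      using Tu[OF u(1)] by (simp add: x_def LIMSEQ_unique)
    moreover have "Re (h (of_real x)) = u / Q s"
    proof -
      have "h (of_real x) = of_real u / q (of_real s)" using u by (simp add: h_def Cx flip: of_real_power)
      then show ?thesis using real[OF s] by simp
    qed
    ultimately have "u * (1 / Q s) = u * (1 / Q 1 * unit_tr T' s)"
      using u(2) by (simp add: m_def)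
    then show "1 / Q s = 1 / Q 1 * unit_tr T' s"
      using u(1) by (simp only: mult_cancel_left) simp
  qed
  qed
qed

section \<open>Pointwise limits of complete Bernstein functions\<close>

lemma stieltjes_unit:
  assumes "real_distribution T" "AE p in T. p \<in> {0..1}"
  shows "stieltjes T (\<lambda>p. 1 - p) (\<lambda>p. p)"
proof -
  interpret T: real_distribution T by fact
  show ?thesis by standard (use assms(2) in \<open>auto elim!: AE_mp\<close>)
qed

lemma cbf_representation:
  assumes "cbf f"
  obtains T where "real_distribution T" "AE p in T. p \<in> {0..1}"
    "\<And>s. s > 0 \<Longrightarrow> 1 / Re (f (of_real s)) = 1 / Re (f 1) * unit_tr T s"
proof (rule stieltjes_representation[OF cbf_holo[OF assms] cbf_nz[OF assms] cbf_Re_csqrt[OF assms]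
      cbf_real(1)[OF assms] cbf_real(2)[OF assms]])
  fix T assume "real_distribution T" "AE p in T. p \<in> {0..1}"
    "\<And>s. s > 0 \<Longrightarrow> 1 / Re (f (of_real s)) = 1 / Re (f (of_real 1)) * unit_tr T s"
  then show thesis using that by simp
qed

lemma cbf_scale:
  assumes "cbf f" "c > 0" shows "cbf (\<lambda>z. of_real c * f z)"
proof (rule cbfI)
  show "(\<lambda>z. of_real c * f z) holomorphic_on slit"
    by (intro holomorphic_intros cbf_holo assms)
qed (use assms cbf_nz[OF assms(1)] in \<open>auto simp: cbf_cnj cbf_Arg0 cbf_Arg\<close>)

text \<open>In the representation of each 1/f the scalar factor 1/f(1) converges, and a subsequence
  of the measures converges by Helly, so 1/L is again a positive multiple of a Stieltjes transform.
  Positivity of \<open>L\<close> keeps this factor finite.\<close>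

lemma cbf_limit:
  assumes f: "\<And>n. cbf (f n)" and lim: "\<And>s. s > 0 \<Longrightarrow> (\<lambda>n. Re (f n (of_real s))) \<longlonglongrightarrow> L s"
    and L: "\<And>s. s > 0 \<Longrightarrow> L s > 0"
  shows "\<exists>g. cbf g \<and> (\<forall>s>0. g (of_real s) = of_real (L s))"
proof -
  have "\<exists>T. real_distribution T \<and> (AE p in T. p \<in> {0..1}) \<and>
    (\<forall>s>0. 1 / Re (f n (of_real s)) = 1 / Re (f n 1) * unit_tr T s)" for n
    by (rule cbf_representation[OF f[of n]]) blast
  then obtain T where "\<forall>n. real_distribution (T n) \<and> (AE p in T n. p \<in> {0..1}) \<and>
    (\<forall>s>0. 1 / Re (f n (of_real s)) = 1 / Re (f n 1) * unit_tr (T n) s)"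
    by (rule choice[OF allI, THEN exE])
  then have T: "\<And>n. real_distribution (T n)" "\<And>n. AE p in T n. p \<in> {0..1}"
    and Ts: "\<And>n s. s > 0 \<Longrightarrow> 1 / Re (f n (of_real s)) = 1 / Re (f n 1) * unit_tr (T n) s"
    by blast+
  show ?thesis
  proof (rule unit_kernel_helly[of T, OF T])
    fix r :: "nat \<Rightarrow> nat" and T' assume r: "strict_mono r" and T': "real_distribution T'" "AE p in T'. p \<in> {0..1}"
      and limT: "\<And>s. s > 0 \<Longrightarrow> (\<lambda>n. unit_tr (T (r n)) s) \<longlonglongrightarrow> unit_tr T' s"
    interpret S: stieltjes T' "\<lambda>p. 1 - p" "\<lambda>p. p" by (rule stieltjes_unit[OF T'])
    define g where "g z = of_real (L 1) * (1 / S.W z)" for z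
    have "cbf g" unfolding g_def by (intro cbf_scale S.cbf_inverse_W L) simp
    moreover have "g (of_real s) = of_real (L s)" if s: "s > 0" for s
    proof -
      have sub: "(\<lambda>n. Re (f (r n) (of_real t))) \<longlonglongrightarrow> L t" if "t > 0" for t
        using LIMSEQ_subseq_LIMSEQ[OF lim[OF that] r] by (simp add: o_def)
      have "(\<lambda>n. 1 / Re (f (r n) (of_real s))) \<longlonglongrightarrow> 1 / L s"
        by (intro tendsto_intros sub s) (use L[OF s] in simp)
      moreover have "(\<lambda>n. 1 / Re (f (r n) (of_real s))) \<longlonglongrightarrow> 1 / L 1 * unit_tr T' s"
        unfolding Ts[OF s] using sub[of 1] L[of 1] by (intro tendsto_intros limT s) auto
      ultimately have e: "1 / L s = 1 / L 1 * unit_tr T' s" by (rule LIMSEQ_unique)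
      have "g (of_real s) = of_real (L 1 * (1 / unit_tr T' s))"
        unfolding g_def S.W_of_real by simp
      also have "L 1 * (1 / unit_tr T' s) = 1 / (1 / L s)"
        unfolding e by simp
      finally show ?thesis by simp
    qed
    ultimately show ?thesis by blast
  qed
qed

text \<open>For fixed p in [0,1], 1/(1 - p + p s) is nonincreasing in s and s/(1 - p + p s) is
  nondecreasing; the representation of 1/f transfers both facts.\<close>

lemma cbf_mono:
  assumes f: "cbf f" and st: "0 < s" "s \<le> t"
  shows "Re (f (of_real s)) \<le> Re (f (of_real t))" "Re (f (of_real t)) / t \<le> Re (f (of_real s)) / s"
proof -
  have pos: "Re (f (of_real u)) > 0" if "u > 0" for u using cbf_real[OF f that] by simp
  have "Re (f (of_real s)) \<le> Re (f (of_real t)) \<and> Re (f (of_real t)) / t \<le> Re (f (of_real s)) / s"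
  proof (rule cbf_representation[OF f])
    fix T assume T: "real_distribution T" "AE p in T. p \<in> {0..1}"
      and Ts: "\<And>s. s > 0 \<Longrightarrow> 1 / Re (f (of_real s)) = 1 / Re (f 1) * unit_tr T s"
    interpret S: stieltjes T "\<lambda>p. 1 - p" "\<lambda>p. p" by (rule stieltjes_unit[OF T])
    have t: "t > 0" using st by simp
    have m: "1 / Re (f 1) \<ge> 0" using pos[of 1] by simp
    have kp: "0 < 1 - p + p * u" if "p \<in> {0..1}" "u > 0" for p u :: real
      by (rule less_le_trans[OF _ unit_kernel_bound[of u p]]) (use that in auto)
    have "unit_tr T t \<le> unit_tr T s"
    proof (rule integral_mono_AE[OF S.integrable_kernel_real[OF t] S.integrable_kernel_real[OF st(1)]])
      show "AE p in T. 1 / (1 - p + p * t) \<le> 1 / (1 - p + p * s)"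
        using T(2)
      proof eventually_elim
        case (elim p)
        then have "1 - p + p * s \<le> 1 - p + p * t" using st by (simp add: mult_left_mono)
        then show ?case using kp[OF elim st(1)] by (intro divide_left_mono mult_pos_pos kp elim t st(1)) auto
      qed
    qed
    then have 1: "1 / Re (f (of_real t)) \<le> 1 / Re (f (of_real s))"
      unfolding Ts[OF t] Ts[OF st(1)] by (rule mult_left_mono[OF _ m])
    have "(\<integral>p. s * (1 / (1 - p + p * s)) \<partial>T) \<le> (\<integral>p. t * (1 / (1 - p + p * t)) \<partial>T)"
    proof (rule integral_mono_AE)
      show "AE p in T. s * (1 / (1 - p + p * s)) \<le> t * (1 / (1 - p + p * t))"
        using T(2)
      proof eventually_elim
        case (elim p)
        have "s * (1 - p) \<le> t * (1 - p)" using elim st by (intro mult_right_mono) auto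
        then show ?case using kp[OF elim st(1)] kp[OF elim t] by (simp add: divide_simps) (simp add: algebra_simps)
      qed
    qed (rule integrable_mult_right S.integrable_kernel_real st(1) t)+
    then have "s * unit_tr T s \<le> t * unit_tr T t"
      by (simp only: integral_mult_right_zero)
    then have "1 / Re (f 1) * (s * unit_tr T s) \<le> 1 / Re (f 1) * (t * unit_tr T t)"
      by (rule mult_left_mono[OF _ m])
    then have 2: "s * (1 / Re (f (of_real s))) \<le> t * (1 / Re (f (of_real t)))"
      unfolding Ts[OF t] Ts[OF st(1)] by (simp only: mult.left_commute)
    show ?thesis using 1 2 pos[OF st(1)] pos[OF t] st t by (simp add: field_simps)
  qed
  then show "Re (f (of_real s)) \<le> Re (f (of_real t))" "Re (f (of_real t)) / t \<le> Re (f (of_real s)) / s" by auto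
qed

text \<open>A short interval (0,d) contains a limit point of itself inside the connected slit plane.
  This is how information near 0 becomes global.\<close>

lemma slit_identity:
  assumes "f holomorphic_on slit" "g holomorphic_on slit" "\<forall>\<^sub>F s in at_right 0. f (complex_of_real s) = g (of_real s)"
    and "z \<in> slit"
  shows "f z = g z"
proof -
  obtain d where d: "d > 0" "\<And>s. 0 < s \<Longrightarrow> s < d \<Longrightarrow> f (complex_of_real s) = g (of_real s)"
    using assms(3) by (auto simp: eventually_at_right_field)
  let ?U = "complex_of_real ` {0<..<d}"
  have "f z - g z = 0"
  proof (rule analytic_continuation[of "\<lambda>z. f z - g z" slit ?U "of_real (d/2)"])
    show "of_real (d / 2) islimpt ?U"
      unfolding islimpt_approachable
    proof (intro allI impI)
      fix e :: real assume e: "e > 0"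
      let ?m = "min (d/4) (e/2)"
      have "?m > 0" "?m < e" "d/2 + ?m < d" using d(1) e by (auto simp: min_def)
      then show "\<exists>x'\<in>?U. x' \<noteq> of_real (d/2) \<and> dist x' (of_real (d/2)) < e"
        using d(1) by (intro bexI[of _ "of_real (d/2 + ?m)"] conjI imageI)
          (auto simp only: of_real_eq_iff dist_of_real dist_real_def greaterThanLessThan_iff)
    qed
    show "of_real (d / 2) \<in> slit" unfolding of_real_slit using d(1) by simp
    show "(\<lambda>z. f z - g z) holomorphic_on slit" using assms(1,2) by (rule holomorphic_on_diff)
    show "?U \<subseteq> slit" by auto
    show "f z - g z = 0" if "z \<in> ?U" for z using that d(2) by auto
  qed (fact open_slit connected_slit assms(4))+
  then show ?thesis by simp
qed

section \<open>Uniqueness of the transform\<close>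

lemma real_distribution_measure_UNIV [simp]:
  assumes "real_distribution M" shows "measure M UNIV = 1"
proof -
  interpret real_distribution M by fact
  show ?thesis using prob_space by simp
qed

text \<open>Since 0 \<le> p^n \<le> 1, the norms of \<open>c n\<close> dominate the series and allow
  termwise integration. It serves both the geometric and the exponential series.\<close>

lemma moment_series:
  fixes c :: "nat \<Rightarrow> complex"
  assumes M: "real_distribution M" "AE p in M. p \<in> {0..1}" and c: "summable (\<lambda>n. norm (c n))"
  shows "(\<lambda>n. c n * of_real (\<integral>p. p ^ n \<partial>M)) sums (\<integral>p. (\<Sum>n. c n * of_real p ^ n) \<partial>M)"
proof -
  interpret M: real_distribution M by fact
  have b: "AE p in M. norm (c n * of_real p ^ n) \<le> norm (c n)" for n
    using M(2) by eventually_elim (auto simp: norm_mult norm_power power_le_one intro!: mult_left_le)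
  have i: "integrable M (\<lambda>p. c n * of_real p ^ n)" for n
    by (rule M.integrable_const_bound[OF b]) auto
  have "(\<lambda>n. \<integral>p. c n * of_real p ^ n \<partial>M) sums (\<integral>p. (\<Sum>n. c n * of_real p ^ n) \<partial>M)"
  proof (rule sums_integral[OF i])
    show "AE p in M. summable (\<lambda>n. norm (c n * of_real p ^ n))"
    proof -
      have "AE p in M. \<forall>n. norm (c n * of_real p ^ n) \<le> norm (c n)" using b by (simp add: AE_all_countable)
      then show ?thesis by eventually_elim (rule summable_comparison_test[OF _ c], auto)
    qed
    show "summable (\<lambda>n. \<integral>p. norm (c n * of_real p ^ n) \<partial>M)"
    proof (rule summable_comparison_test[OF _ c], intro exI allI impI)
      fix n
      have "norm (\<integral>p. norm (c n * of_real p ^ n) \<partial>M) = (\<integral>p. norm (c n * of_real p ^ n) \<partial>M)" by simp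
      also have "\<dots> \<le> (\<integral>p. norm (c n) \<partial>M)"
        by (rule integral_mono_AE[OF integrable_norm[OF i] _ b]) simp
      finally show "norm (\<integral>p. norm (c n * of_real p ^ n) \<partial>M) \<le> norm (c n)" by (simp add: M)
    qed
  qed
  moreover have "(\<integral>p. c n * of_real p ^ n \<partial>M) = c n * of_real (\<integral>p. p ^ n \<partial>M)" for n
  proof -
    have "(\<integral>p. complex_of_real p ^ n \<partial>M) = of_real (\<integral>p. p ^ n \<partial>M)"
      using integral_complex_of_real[of M "\<lambda>p. p ^ n"] by (simp only: of_real_power)
    then show ?thesis by (simp only: integral_mult_right_zero)
  qed
  ultimately show ?thesis by (simp only:)
qed

text \<open>The transform is a power series in r whose coefficients are, up to sign, the moments;
  the moments of a measure on [0,1] in turn give its characteristic function through the exponential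
  series.\<close>

lemma real_distribution_unit_eqI:
  assumes M: "real_distribution M" "AE p in M. p \<in> {0..1}" and N: "real_distribution N" "AE p in N. p \<in> {0..1}"
    and eq: "\<And>r::complex. norm r < 1 \<Longrightarrow> (\<integral>p. 1 / (1 + of_real p * r) \<partial>M) = (\<integral>p. 1 / (1 + of_real p * r) \<partial>N)"
  shows "M = N"
proof -
  define m n where "m k = (\<integral>p. p ^ k \<partial>M)" and "n k = (\<integral>p. p ^ k \<partial>N)" for k
  interpret M: real_distribution M by fact
  interpret N: real_distribution N by fact
  have geo: "(\<lambda>k. (-r) ^ k * of_real (\<integral>p. p ^ k \<partial>L)) sums (\<integral>p. 1 / (1 + of_real p * r) \<partial>L)"
    if L: "real_distribution L" "AE p in L. p \<in> {0..1}" and r: "norm r < 1" for L and r :: complex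
  proof -
    interpret L: real_distribution L by fact
    have "summable (\<lambda>k. norm ((-r) ^ k))" using r by (simp add: norm_power summable_geometric)
    from moment_series[OF L this]
    have "(\<lambda>k. (-r) ^ k * of_real (\<integral>p. p ^ k \<partial>L)) sums (\<integral>p. (\<Sum>k. (-r) ^ k * of_real p ^ k) \<partial>L)" .
    also have "(\<integral>p. (\<Sum>k. (-r) ^ k * of_real p ^ k) \<partial>L) = (\<integral>p. 1 / (1 + of_real p * r) \<partial>L)"
    proof (rule integral_cong_AE)
      show "AE p in L. (\<Sum>k. (-r) ^ k * of_real p ^ k) = 1 / (1 + of_real p * r)"
        using L(2)
      proof eventually_elim
        case (elim p)
        have "norm (- r * of_real p) < 1"
          using elim r mult_left_le[of "\<bar>p\<bar>" "norm r"] by (simp add: norm_mult)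
        then have "(\<Sum>k. (- r * of_real p) ^ k) = 1 / (1 - (- r * of_real p))"
          by (rule suminf_geometric)
        then show ?case by (simp only: power_mult_distrib) (simp add: mult.commute)
      qed
      show "(\<lambda>p. \<Sum>k. (-r) ^ k * complex_of_real p ^ k) \<in> borel_measurable L" by measurable
    qed measurable
    finally show ?thesis .
  qed
  have m0: "m 0 = n 0" by (simp add: m_def n_def M N)
  have mn: "m k = n k" for k
  proof (rule ccontr)
    assume k: "m k \<noteq> n k"
    define a where "a j = (-1) ^ j * complex_of_real (m j - n j)" for j
    have "(\<lambda>j. a j * (r - 0) ^ j) sums 0" if "norm (r - 0) < 1" for r :: complex
    proof -
      have "(\<lambda>j. (-r) ^ j * of_real (m j) - (-r) ^ j * of_real (n j)) sums
         ((\<integral>p. 1 / (1 + of_real p * r) \<partial>M) - (\<integral>p. 1 / (1 + of_real p * r) \<partial>N))"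
        unfolding m_def n_def using that by (intro sums_diff geo M N) auto
      moreover have "(-r) ^ j * of_real (m j) - (-r) ^ j * of_real (n j) = a j * (r - 0) ^ j" for j
        by (simp add: a_def power_minus[of r] algebra_simps)
      ultimately show ?thesis using eq[of r] that by simp
    qed
    moreover have "k > 0" "a k \<noteq> 0" using k m0 by (auto simp: a_def intro: gr0I)
    \<comment> \<open>A nonzero coefficient would make 0 an isolated zero of the sum, but the sum
      vanishes on the whole unit disc.\<close>
    ultimately obtain s where s: "s > 0" "\<And>z. z \<in> cball 0 s - {0::complex} \<Longrightarrow> (0::complex) \<noteq> 0"
      using powser_0_nonzero[of 1 0 a "\<lambda>_. 0" k] by auto
    show False using s(2)[of "of_real s"] s(1) by simp
  qed
  have "char M t = char N t" for t
  proof -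
    have ch: "char L t = (\<Sum>k. (\<i> * t) ^ k / fact k * of_real (\<integral>p. p ^ k \<partial>L))"
      if L: "real_distribution L" "AE p in L. p \<in> {0..1}" for L
    proof -
      interpret L: real_distribution L by fact
      have series: "(\<Sum>k. (\<i> * t) ^ k / fact k * of_real p ^ k) = iexp (t * p)" for p
      proof -
        have "iexp (t * p) = exp (\<i> * t * of_real p)" by (simp add: mult.assoc)
        also have "\<dots> = (\<Sum>k. (\<i> * t) ^ k / fact k * of_real p ^ k)"
          unfolding exp_def by (intro suminf_cong) (simp add: power_mult_distrib scaleR_conv_of_real field_simps)
        finally show ?thesis by simp
      qed
      have "summable (\<lambda>k. norm ((\<i> * t) ^ k / fact k))"
        using summable_norm_exp[of "\<i> * t"] by (simp add: field_simps norm_mult norm_divide norm_power scaleR_conv_of_real)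
      from moment_series[OF L this]
      have "(\<Sum>k. (\<i> * t) ^ k / fact k * of_real (\<integral>p. p ^ k \<partial>L)) = (\<integral>p. (\<Sum>k. (\<i> * t) ^ k / fact k * of_real p ^ k) \<partial>L)"
        by (rule sums_unique[symmetric])
      also have "\<dots> = (\<integral>p. iexp (t * p) \<partial>L)" unfolding series ..
      finally show ?thesis by (simp add: char_def)
    qed
    show ?thesis unfolding ch[OF M] ch[OF N] using mn by (simp add: m_def n_def)
  qed
  then show ?thesis by (intro Levy_uniqueness M N) auto
qed

text \<open>This normalization serves both halves of the theorem: F(z) = z Q(-1/z) and \<eta>(z) = 1
  - Q(-z). \<open>qtr\<close> is its restriction to the real axis.\<close>

definition Qtr :: "real measure \<Rightarrow> complex \<Rightarrow> complex" where
  "Qtr mu z = 1 / (\<integral>x. 1 / (1 + of_real x * z) \<partial>mu)"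

definition qtr :: "real measure \<Rightarrow> real \<Rightarrow> real" where
  "qtr mu s = 1 / (\<integral>x. 1 / (1 + x * s) \<partial>mu)"

lemma Pplus_AE:
  assumes "mu \<in> Pplus" shows "AE x in mu. 0 \<le> x"
proof (rule AE_I)
  show "{x \<in> space mu. \<not> 0 \<le> x} \<subseteq> {..<0}" by auto
qed (use assms in \<open>auto simp: Pplus_def\<close>)

lemma Pplus_real_distribution: "mu \<in> Pplus \<Longrightarrow> real_distribution mu"
  by (simp add: Pplus_def real_distribution_def real_distribution_axioms_def)

lemma Pplus_I:
  assumes "real_distribution mu" "AE x in mu. 0 \<le> x" shows "mu \<in> Pplus"
proof -
  interpret real_distribution mu by fact
  have "emeasure mu {..<0} = 0"
    using assms(2) by (subst (asm) AE_iff_null) (auto simp: not_le null_sets_def lessThan_def)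
  then show ?thesis by (simp add: Pplus_def prob_space_axioms)
qed

lemma Pplus_stieltjes:
  assumes "mu \<in> Pplus" shows "stieltjes mu (\<lambda>_. 1) (\<lambda>x. x)"
proof -
  interpret real_distribution mu by (rule Pplus_real_distribution[OF assms])
  show ?thesis by standard (use Pplus_AE[OF assms] in auto)
qed

lemma cbf_Qtr: assumes "mu \<in> Pplus" shows "cbf (Qtr mu)"
proof -
  interpret stieltjes mu "\<lambda>_. 1" "\<lambda>x. x" by (rule Pplus_stieltjes[OF assms])
  show ?thesis using cbf_inverse_W by (simp add: W_def[abs_def] Qtr_def[abs_def])
qed

lemma Qtr_of_real: assumes "mu \<in> Pplus" shows "Qtr mu (of_real s) = of_real (qtr mu s)"
proof -
  interpret stieltjes mu "\<lambda>_. 1" "\<lambda>x. x" by (rule Pplus_stieltjes[OF assms])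
  show ?thesis using W_of_real[of s] by (simp add: W_def Qtr_def qtr_def)
qed

lemma inverse_kernel_le_1:
  assumes "0 \<le> (x::real)" "0 < s" shows "1 / (1 + x * s) \<le> 1" "norm (1 / (1 + x * s)) \<le> 1"
proof -
  have "0 \<le> x * s" using assms by simp
  then show "1 / (1 + x * s) \<le> 1" "norm (1 / (1 + x * s)) \<le> 1" by (auto simp: divide_le_eq)
qed

lemma qtr_ge_1: assumes mu: "mu \<in> Pplus" and s: "s > 0" shows "1 \<le> qtr mu s"
proof -
  interpret stieltjes mu "\<lambda>_. 1" "\<lambda>x. x" by (rule Pplus_stieltjes[OF mu])
  have "1 / (1 + x * s) \<le> 1" if "0 \<le> x" for x by (rule inverse_kernel_le_1(1)[OF that s])
  then have "AE x in mu. 1 / (1 + x * s) \<le> 1" using Pplus_AE[OF mu] by auto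
  then have "(\<integral>x. 1 / (1 + x * s) \<partial>mu) \<le> (\<integral>x. 1 \<partial>mu)"
    using integrable_kernel_real[OF s] by (intro integral_mono_AE) auto
  then show ?thesis using W_of_real_pos[OF s] by (simp add: qtr_def prob_space)
qed

lemma qtr_tendsto_0: assumes mu: "mu \<in> Pplus" shows "(qtr mu \<longlongrightarrow> 1) (at_right 0)"
proof -
  interpret stieltjes mu "\<lambda>_. 1" "\<lambda>x. x" by (rule Pplus_stieltjes[OF mu])
  interpret r: real_distribution mu by (rule Pplus_real_distribution[OF mu])
  have "((\<lambda>s. \<integral>x. 1 / (1 + x * s) \<partial>mu) \<longlongrightarrow> 1) (at_right 0)"
    unfolding tendsto_at_iff_sequentially
  proof (intro allI impI)
    fix X :: "nat \<Rightarrow> real" assume X: "\<forall>i. X i \<in> {0<..} - {0}" "X \<longlonglongrightarrow> 0"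
    have "(\<lambda>i. \<integral>x. 1 / (1 + x * X i) \<partial>mu) \<longlonglongrightarrow> (\<integral>x. 1 \<partial>mu)"
    proof (rule integral_dominated_convergence[where w = "\<lambda>_. 1"])
      show "AE x in mu. (\<lambda>i. 1 / (1 + x * X i)) \<longlonglongrightarrow> 1"
      proof (rule AE_I2)
        fix x
        have "(\<lambda>i. 1 / (1 + x * X i)) \<longlonglongrightarrow> 1 / (1 + x * 0)" by (intro tendsto_intros X) simp
        then show "(\<lambda>i. 1 / (1 + x * X i)) \<longlonglongrightarrow> 1" by simp
      qed
      fix i
      have "X i > 0" using X by auto
      then have "norm (1 / (1 + x * X i)) \<le> 1" if "0 \<le> x" for x by (rule inverse_kernel_le_1(2)[OF that])
      then show "AE x in mu. norm (1 / (1 + x * X i)) \<le> 1" by (rule AE_mp[OF Pplus_AE[OF mu] AE_I2[OF impI]])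
    qed auto
    then show "((\<lambda>s. \<integral>x. 1 / (1 + x * s) \<partial>mu) \<circ> X) \<longlonglongrightarrow> 1" by (simp add: o_def Pplus_real_distribution[OF mu])
  qed
  then have "((\<lambda>s. 1 / (\<integral>x. 1 / (1 + x * s) \<partial>mu)) \<longlongrightarrow> 1 / 1) (at_right 0)"
    by (intro tendsto_intros) auto
  then show ?thesis by (simp add: qtr_def[abs_def])
qed

text \<open>The map x/(1+x) carries the half-line into [0,1), where the transform determines the
  measure. The kernel there at r is an affine function of 1/(1 + x (1 + r)), so its integral is
  known from \<open>Qtr\<close> at 1 + r. For |r| < 1 this point lies in the slit plane, where
  values near 0 determine \<open>Qtr\<close>.\<close>

lemma Pplus_eqI:
  assumes mu: "mu \<in> Pplus" and nu: "nu \<in> Pplus" and eq: "\<forall>\<^sub>F s in at_right 0. qtr mu s = qtr nu s"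
  shows "mu = nu"
proof -
  define c :: "real \<Rightarrow> real" where "c x = (if 0 \<le> x then x / (1 + x) else 0)" for x
  define c' :: "real \<Rightarrow> real" where "c' p = p / (1 - p)" for p
  have [measurable]: "c \<in> borel_measurable borel" "c' \<in> borel_measurable borel"
    unfolding c_def c'_def by measurable
  have c01: "0 \<le> c x" "c x \<le> 1" for x by (auto simp: c_def)
  have unit: "real_distribution (distr L borel c)" "AE p in distr L borel c. p \<in> {0..1}"
    and recover: "distr (distr L borel c) borel c' = L"
    and int: "\<And>r::complex. norm r < 1 \<Longrightarrow> (\<integral>p. 1 / (1 + of_real p * r) \<partial>(distr L borel c))
       = 1 / (1 + r) + (1 - 1 / (1 + r)) * (1 / Qtr L (1 + r))" if L: "L \<in> Pplus" for L
  proof -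
    interpret L: real_distribution L by (rule Pplus_real_distribution[OF L])
    interpret S: stieltjes L "\<lambda>_. 1" "\<lambda>x. x" by (rule Pplus_stieltjes[OF L])
    show "real_distribution (distr L borel c)" by (rule L.real_distribution_distr) simp
    show "AE p in distr L borel c. p \<in> {0..1}" by (subst AE_distr_iff) (auto simp: c01)
    have "distr (distr L borel c) borel c' = distr L borel (c' \<circ> c)" by (rule distr_distr) simp_all
    also have "\<dots> = distr L borel (\<lambda>x. x)"
    proof (rule distr_cong_AE)
      show "AE x in L. (c' \<circ> c) x = x"
        using Pplus_AE[OF L] by eventually_elim (auto simp: c_def c'_def field_simps)
    qed auto
    also have "\<dots> = L" by (rule distr_id2) simp
    finally show "distr (distr L borel c) borel c' = L" .
    fix r :: complex assume r: "norm r < 1"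
    have z: "1 + r \<in> slit"
      using abs_Re_le_cmod[of r] r by (auto simp: slit_iff)
    then have nz: "1 + r \<noteq> 0" by (rule slit_nz)
    have "(\<integral>p. 1 / (1 + of_real p * r) \<partial>(distr L borel c)) = (\<integral>x. 1 / (1 + of_real (c x) * r) \<partial>L)"
      by (rule integral_distr) simp_all
    also have "\<dots> = (\<integral>x. 1 / (1 + r) + (1 - 1 / (1 + r)) * (1 / (of_real 1 + of_real x * (1 + r))) \<partial>L)"
    proof (rule integral_cong_AE)
      show "AE x in L. 1 / (1 + of_real (c x) * r) = 1 / (1 + r) + (1 - 1 / (1 + r)) * (1 / (of_real 1 + of_real x * (1 + r)))"
        using Pplus_AE[OF L]
      proof eventually_elim
        case (elim x)
        have d: "1 + of_real x * (1 + r) \<noteq> 0" using kernel_bound(2)[OF z, of 1 x] elim by simp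
        have x1: "1 + complex_of_real x \<noteq> 0" using elim by (metis add_nonneg_eq_0_iff of_real_1 of_real_add of_real_eq_0_iff zero_le_one zero_neq_one)
        have "1 + of_real (c x) * r = (1 + of_real x * (1 + r)) / (1 + of_real x)"
          using elim x1 by (simp add: c_def field_simps)
        then have "1 / (1 + of_real (c x) * r) = (1 + of_real x) / (1 + of_real x * (1 + r))" by simp
        also have "\<dots> = 1 / (1 + r) + (1 - 1 / (1 + r)) * (1 / (of_real 1 + of_real x * (1 + r)))"
          using d nz by (simp add: divide_simps) (simp add: algebra_simps)
        finally show ?case .
      qed
    qed measurable
    also have "\<dots> = 1 / (1 + r) + (1 - 1 / (1 + r)) * (\<integral>x. 1 / (of_real 1 + of_real x * (1 + r)) \<partial>L)"
      using S.integrable_kernel[OF z]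
      by (subst Bochner_Integration.integral_add)
         (simp_all only: integral_mult_right_zero integrable_mult_right L.integrable_const lebesgue_integral_const
           L.space_eq_univ real_distribution_measure_UNIV[OF Pplus_real_distribution[OF L]] scaleR_one simp_thms)
    also have "(\<integral>x. 1 / (of_real 1 + of_real x * (1 + r)) \<partial>L) = 1 / Qtr L (1 + r)"
      by (simp add: Qtr_def)
    finally show "(\<integral>p. 1 / (1 + of_real p * r) \<partial>(distr L borel c))
       = 1 / (1 + r) + (1 - 1 / (1 + r)) * (1 / Qtr L (1 + r))" .
  qed
  have Q: "Qtr mu z = Qtr nu z" if "z \<in> slit" for z
  proof (rule slit_identity[OF cbf_holo[OF cbf_Qtr[OF mu]] cbf_holo[OF cbf_Qtr[OF nu]] _ that])
    show "\<forall>\<^sub>F s in at_right 0. Qtr mu (of_real s) = Qtr nu (of_real s)"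
      using eq by eventually_elim (simp add: Qtr_of_real mu nu)
  qed
  have "distr mu borel c = distr nu borel c"
  proof (rule real_distribution_unit_eqI[OF unit[OF mu] unit[OF nu]])
    fix r :: complex assume r: "norm r < 1"
    have "1 + r \<in> slit" using abs_Re_le_cmod[of r] r by (auto simp: slit_iff)
    then show "(\<integral>p. 1 / (1 + of_real p * r) \<partial>(distr mu borel c)) = (\<integral>p. 1 / (1 + of_real p * r) \<partial>(distr nu borel c))"
      unfolding int[OF mu r] int[OF nu r] by (simp add: Q)
  qed
  then have "distr (distr mu borel c) borel c' = distr (distr nu borel c) borel c'" by (rule arg_cong)
  then show ?thesis unfolding recover[OF mu] recover[OF nu] .
qed

section \<open>Existence of measures with a given transform\<close>

text \<open>As s decreases to 0 along 1/(n+1), the kernels increase to 1/(1 - p), with value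
  infinity at p = 1. Monotone convergence to a finite limit therefore forbids an atom at 1 and
  evaluates the integral of 1/(1 - p).\<close>

lemma unit_inverse_moment:
  fixes T :: "real measure"
  assumes T: "real_distribution T" "AE p in T. p \<in> {0..1}"
    and lim: "((\<lambda>s. unit_tr T s) \<longlongrightarrow> L) (at_right 0)"
  shows "AE p in T. 0 \<le> p \<and> p < 1" "(\<integral>\<^sup>+p. ennreal (1 / (1 - p)) \<partial>T) = ennreal L"
proof -
  interpret S: stieltjes T "\<lambda>p. 1 - p" "\<lambda>p. p" by (rule stieltjes_unit[OF T])
  define s :: "nat \<Rightarrow> real" where "s n = 1 / real (Suc n)" for n
  have s: "s n > 0" "s (Suc n) \<le> s n" for n by (auto simp: s_def field_simps)
  have slim: "s \<longlonglongrightarrow> 0" unfolding s_def by (rule LIMSEQ_Suc[OF lim_1_over_n])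
  define g where "g n p = ennreal (1 / (1 - p + p * s n))" for n p
  define G where "G p = (SUP n. g n p)" for p
  have [measurable]: "g n \<in> borel_measurable T" for n unfolding g_def by measurable
  have [measurable]: "G \<in> borel_measurable T" unfolding G_def by measurable
  have kp: "0 < 1 - p + p * s n" if "p \<in> {0..1}" for p n
    by (rule less_le_trans[OF _ unit_kernel_bound[of "s n" p]]) (use that s in auto)
  have gm: "g n p \<le> g (Suc n) p" if p: "p \<in> {0..1}" for p n
  proof -
    have "1 - p + p * s (Suc n) \<le> 1 - p + p * s n" using p s by (auto intro: mult_left_mono)
    then show ?thesis unfolding g_def using kp[OF p]
      by (intro ennreal_leI divide_left_mono mult_pos_pos) auto
  qed
  then have gi: "incseq (\<lambda>n. g n p)" if "p \<in> {0..1}" for p using that by (intro incseq_SucI) auto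
  have gint: "(\<integral>\<^sup>+p. g n p \<partial>T) = ennreal (\<integral>p. 1 / (1 - p + p * s n) \<partial>T)" for n
    unfolding g_def
  proof (rule nn_integral_eq_integral[OF S.integrable_kernel_real[OF s(1)]])
    show "AE p in T. 0 \<le> 1 / (1 - p + p * s n)"
      using T(2) by eventually_elim (use kp in \<open>simp add: less_imp_le\<close>)
  qed
  have "(\<integral>\<^sup>+p. G p \<partial>T) = (SUP n. \<integral>\<^sup>+p. g n p \<partial>T)"
    unfolding G_def by (rule nn_integral_monotone_convergence_SUP_AE) (use T(2) gm in \<open>auto elim!: AE_mp\<close>)
  also have "\<dots> = ennreal L"
  proof (rule LIMSEQ_unique)
    have "incseq (\<lambda>n. \<integral>\<^sup>+p. g n p \<partial>T)"
      by (intro incseq_SucI nn_integral_mono_AE) (use T(2) gm in \<open>auto elim!: AE_mp\<close>)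
    then show "(\<lambda>n. \<integral>\<^sup>+p. g n p \<partial>T) \<longlonglongrightarrow> (SUP n. \<integral>\<^sup>+p. g n p \<partial>T)" by (rule LIMSEQ_SUP)
    have "filterlim s (at_right 0) sequentially"
      unfolding filterlim_at using slim s(1) by (auto simp: less_imp_neq[THEN not_sym])
    from filterlim_compose[OF lim this]
    show "(\<lambda>n. \<integral>\<^sup>+p. g n p \<partial>T) \<longlonglongrightarrow> ennreal L" unfolding gint by (rule tendsto_ennrealI)
  qed
  finally have GL: "(\<integral>\<^sup>+p. G p \<partial>T) = ennreal L" .
  then have fin: "AE p in T. G p \<noteq> \<infinity>" by (intro nn_integral_PInf_AE) auto
  have G1: "G 1 = \<infinity>"
  proof -
    have "of_nat n \<le> G 1" for n
    proof -
      have "of_nat n \<le> g n 1" by (simp add: g_def s_def ennreal_of_nat_eq_real_of_nat)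
      also have "\<dots> \<le> G 1" unfolding G_def by (rule SUP_upper) simp
      finally show ?thesis .
    qed
    then have "(SUP n. of_nat n) \<le> G 1" by (rule SUP_least)
    then show ?thesis by (simp add: ennreal_SUP_of_nat_eq_top top_unique)
  qed
  have Gp: "G p = ennreal (1 / (1 - p))" if p: "0 \<le> p" "p < 1" for p
  proof (rule LIMSEQ_unique)
    show "(\<lambda>n. g n p) \<longlonglongrightarrow> G p" unfolding G_def using p by (intro LIMSEQ_SUP gi) auto
    have "(\<lambda>n. 1 / (1 - p + p * s n)) \<longlonglongrightarrow> 1 / (1 - p + p * 0)"
      using p by (intro tendsto_intros slim) auto
    then show "(\<lambda>n. g n p) \<longlonglongrightarrow> ennreal (1 / (1 - p))" unfolding g_def by (intro tendsto_ennrealI) simp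
  qed
  show 1: "AE p in T. 0 \<le> p \<and> p < 1"
    using T(2) fin
  proof eventually_elim
    case (elim p)
    then show ?case using G1 by (cases "p = 1") auto
  qed
  have "(\<integral>\<^sup>+p. ennreal (1 / (1 - p)) \<partial>T) = (\<integral>\<^sup>+p. G p \<partial>T)"
    by (rule nn_integral_cong_AE) (use 1 Gp in \<open>auto elim!: AE_mp\<close>)
  then show "(\<integral>\<^sup>+p. ennreal (1 / (1 - p)) \<partial>T) = ennreal L" using GL by simp
qed

text \<open>With x = p/(1-p) the kernel 1/(1 - p + p s) equals 1/(1 - p) times 1/(1 + x s). So the
  weight 1/(1 - p), divided by \<open>Q 1\<close>, is the density that turns the measure on [0,1]
  into the one sought, and the limit of \<open>Q\<close> at 0 makes its total mass 1.\<close>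

theorem Pplus_exists:
  assumes holo: "q holomorphic_on slit" and nz: "\<And>z. z \<in> slit \<Longrightarrow> q z \<noteq> 0"
    and Req: "\<And>z. z \<in> slit \<Longrightarrow> 0 \<le> Re (csqrt z * cnj (q z))"
    and real: "\<And>s. s > 0 \<Longrightarrow> q (of_real s) = of_real (Q s)" and pos: "\<And>s. s > 0 \<Longrightarrow> 0 < Q s"
    and lim: "(Q \<longlongrightarrow> 1) (at_right 0)"
  shows "\<exists>mu\<in>Pplus. \<forall>s>0. qtr mu s = Q s"
proof (rule stieltjes_representation[OF holo nz Req real pos])
  fix T assume T: "real_distribution T" "AE p in T. p \<in> {0..1}"
    and rep: "\<And>s. s > 0 \<Longrightarrow> 1 / Q s = 1 / Q 1 * unit_tr T s"
  interpret T: real_distribution T by fact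
  have Q1: "Q 1 > 0" by (rule pos) simp
  have "((\<lambda>s. Q 1 / Q s) \<longlongrightarrow> Q 1 / 1) (at_right 0)" by (intro tendsto_intros lim) simp
  moreover have "\<forall>\<^sub>F s in at_right 0. Q 1 / Q s = unit_tr T s"
    using at_right_0_pos
  proof eventually_elim
    case (elim s)
    have "Q 1 / Q s = Q 1 * (1 / Q s)" by simp
    also have "\<dots> = unit_tr T s" unfolding rep[OF elim] using Q1 by simp
    finally show ?case .
  qed
  ultimately have "((\<lambda>s. unit_tr T s) \<longlongrightarrow> Q 1) (at_right 0)"
    by (simp add: Lim_transform_eventually)
  note T1 = unit_inverse_moment[OF T this]
  \<comment> \<open>Setting both functions to 0 off [0,1) changes them only on a null set of
    \<open>T\<close> and keeps them nonnegative everywhere.\<close>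
  define X :: "real \<Rightarrow> real" where "X p = (if 0 \<le> p \<and> p < 1 then p / (1 - p) else 0)" for p
  define D :: "real \<Rightarrow> real" where "D p = (if 0 \<le> p \<and> p < 1 then 1 / Q 1 / (1 - p) else 0)" for p
  have [measurable]: "X \<in> borel_measurable borel" "D \<in> borel_measurable borel"
    unfolding X_def D_def by measurable
  have X0: "0 \<le> X p" and D0: "0 \<le> D p" for p using Q1 by (auto simp: X_def D_def)
  define N where "N = density T (\<lambda>p. ennreal (D p))"
  have "emeasure N (space N) = (\<integral>\<^sup>+p. ennreal (D p) \<partial>T)"
    unfolding N_def by (simp add: emeasure_density)
  also have "\<dots> = (\<integral>\<^sup>+p. ennreal (1 / Q 1) * ennreal (1 / (1 - p)) \<partial>T)"
  proof (rule nn_integral_cong_AE)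
    show "AE p in T. ennreal (D p) = ennreal (1 / Q 1) * ennreal (1 / (1 - p))"
      using T1(1) by eventually_elim (use Q1 in \<open>simp add: D_def flip: ennreal_mult\<close>)
  qed
  also have "\<dots> = ennreal (1 / Q 1) * ennreal (Q 1)"
    by (subst nn_integral_cmult) (simp_all add: T1(2))
  also have "\<dots> = 1" using Q1 by (simp flip: ennreal_mult)
  finally interpret N: prob_space N by (rule prob_spaceI)
  have [measurable]: "X \<in> borel_measurable N" by (simp add: N_def)
  define mu where "mu = distr N borel X"
  have mu: "mu \<in> Pplus"
    unfolding mu_def by (intro Pplus_I N.real_distribution_distr) (auto simp: AE_distr_iff X0)
  have "qtr mu s = Q s" if s: "s > 0" for s
  proof -
    have "(\<integral>x. 1 / (1 + x * s) \<partial>mu) = (\<integral>p. 1 / (1 + X p * s) \<partial>N)"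
      unfolding mu_def by (rule integral_distr) simp_all
    also have "\<dots> = (\<integral>p. D p * (1 / (1 + X p * s)) \<partial>T)"
      unfolding N_def by (subst integral_density) (auto simp: D0)
    also have "\<dots> = (\<integral>p. 1 / Q 1 * (1 / (1 - p + p * s)) \<partial>T)"
    proof (rule integral_cong_AE)
      show "AE p in T. D p * (1 / (1 + X p * s)) = 1 / Q 1 * (1 / (1 - p + p * s))"
        using T1(1)
      proof eventually_elim
        case (elim p)
        then have X: "1 + X p * s = (1 - p + p * s) / (1 - p)" by (simp add: X_def field_simps)
        have D: "D p = 1 / Q 1 / (1 - p)" using elim by (simp add: D_def)
        show ?case unfolding X D using elim by simp
      qed
    qed measurable
    also have "\<dots> = 1 / Q s" unfolding rep[OF s] by (rule integral_mult_right_zero)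
    finally show ?thesis by (simp add: qtr_def)
  qed
  with mu show ?thesis by blast
qed

lemma Pplus_of_cbf:
  assumes f: "cbf f" and lim: "((\<lambda>s. Re (f (of_real s))) \<longlongrightarrow> 1) (at_right 0)"
  shows "\<exists>mu\<in>Pplus. \<forall>s>0. qtr mu s = Re (f (of_real s))"
  by (rule Pplus_exists[OF cbf_holo[OF f] cbf_nz[OF f] cbf_Re_csqrt[OF f] cbf_real(1)[OF f] cbf_real(2)[OF f] lim])

lemma delta0_Pplus: "delta0 \<in> Pplus"
  by (auto simp: Pplus_def delta0_def prob_space_return)

lemma qtr_delta0: "qtr delta0 s = 1"
proof -
  have "(\<integral>x. 1 / (1 + x * s) \<partial>delta0) = 1 / (1 + 0 * s)"
    unfolding delta0_def by (rule integral_return) simp_all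
  then show ?thesis by (simp add: qtr_def)
qed

section \<open>The transform e = q - 1 and its complete Bernstein property\<close>

definition etr :: "real measure \<Rightarrow> real \<Rightarrow> real" where
  "etr mu s = qtr mu s - 1"

lemma etr_tendsto_0: "mu \<in> Pplus \<Longrightarrow> (etr mu \<longlongrightarrow> 0) (at_right 0)"
  using tendsto_diff[OF qtr_tendsto_0 tendsto_const[of 1]] by (simp add: etr_def[abs_def])

lemma etr_delta0 [simp]: "etr delta0 s = 0"
  by (simp add: etr_def qtr_delta0)

text \<open>Since \<open>csqrt z\<close> has positive real part, adding 1 to \<open>f\<close>
  preserves the half-plane condition, and in fact makes it strict. The argument of 1 + f never has
  to be examined.\<close>

lemma Pplus_of_cbf_etr:
  assumes f: "cbf f" and lim: "((\<lambda>s. Re (f (of_real s))) \<longlongrightarrow> 0) (at_right 0)"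
  shows "\<exists>mu\<in>Pplus. mu \<noteq> delta0 \<and> (\<forall>s>0. etr mu s = Re (f (of_real s)))"
proof -
  have R: "0 < Re (csqrt z * cnj (1 + f z))" if "z \<in> slit" for z
    using cbf_Re_csqrt[OF f that] that by (simp add: slit_Re_csqrt distrib_left del: csqrt.sel)
  have "\<exists>mu\<in>Pplus. \<forall>s>0. qtr mu s = 1 + Re (f (of_real s))"
  proof (rule Pplus_exists)
    show "(\<lambda>z. 1 + f z) holomorphic_on slit" by (intro holomorphic_intros cbf_holo f)
    show "1 + f z \<noteq> 0" if "z \<in> slit" for z
      using R[OF that] by (metis complex_cnj_zero mult_zero_right less_irrefl zero_complex.sel(1))
    show "0 \<le> Re (csqrt z * cnj (1 + f z))" if "z \<in> slit" for z using R[OF that] by (rule less_imp_le)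
    show "1 + f (of_real s) = of_real (1 + Re (f (of_real s)))" if "s > 0" for s
      using cbf_real(1)[OF f that] by simp
    show "0 < 1 + Re (f (of_real s))" if "s > 0" for s using cbf_real(2)[OF f that] by simp
    show "((\<lambda>s. 1 + Re (f (of_real s))) \<longlongrightarrow> 1) (at_right 0)"
      using tendsto_add[OF tendsto_const[of 1] lim] by simp
  qed
  then obtain mu where mu: "mu \<in> Pplus" "\<And>s. s > 0 \<Longrightarrow> qtr mu s = 1 + Re (f (of_real s))" by blast
  have "mu \<noteq> delta0" using mu(2)[of 1] qtr_delta0[of 1] cbf_real(2)[OF f, of 1] by auto
  then show ?thesis using mu by (intro bexI[of _ mu]) (auto simp: etr_def)
qed

lemma Pplus_AE_0:
  assumes mu: "mu \<in> Pplus" and ae: "AE x in mu. x = 0" shows "mu = delta0"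
proof (rule Pplus_eqI[OF mu delta0_Pplus])
  interpret r: real_distribution mu by (rule Pplus_real_distribution[OF mu])
  have "qtr mu s = 1" for s
  proof -
    have "(\<integral>x. 1 / (1 + x * s) \<partial>mu) = (\<integral>x. 1 \<partial>mu)"
    proof (rule integral_cong_AE)
      show "AE x in mu. 1 / (1 + x * s) = 1" using ae by eventually_elim simp
    qed measurable
    then show ?thesis using r.prob_space by (simp add: qtr_def)
  qed
  then show "\<forall>\<^sub>F s in at_right 0. qtr mu s = qtr delta0 s" by (simp add: qtr_delta0)
qed

text \<open>The source of all strict inequalities below: if the integral were 0, the measure would
  be concentrated at 0.\<close>

lemma Pplus_integral_pos:
  assumes mu: "mu \<in> Pplus" "mu \<noteq> delta0" and h: "integrable mu h" "\<And>x. 0 \<le> x \<Longrightarrow> 0 \<le> h x" "\<And>x. 0 < x \<Longrightarrow> 0 < (h x::real)"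
  shows "0 < (\<integral>x. h x \<partial>mu)"
proof -
  have nn: "AE x in mu. 0 \<le> h x" using Pplus_AE[OF mu(1)] by eventually_elim (rule h(2))
  have "(\<integral>x. h x \<partial>mu) \<noteq> 0"
  proof
    assume "(\<integral>x. h x \<partial>mu) = 0"
    then have "AE x in mu. h x = 0" using integral_nonneg_eq_0_iff_AE[OF h(1) nn] by simp
    then have "AE x in mu. x = 0" using Pplus_AE[OF mu(1)]
    proof eventually_elim
      case (elim x) then show ?case using h(3)[of x] by (cases "x = 0") auto
    qed
    then show False using Pplus_AE_0[OF mu(1)] mu(2) by simp
  qed
  moreover have "0 \<le> (\<integral>x. h x \<partial>mu)" using nn by (rule integral_nonneg_AE)
  ultimately show ?thesis by simp
qed

text \<open>Nonnegativity of the variance of \<open>k\<close>; it is the convexity behind the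
  Bernstein property of e.\<close>

lemma (in prob_space) norm_integral_square_le:
  fixes k :: "'a \<Rightarrow> complex"
  assumes k: "integrable M k" and k2: "integrable M (\<lambda>x. (cmod (k x))\<^sup>2)"
  shows "(cmod (\<integral>x. k x \<partial>M))\<^sup>2 \<le> (\<integral>x. (cmod (k x))\<^sup>2 \<partial>M)"
proof -
  define c where "c = (\<integral>x. k x \<partial>M)"
  have e: "(cmod (k x - c))\<^sup>2 = (cmod (k x))\<^sup>2 - 2 * Re (cnj c * k x) + (cmod c)\<^sup>2" for x
    unfolding cmod_power2 by (simp add: algebra_simps power2_eq_square)
  have i: "integrable M (\<lambda>x. 2 * Re (cnj c * k x))" by (intro integrable_mult_right integrable_Re k)
  have "0 \<le> (\<integral>x. (cmod (k x - c))\<^sup>2 \<partial>M)" by (rule integral_nonneg_AE) simp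
  also have "\<dots> = (\<integral>x. (cmod (k x))\<^sup>2 \<partial>M) - (\<integral>x. 2 * Re (cnj c * k x) \<partial>M) + (cmod c)\<^sup>2"
    unfolding e using k2 i by (simp add: prob_space)
  also have "(\<integral>x. 2 * Re (cnj c * k x) \<partial>M) = 2 * Re (cnj c * c)"
    unfolding integral_mult_right_zero using k by (subst integral_Re) (auto simp: c_def)
  also have "Re (cnj c * c) = (cmod c)\<^sup>2" unfolding cmod_power2 by (simp add: power2_eq_square)
  finally show ?thesis by (simp add: c_def)
qed

text \<open>Let w be the integral of k(x) = 1/(1 + x z). The upper bound on the argument of 1/w - 1
  amounts to Im (z w) \<ge> Im z |w|^2. Pointwise Im (z k) = Im z |k|^2, so the claim is that the
  squared norm of the mean of \<open>k\<close> is at most the mean of |k|^2.\<close>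

lemma cbf_Etr:
  assumes mu: "mu \<in> Pplus" "mu \<noteq> delta0" shows "cbf (\<lambda>z. Qtr mu z - 1)"
proof (rule cbfI)
  interpret S: stieltjes mu "\<lambda>_. 1" "\<lambda>x. x" by (rule Pplus_stieltjes[OF mu(1)])
  note Q = cbf_Qtr[OF mu(1)]
  show "(\<lambda>z. Qtr mu z - 1) holomorphic_on slit" by (intro holomorphic_intros cbf_holo Q)
  show "Qtr mu (cnj z) - 1 = cnj (Qtr mu z - 1)" if "z \<in> slit" for z using cbf_cnj[OF Q that] by simp
  fix z assume z: "z \<in> slit" "0 \<le> Im z"
  define k where "k x = 1 / (1 + complex_of_real x * z)" for x
  have ki: "integrable mu k" using S.integrable_kernel[OF z(1)] by (simp add: k_def[abs_def])
  have [measurable]: "k \<in> borel_measurable mu" using ki by auto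
  have kd: "1 + of_real x * z \<noteq> 0" if "0 \<le> x" for x using kernel_bound(2)[OF z(1), of 1 x] that by simp
  have kb: "AE x in mu. cmod (k x) \<le> 1 / kernel_gap z" using S.kernel_le(1)[OF z(1)] by (simp add: k_def)
  then have "AE x in mu. norm ((cmod (k x))\<^sup>2) \<le> (1 / kernel_gap z)\<^sup>2"
    by eventually_elim (simp add: power_mono del: power_divide)
  then have k2: "integrable mu (\<lambda>x. (cmod (k x))\<^sup>2)" by (rule S.integrable_const_bound) measurable
  define w where "w = (\<integral>x. k x \<partial>mu)"
  have Qw: "Qtr mu z = 1 / w" by (simp add: Qtr_def w_def k_def)
  have wnz: "w \<noteq> 0" using cbf_nz[OF Q z(1)] Qw by auto
  let ?E = "Qtr mu z - 1"
  have w_real: "w = of_real (\<integral>x. 1 / (1 + x * Re z) \<partial>mu)" if "Im z = 0"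
  proof -
    have wW: "w = S.W z" by (simp add: w_def k_def[abs_def] S.W_def)
    have "z = of_real (Re z)" using that by (simp add: complex_eq_iff)
    then have "S.W z = S.W (of_real (Re z))" by (rule arg_cong)
    then show ?thesis unfolding wW S.W_of_real .
  qed
  show "?E \<noteq> 0 \<and> 0 \<le> Arg ?E \<and> Arg ?E \<le> Arg z"
  proof -
    have real_pos: "0 < Re ?E" if "Im z = 0"
    proof -
      have s: "Re z > 0" using z that by (auto simp: slit_iff)
      have "0 < (\<integral>x. 1 - 1 / (1 + x * Re z) \<partial>mu)"
      proof (rule Pplus_integral_pos[OF mu])
        show "integrable mu (\<lambda>x. 1 - 1 / (1 + x * Re z))"
          using S.integrable_kernel_real[OF s] by (intro Bochner_Integration.integrable_diff) auto
        show "0 \<le> 1 - 1 / (1 + x * Re z)" if "0 \<le> x" for x using inverse_kernel_le_1(1)[OF that s] by simp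
        show "0 < 1 - 1 / (1 + x * Re z)" if "0 < x" for x using that s by (simp add: divide_less_eq add_pos_pos)
      qed
      then have "(\<integral>x. 1 / (1 + x * Re z) \<partial>mu) < 1"
        using S.integrable_kernel_real[OF s] by (simp add: S.prob_space)
      moreover have "0 < (\<integral>x. 1 / (1 + x * Re z) \<partial>mu)" using S.W_of_real_pos[OF s] .
      ultimately have "1 < 1 / (\<integral>x. 1 / (1 + x * Re z) \<partial>mu)" by (simp add: less_divide_eq)
      moreover have "Qtr mu z = of_real (1 / (\<integral>x. 1 / (1 + x * Re z) \<partial>mu))"
        unfolding Qw w_real[OF that] by simp
      ultimately show ?thesis by (simp only: minus_complex.sel Re_complex_of_real one_complex.sel diff_gt_0_iff_gt)
    qed
    have ImE: "0 \<le> Im ?E" using cbf_Im[OF Q z] by simp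
    have "?E \<noteq> 0"
    proof (cases "Im z = 0")
      case True then show ?thesis using real_pos by auto
    next
      case False
      then have y: "0 < Im z" using z by simp
      \<comment> \<open>Mass off 0 pushes w strictly below the real axis, so w cannot equal
        1.\<close>
      have "0 < (\<integral>x. - Im (k x) \<partial>mu)"
      proof (rule Pplus_integral_pos[OF mu])
        show "integrable mu (\<lambda>x. - Im (k x))" by (intro Bochner_Integration.integrable_minus integrable_Im ki)
        have "- Im (k x) = x * Im z / (cmod (1 + of_real x * z))\<^sup>2" for x
          by (simp add: k_def Im_divide cmod_power2)
        then show "0 \<le> - Im (k x)" if "0 \<le> x" for x using that y by simp
        show "0 < - Im (k x)" if "0 < x" for x
          using \<open>\<And>x. - Im (k x) = x * Im z / (cmod (1 + of_real x * z))\<^sup>2\<close>[of x] that y kd[of x] by simp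
      qed
      also have "(\<integral>x. - Im (k x) \<partial>mu) = - Im w" using ki by (simp add: w_def)
      finally have "w \<noteq> 1" by auto
      then show ?thesis unfolding Qw using wnz by auto
    qed
    moreover have "Im (?E * cnj z) \<le> 0"
    proof -
      have le: "Im z * (cmod w)\<^sup>2 \<le> Im (z * w)"
      proof -
        have zk: "Im (z * k x) = Im z * (cmod (k x))\<^sup>2" for x
          unfolding k_def norm_divide power_divide by (simp add: Im_divide cmod_power2 algebra_simps)
        have "Im (z * w) = (\<integral>x. Im (z * k x) \<partial>mu)"
          using ki unfolding w_def by (subst integral_Im) auto
        also have "\<dots> = Im z * (\<integral>x. (cmod (k x))\<^sup>2 \<partial>mu)" unfolding zk by simp
        finally show ?thesis using S.norm_integral_square_le[OF ki k2] z(2) by (simp add: w_def mult_left_mono)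
      qed
      have "Im (?E * cnj z) = - Im (z * w) / (cmod w)\<^sup>2 + Im z"
      proof -
        have "1 / w * cnj z = cnj (z * w) / of_real ((cmod w)^2)"
          unfolding complex_norm_square using wnz by (simp add: field_simps)
        then have "Im (1 / w * cnj z) = - Im (z * w) / (cmod w)^2"
          by (simp only: Im_divide_of_real cnj.sel)
        then show ?thesis unfolding Qw by (simp add: left_diff_distrib)
      qed
      moreover have "Im z \<le> Im (z * w) / (cmod w)\<^sup>2"
        by (subst pos_le_divide_eq) (use wnz le in simp_all)
      ultimately show ?thesis by (simp only: minus_divide_left[symmetric])
    qed
    ultimately show ?thesis using Arg_le_I[OF z _ ImE _ real_pos] by blast
  qed
qed

lemma etr_eq_Qtr: "mu \<in> Pplus \<Longrightarrow> etr mu s = Re (Qtr mu (of_real s) - 1)"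
  by (simp add: etr_def Qtr_of_real)

lemma etr_pos: "mu \<in> Pplus \<Longrightarrow> mu \<noteq> delta0 \<Longrightarrow> s > 0 \<Longrightarrow> 0 < etr mu s"
  using cbf_real(2)[OF cbf_Etr] by (simp add: etr_eq_Qtr)

lemma etr_ratio_antimono:
  "mu \<in> Pplus \<Longrightarrow> mu \<noteq> delta0 \<Longrightarrow> 0 < s \<Longrightarrow> s \<le> t \<Longrightarrow> etr mu t / t \<le> etr mu s / s"
  using cbf_mono(2)[OF cbf_Etr] by (simp add: etr_eq_Qtr)

text \<open>Membership in the class gives only weak monotonicity; strictness, which makes
  \<open>etr\<close> invertible, comes from the mass off 0.\<close>

lemma etr_strict_mono:
  assumes mu: "mu \<in> Pplus" "mu \<noteq> delta0" and st: "0 < s" "s < t"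
  shows "etr mu s < etr mu t"
proof -
  interpret S: stieltjes mu "\<lambda>_. 1" "\<lambda>x. x" by (rule Pplus_stieltjes[OF mu(1)])
  have t: "0 < t" using st by simp
  have "0 < (\<integral>x. 1 / (1 + x * s) - 1 / (1 + x * t) \<partial>mu)"
  proof (rule Pplus_integral_pos[OF mu])
    show "integrable mu (\<lambda>x. 1 / (1 + x * s) - 1 / (1 + x * t))"
      by (intro Bochner_Integration.integrable_diff S.integrable_kernel_real st t)
    have p: "0 < 1 + x * u" if "0 \<le> x" "0 < u" for x u :: real
      using that by (intro add_pos_nonneg) auto
    show "0 \<le> 1 / (1 + x * s) - 1 / (1 + x * t)" if "0 \<le> x" for x
      using p[OF that st(1)] p[OF that t] st that by (simp add: frac_le mult_left_mono)
    show "0 < 1 / (1 + x * s) - 1 / (1 + x * t)" if "0 < x" for x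
      using p[of x s] p[of x t] st t that by (simp add: frac_less2)
  qed
  then have "(\<integral>x. 1 / (1 + x * t) \<partial>mu) < (\<integral>x. 1 / (1 + x * s) \<partial>mu)"
    using S.integrable_kernel_real[OF st(1)] S.integrable_kernel_real[OF t] by simp
  moreover have "0 < (\<integral>x. 1 / (1 + x * t) \<partial>mu)" using S.W_of_real_pos[OF t] .
  ultimately show ?thesis by (simp add: etr_def qtr_def frac_less2)
qed

lemma etr_continuous: assumes "mu \<in> Pplus" shows "continuous_on {0<..} (etr mu)"
proof -
  have "continuous_on {0<..} (\<lambda>s. Re (Qtr mu (of_real s) - 1))"
    by (intro continuous_intros continuous_on_compose2[OF holomorphic_on_imp_continuous_on[OF cbf_holo[OF cbf_Qtr[OF assms]]]]) auto
  moreover have "etr mu = (\<lambda>s. Re (Qtr mu (of_real s) - 1))" by (rule ext) (rule etr_eq_Qtr[OF assms])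
  ultimately show ?thesis by (simp only:)
qed

lemma Pplus_etr_eqI:
  assumes "mu \<in> Pplus" "nu \<in> Pplus" "\<forall>\<^sub>F s in at_right 0. etr mu s = etr nu s" shows "mu = nu"
  using assms by (intro Pplus_eqI) (auto simp: etr_def)

section \<open>Sigma-transforms and convolutions\<close>

lemma Ftr_eq_Qtr: assumes "z \<noteq> 0" shows "Ftr mu z = z * Qtr mu (- (1 / z))"
proof -
  have "cauchyG mu z = (\<integral>x. inverse z * (1 / (1 + of_real x * (- (1 / z)))) \<partial>mu)"
    unfolding cauchyG_def
  proof (rule Bochner_Integration.integral_cong[OF refl])
    fix x
    have "z - of_real x = z * (1 + of_real x * (- (1 / z)))" using assms by (simp add: field_simps)
    then show "inverse (z - of_real x) = inverse z * (1 / (1 + of_real x * (- (1 / z))))"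
      by (simp only: inverse_mult_distrib divide_inverse mult_1)
  qed
  also have "\<dots> = inverse z * (\<integral>x. 1 / (1 + of_real x * (- (1 / z))) \<partial>mu)"
    by (rule integral_mult_right_zero)
  finally have "cauchyG mu z = inverse z * (\<integral>x. 1 / (1 + of_real x * (- (1 / z))) \<partial>mu)" .
  then have "Ftr mu z = 1 / (inverse z * (\<integral>x. 1 / (1 + of_real x * (- (1 / z))) \<partial>mu))"
    unfolding Ftr_def by (rule arg_cong)
  then show ?thesis unfolding Qtr_def by (simp add: field_simps)
qed

lemma etatr_eq_Qtr: assumes "z \<noteq> 0" shows "etatr mu z = 1 - Qtr mu (- z)"
  using assms by (simp add: etatr_def Ftr_eq_Qtr)

lemma Ftr_neg:
  assumes "mu \<in> Pplus" "x < 0"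
  shows "Ftr mu (of_real x) = of_real (x * qtr mu (1 / (- x)))"
proof -
  have "- (1 / complex_of_real x) = of_real (1 / (- x))" by simp
  then show ?thesis using assms Qtr_of_real[OF assms(1), of "1 / (- x)"] by (simp add: Ftr_eq_Qtr)
qed

lemma qtr_0 [simp]: "mu \<in> Pplus \<Longrightarrow> qtr mu 0 = 1"
  by (simp add: qtr_def Pplus_real_distribution prob_space.prob_space[of mu] real_distribution.axioms(1))

lemma etr_0 [simp]: "mu \<in> Pplus \<Longrightarrow> etr mu 0 = 0"
  by (simp add: etr_def)

lemma etatr_neg:
  assumes "mu \<in> Pplus" shows "etatr mu (- of_real s) = - of_real (etr mu s)"
proof (cases "s = 0")
  case True then show ?thesis using assms by (simp add: etatr_def)
next
  case False then show ?thesis using assms by (simp add: etatr_eq_Qtr Qtr_of_real etr_def)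
qed

lemma etr_nonneg: "mu \<in> Pplus \<Longrightarrow> s \<ge> 0 \<Longrightarrow> 0 \<le> etr mu s"
  by (cases "s = 0") (auto simp: etr_def qtr_ge_1)

lemma etr_inj:
  assumes "mu \<in> Pplus" "mu \<noteq> delta0" "0 < s" "0 < t" "etr mu s = etr mu t" shows "s = t"
  using etr_strict_mono[OF assms(1,2,3), of t] etr_strict_mono[OF assms(1,2,4), of s] assms(5) by (cases s t rule: linorder_cases) auto

text \<open>By injectivity - s is the only negative preimage. Sigma-transforms are handled below in
  this parametrization by s, so that inverse functions never appear.\<close>

lemma Sigmatr_etr:
  assumes mu: "mu \<in> Pplus" "mu \<noteq> delta0" and s: "s > 0"
  shows "Sigmatr mu (- etr mu s) = s / etr mu s"
proof -
  have "(THE w. w < 0 \<and> etatr mu (of_real w) = of_real (- etr mu s)) = - s"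
  proof (rule the_equality)
    show "- s < 0 \<and> etatr mu (of_real (- s)) = of_real (- etr mu s)"
      using s etatr_neg[OF mu(1), of s] by simp
    fix w assume w: "w < 0 \<and> etatr mu (of_real w) = of_real (- etr mu s)"
    then have "etr mu (- w) = etr mu s" using etatr_neg[OF mu(1), of "- w"] by (simp flip: of_real_minus)
    then show "w = - s" using etr_inj[OF mu, of "- w" s] w s by simp
  qed
  then show ?thesis by (simp add: Sigmatr_def)
qed

lemma etr_filterlim:
  assumes "mu \<in> Pplus" "mu \<noteq> delta0" shows "filterlim (etr mu) (at_right 0) (at_right 0)"
  by (rule filterlim_at_right_0I[OF etr_tendsto_0[OF assms(1)] etr_pos[OF assms]])

lemma etr_surj_near_0:
  assumes mu: "mu \<in> Pplus" "mu \<noteq> delta0" and y: "0 < y" "y \<le> etr mu d" "0 < d"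
  obtains s where "0 < s" "s \<le> d" "etr mu s = y"
proof -
  have "\<forall>\<^sub>F s in at_right 0. etr mu s < y"
    using order_tendstoD(2)[OF etr_tendsto_0[OF mu(1)] y(1)] .
  then obtain b where b: "b > 0" "\<And>s. 0 < s \<Longrightarrow> s < b \<Longrightarrow> etr mu s < y"
    by (auto simp: eventually_at_right_field)
  define s0 where "s0 = min (b/2) d"
  have "0 < s0" "s0 \<le> d" "s0 < b" using b(1) y(3) by (auto simp: s0_def min_def)
  then have s0: "0 < s0" "s0 \<le> d" "etr mu s0 \<le> y" using b(2)[of s0] by auto
  have "continuous_on {s0..d} (etr mu)"
    by (rule continuous_on_subset[OF etr_continuous[OF mu(1)]]) (use s0 in auto)
  then obtain s where "s0 \<le> s" "s \<le> d" "etr mu s = y" using IVT'[of "etr mu" s0 y d] s0 y by auto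
  then show thesis using that[of s] s0 by auto
qed

text \<open>Near 0 the function \<open>etr mu\<close> is continuous, strictly increasing and onto a
  right neighbourhood of 0, so germs in the variable x = - etr mu s and germs in s may be
  exchanged.\<close>

lemma eventually_at_left_0_etr:
  assumes mu: "mu \<in> Pplus" "mu \<noteq> delta0"
  shows "(\<forall>\<^sub>F x in at_left 0. P x) \<longleftrightarrow> (\<forall>\<^sub>F s in at_right 0. P (- etr mu s))"
proof
  assume "\<forall>\<^sub>F x in at_left 0. P x"
  then have "\<forall>\<^sub>F y in at_right 0. P (- y)" by (simp add: eventually_at_left_to_right)
  then show "\<forall>\<^sub>F s in at_right 0. P (- etr mu s)" using etr_filterlim[OF mu] by (rule eventually_compose_filterlim)
next
  assume "\<forall>\<^sub>F s in at_right 0. P (- etr mu s)"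
  then obtain d where d: "d > 0" "\<And>s. 0 < s \<Longrightarrow> s < d \<Longrightarrow> P (- etr mu s)"
    by (auto simp: eventually_at_right_field)
  have "P (- y)" if y: "0 < y" "y < etr mu (d/2)" for y
  proof (rule etr_surj_near_0[OF mu y(1) less_imp_le[OF y(2)]])
    show "0 < d / 2" using d by simp
    fix s assume "0 < s" "s \<le> d / 2" "etr mu s = y"
    then show "P (- y)" using d(2)[of s] d(1) by simp
  qed
  moreover have "0 < etr mu (d/2)" using d by (intro etr_pos mu) simp
  ultimately have "\<forall>\<^sub>F y in at_right 0. P (- y)" by (auto simp: eventually_at_right_field)
  then show "\<forall>\<^sub>F x in at_left 0. P x" by (simp add: eventually_at_left_to_right)
qed

text \<open>Equality of the two Sigma-transforms at - y says that both \<open>etr\<close> functions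
  take the value y at the same s. Hence they agree near 0, which determines the measure.\<close>

lemma Sigmatr_unique:
  assumes r: "rho \<in> Pplus" "rho \<noteq> delta0" and r': "rho' \<in> Pplus" "rho' \<noteq> delta0"
    and ev: "\<forall>\<^sub>F x in at_left 0. Sigmatr rho x = Sigmatr rho' x"
  shows "rho = rho'"
proof (rule Pplus_etr_eqI[OF r(1) r'(1)])
  have e1: "0 < etr rho' 1" by (rule etr_pos[OF r']) simp
  have small: "\<forall>\<^sub>F s in at_right 0. etr rho s < etr rho' 1"
    using order_tendstoD(2)[OF etr_tendsto_0[OF r(1)] e1] .
  have "\<forall>\<^sub>F s in at_right 0. Sigmatr rho (- etr rho s) = Sigmatr rho' (- etr rho s)"
    using ev unfolding eventually_at_left_0_etr[OF r] .
  with small at_right_0_pos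
  show "\<forall>\<^sub>F s in at_right 0. etr rho s = etr rho' s"
  proof eventually_elim
    case (elim s)
    have p: "0 < etr rho s" by (rule etr_pos[OF r elim(2)])
    obtain s' where s': "0 < s'" "etr rho' s' = etr rho s"
      using etr_surj_near_0[OF r' p, of 1] elim(1) by auto
    have "s / etr rho s = s' / etr rho s"
      using elim(3) Sigmatr_etr[OF r elim(2)] Sigmatr_etr[OF r' s'(1)] s'(2) by simp
    then show ?case using p s' by simp
  qed
qed

text \<open>With e the common value, dividing u v = s e by e^2 gives s/e = (u/e)(v/e), which is the
  product rule for Sigma.\<close>

lemma Sigmatr_product_I:
  assumes mu: "mu \<in> Pplus" "mu \<noteq> delta0" and nu: "nu \<in> Pplus" "nu \<noteq> delta0" and rho: "rho \<in> Pplus" "rho \<noteq> delta0"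
    and ev: "\<forall>\<^sub>F s in at_right 0. \<exists>u>0. \<exists>v>0. etr mu u = etr rho s \<and> etr nu v = etr rho s \<and> u * v = s * etr rho s"
  shows "\<forall>\<^sub>F x in at_left 0. Sigmatr rho x = Sigmatr mu x * Sigmatr nu x"
  unfolding eventually_at_left_0_etr[OF rho]
  using ev at_right_0_pos
proof eventually_elim
  case (elim s)
  then obtain u v where uv: "u > 0" "v > 0" "etr mu u = etr rho s" "etr nu v = etr rho s" "u * v = s * etr rho s" by blast
  have p: "0 < etr rho s" by (rule etr_pos[OF rho elim(2)])
  show ?case
    using Sigmatr_etr[OF rho elim(2)] Sigmatr_etr[OF mu uv(1)] Sigmatr_etr[OF nu uv(2)] uv p by simp
qed

lemma Sigmatr_power_I:
  assumes mu: "mu \<in> Pplus" "mu \<noteq> delta0" and rho: "rho \<in> Pplus" "rho \<noteq> delta0"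
    and ev: "\<forall>\<^sub>F s in at_right 0. \<exists>u>0. etr mu u = etr rho s \<and> s / etr rho s = (u / etr rho s) powr t"
  shows "\<forall>\<^sub>F x in at_left 0. Sigmatr rho x = Sigmatr mu x powr t"
  unfolding eventually_at_left_0_etr[OF rho]
  using ev at_right_0_pos
proof eventually_elim
  case (elim s)
  then obtain u where u: "u > 0" "etr mu u = etr rho s" "s / etr rho s = (u / etr rho s) powr t" by blast
  show ?case using Sigmatr_etr[OF rho elim(2)] Sigmatr_etr[OF mu u(1)] u by simp
qed

section \<open>Evaluating the definite descriptions\<close>

lemma free_mult_conv_delta0: "mu = delta0 \<or> nu = delta0 \<Longrightarrow> free_mult_conv mu nu = delta0"
  unfolding free_mult_conv_def using delta0_Pplus by (intro the_equality) auto

lemma free_mult_conv_eqI: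
  assumes mu: "mu \<noteq> delta0" and nu: "nu \<noteq> delta0" and rho: "rho \<in> Pplus" "rho \<noteq> delta0"
    and ev: "\<forall>\<^sub>F x in at_left 0. Sigmatr rho x = Sigmatr mu x * Sigmatr nu x"
  shows "free_mult_conv mu nu = rho"
proof -
  have "r = rho" if r: "r \<in> Pplus" "r \<noteq> delta0" "\<forall>\<^sub>F x in at_left 0. Sigmatr r x = Sigmatr mu x * Sigmatr nu x" for r
    by (rule Sigmatr_unique[OF r(1,2) rho]) (use r(3) ev in eventually_elim, simp)
  moreover have if_eq: "(if mu = delta0 \<or> nu = delta0 then X else Y) = Y" for X Y :: bool using mu nu by simp
  ultimately show ?thesis unfolding free_mult_conv_def if_eq using rho ev by (intro the_equality) blast+
qed

lemma free_mult_pow_delta0: "free_mult_pow delta0 t = delta0"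
  unfolding free_mult_pow_def using delta0_Pplus by (intro the_equality) auto

lemma free_mult_pow_eqI:
  assumes mu: "mu \<noteq> delta0" and rho: "rho \<in> Pplus" "rho \<noteq> delta0"
    and ev: "\<forall>\<^sub>F x in at_left 0. Sigmatr rho x = Sigmatr mu x powr t"
  shows "free_mult_pow mu t = rho"
proof -
  have "r = rho" if r: "r \<in> Pplus" "r \<noteq> delta0" "\<forall>\<^sub>F x in at_left 0. Sigmatr r x = Sigmatr mu x powr t" for r
    by (rule Sigmatr_unique[OF r(1,2) rho]) (use r(3) ev in eventually_elim, simp)
  moreover have if_eq: "(if mu = delta0 then X else Y) = Y" for X Y :: bool using mu by simp
  ultimately show ?thesis unfolding free_mult_pow_def if_eq using rho ev by (intro the_equality) blast+
qed

lemma etatr_etr_cong: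
  assumes rho: "rho \<in> Pplus"
  shows "(\<forall>x::real. x < 0 \<longrightarrow> etatr rho (of_real x) = of_real (- g (- x))) \<longleftrightarrow> (\<forall>s>0. etr rho s = g s)"
proof
  assume l: "\<forall>x::real. x < 0 \<longrightarrow> etatr rho (of_real x) = of_real (- g (- x))"
  show "\<forall>s>0. etr rho s = g s"
  proof (intro allI impI)
    fix s :: real assume "s > 0"
    then show "etr rho s = g s" using l[rule_format, of "- s"] etatr_neg[OF rho, of s] by simp
  qed
next
  assume r: "\<forall>s>0. etr rho s = g s"
  show "\<forall>x::real. x < 0 \<longrightarrow> etatr rho (of_real x) = of_real (- g (- x))"
  proof (intro allI impI)
    fix x :: real assume "x < 0"
    then show "etatr rho (of_real x) = of_real (- g (- x))"
      using r[rule_format, of "- x"] etatr_neg[OF rho, of "- x"] by simp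
  qed
qed

lemma Pplus_etr_eqI': "mu \<in> Pplus \<Longrightarrow> nu \<in> Pplus \<Longrightarrow> (\<And>s. s > 0 \<Longrightarrow> etr mu s = etr nu s) \<Longrightarrow> mu = nu"
  by (rule Pplus_etr_eqI) (auto intro: eventually_at_right_0I)

lemma mono_mult_conv_eqI:
  assumes mu: "mu \<in> Pplus" and nu: "nu \<in> Pplus" and rho: "rho \<in> Pplus"
    and eq: "\<And>s. s > 0 \<Longrightarrow> etr rho s = etr mu (etr nu s)"
  shows "mono_mult_conv mu nu = rho"
proof -
  have iff: "(\<forall>x::real. x < 0 \<longrightarrow> etatr r (of_real x) = etatr mu (etatr nu (of_real x)))
     \<longleftrightarrow> (\<forall>s>0. etr r s = etr mu (etr nu s))" if "r \<in> Pplus" for r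
  proof -
    have "etatr mu (etatr nu (of_real x)) = of_real (- etr mu (etr nu (- x)))" for x
      using etatr_neg[OF nu, of "- x"] etatr_neg[OF mu, of "etr nu (- x)"] by simp
    then show ?thesis using etatr_etr_cong[OF that, of "\<lambda>s. etr mu (etr nu s)"] by simp
  qed
  have "r = rho" if "r \<in> Pplus" "\<forall>s>0. etr r s = etr mu (etr nu s)" for r
    using that rho eq by (intro Pplus_etr_eqI') auto
  then show ?thesis unfolding mono_mult_conv_def using iff rho eq by (intro the_equality) blast+
qed

lemma Pplus_etr_cbf_exists:
  assumes f: "cbf f" and F: "\<And>s. s > 0 \<Longrightarrow> f (of_real s) = of_real (F s)" and lim: "(F \<longlongrightarrow> 0) (at_right 0)"
  obtains mu where "mu \<in> Pplus" "mu \<noteq> delta0" "\<And>s. s > 0 \<Longrightarrow> etr mu s = F s"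
proof -
  have "((\<lambda>s. Re (f (of_real s))) \<longlongrightarrow> 0) (at_right 0)"
    by (rule Lim_transform_eventually[OF lim]) (auto intro: eventually_at_right_0I simp: F)
  from Pplus_of_cbf_etr[OF f this] obtain mu where "mu \<in> Pplus" "mu \<noteq> delta0" "\<forall>s>0. etr mu s = Re (f (of_real s))" by blast
  then show thesis using that F by auto
qed

lemma Etr_of_real: "mu \<in> Pplus \<Longrightarrow> Qtr mu (of_real s) - 1 = of_real (etr mu s)"
  by (simp add: Qtr_of_real etr_def)

text \<open>Existence comes from closure under composition. If a factor is \<open>delta0\<close>,
  the composite vanishes, because \<open>etr mu 0 = 0\<close>, and \<open>delta0\<close> is the
  witness.\<close>

lemma mono_mult_conv_etr:
  assumes mu: "mu \<in> Pplus" and nu: "nu \<in> Pplus"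
  shows "mono_mult_conv mu nu \<in> Pplus" "\<And>s. s > 0 \<Longrightarrow> etr (mono_mult_conv mu nu) s = etr mu (etr nu s)"
proof -
  have "\<exists>rho\<in>Pplus. \<forall>s>0. etr rho s = etr mu (etr nu s)"
  proof (cases "mu = delta0 \<or> nu = delta0")
    case True
    then show ?thesis using mu delta0_Pplus by (intro bexI[of _ delta0]) auto
  next
    case False
    have c: "cbf (\<lambda>z. Qtr mu (Qtr nu z - 1) - 1)"
      using cbf_comp[OF cbf_Etr[OF mu] cbf_Etr[OF nu]] False by simp
    have l: "((\<lambda>s. etr mu (etr nu s)) \<longlongrightarrow> 0) (at_right 0)"
      using filterlim_compose[OF etr_tendsto_0[OF mu] etr_filterlim[OF nu]] False by simp
    show ?thesis
      by (rule Pplus_etr_cbf_exists[OF c _ l]) (auto simp: Etr_of_real mu nu)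
  qed
  then obtain rho where r: "rho \<in> Pplus" "\<And>s. s > 0 \<Longrightarrow> etr rho s = etr mu (etr nu s)" by blast
  have "mono_mult_conv mu nu = rho" by (rule mono_mult_conv_eqI[OF mu nu r])
  with r show "mono_mult_conv mu nu \<in> Pplus" "\<And>s. s > 0 \<Longrightarrow> etr (mono_mult_conv mu nu) s = etr mu (etr nu s)" by auto
qed

text \<open>This is the uniqueness half of \<open>Bmap\<close>. Values equal to 0 are treated apart
  because injectivity of \<open>etr mu\<close> is available only on the open half-line.\<close>

lemma mono_mult_conv_cancel:
  assumes mu: "mu \<in> Pplus" "mu \<noteq> delta0" and r: "r1 \<in> Pplus" "r2 \<in> Pplus"
    and eq: "mono_mult_conv mu r1 = mono_mult_conv mu r2"
  shows "r1 = r2"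
proof (rule Pplus_etr_eqI'[OF r])
  fix s :: real assume s: "s > 0"
  have e: "etr mu (etr r1 s) = etr mu (etr r2 s)"
    using mono_mult_conv_etr(2)[OF mu(1) r(1) s] mono_mult_conv_etr(2)[OF mu(1) r(2) s] eq by simp
  have n: "0 \<le> etr r1 s" "0 \<le> etr r2 s" using s r by (auto intro: etr_nonneg)
  show "etr r1 s = etr r2 s"
  proof (cases "etr r1 s = 0 \<or> etr r2 s = 0")
    case True
    then show ?thesis using e n mu etr_pos[OF mu] by (metis etr_0 less_eq_real_def less_irrefl)
  next
    case False
    then show ?thesis using etr_inj[OF mu _ _ e] n by simp
  qed
qed

lemma Bmap_eqI:
  assumes mu: "mu \<in> Pplus" "mu \<noteq> delta0" and B: "B \<in> Pplus" and eq: "free_mult_conv mu nu = mono_mult_conv mu B"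
  shows "Bmap mu nu = B"
  unfolding Bmap_def
  by (rule the_equality) (use assms mono_mult_conv_cancel[OF mu] in auto)

section \<open>Subordination and free convolution\<close>

text \<open>The sign of T w - w on the two sides of \<open>ws\<close> replaces a contraction
  estimate. Monotonicity makes each side invariant: w \<le> ws < T w would give T w \<le> T (T w) <
  T w. The orbit is then monotone and bounded, and its positive limit is a fixed point, hence
  \<open>ws\<close>.\<close>

lemma monotone_iteration_tendsto:
  fixes T :: "real \<Rightarrow> real"
  assumes mono: "\<And>v w. 0 < v \<Longrightarrow> v \<le> w \<Longrightarrow> T v \<le> T w"
    and cont: "continuous_on {0<..} T" and ws: "0 < ws" and w0: "0 < w0"
    and below: "\<And>w. 0 < w \<Longrightarrow> w < ws \<Longrightarrow> w < T w" and above: "\<And>w. ws < w \<Longrightarrow> T w < w"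
  shows "(\<lambda>n. (T ^^ n) w0) \<longlonglongrightarrow> ws"
proof -
  have fix_le: "T w \<le> ws" if "0 < w" "w \<le> ws" for w
  proof (rule ccontr)
    assume "\<not> T w \<le> ws"
    then have c: "ws < T w" by simp
    have "T w \<le> T (T w)" using that c ws by (intro mono) auto
    moreover have "T (T w) < T w" by (rule above[OF c])
    ultimately show False by simp
  qed
  have fix_ge: "ws \<le> T w" if "ws \<le> w" for w
  proof (rule ccontr)
    assume "\<not> ws \<le> T w"
    then have c: "T w < ws" by simp
    have "ws / 2 < T (ws / 2)" using ws by (intro below) auto
    also have "T (ws / 2) \<le> T w" using ws that by (intro mono) auto
    finally have p: "0 < T w" using ws by simp
    have "T (T w) \<le> T w" using p c that by (intro mono) auto
    moreover have "T w < T (T w)" by (rule below[OF p c])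
    ultimately show False by simp
  qed
  have step: "T L = L" if X: "(\<lambda>n. (T ^^ n) w0) \<longlonglongrightarrow> L" "\<And>n. 0 < (T ^^ n) w0" "0 < L" for L
  proof -
    have "(\<lambda>n. T ((T ^^ n) w0)) \<longlonglongrightarrow> T L"
      using X by (intro continuous_on_tendsto_compose[OF cont]) auto
    moreover have "(\<lambda>n. T ((T ^^ n) w0)) \<longlonglongrightarrow> L" using LIMSEQ_Suc[OF X(1)] by simp
    ultimately show ?thesis by (rule LIMSEQ_unique)
  qed
  show ?thesis
  proof (cases "w0 \<le> ws")
    case True
    have inv: "w0 \<le> (T ^^ n) w0 \<and> (T ^^ n) w0 \<le> ws" for n
    proof (induction n)
      case (Suc n)
      then have p: "0 < (T ^^ n) w0" "(T ^^ n) w0 \<le> ws" using w0 by auto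
      have "(T ^^ n) w0 \<le> T ((T ^^ n) w0)" using below[OF p(1)] p fix_ge[of ws] by (cases "(T ^^ n) w0 = ws") auto
      then show ?case using Suc fix_le[OF p] by simp
    qed (use True in simp)
    then have pos: "0 < (T ^^ n) w0" for n using w0 by (meson less_le_trans)
    have inc: "(T ^^ n) w0 \<le> (T ^^ Suc n) w0" for n
      using below[OF pos, of n] inv[of n] fix_ge[of ws] by (cases "(T ^^ n) w0 = ws") auto
    then have "incseq (\<lambda>n. (T ^^ n) w0)" by (rule incseq_SucI)
    then obtain L where L: "(\<lambda>n. (T ^^ n) w0) \<longlonglongrightarrow> L" "\<forall>n. (T ^^ n) w0 \<le> L"
      using incseq_convergent[of _ ws] inv by blast
    have Lw: "w0 \<le> L" "L \<le> ws" using L(2)[rule_format, of 0] LIMSEQ_le_const2[OF L(1), of ws] inv by auto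
    have "T L = L" using step[OF L(1) pos] Lw w0 by simp
    then have "L = ws" using below[of L] Lw w0 by (cases "L = ws") auto
    then show ?thesis using L by simp
  next
    case False
    have inv: "ws \<le> (T ^^ n) w0" for n
    proof (induction n)
      case (Suc n) then show ?case using fix_ge by simp
    qed (use False in simp)
    then have pos: "0 < (T ^^ n) w0" for n using ws by (meson less_le_trans)
    have dec: "(T ^^ Suc n) w0 \<le> (T ^^ n) w0" for n
      using above[of "(T ^^ n) w0"] inv[of n] fix_le[of ws] ws by (cases "(T ^^ n) w0 = ws") auto
    then have "decseq (\<lambda>n. (T ^^ n) w0)" by (rule decseq_SucI)
    then obtain L where L: "(\<lambda>n. (T ^^ n) w0) \<longlonglongrightarrow> L" "\<forall>n. L \<le> (T ^^ n) w0"
      using decseq_convergent[of _ ws] inv by blast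
    have Lw: "ws \<le> L" using LIMSEQ_le_const[OF L(1), of ws] inv by auto
    have "T L = L" using step[OF L(1) pos] Lw ws by simp
    then have "L = ws" using above[of L] Lw by (cases "L = ws") auto
    then show ?thesis using L by simp
  qed
qed

text \<open>\<open>T s\<close> describes how the operator \<open>F\<close> acts on values at s, so
  one sequence of functions in the class performs the real iteration at every s simultaneously; the
  limit theorem then promotes \<open>ws\<close> to a member of the class.\<close>

lemma cbf_fixed_point:
  fixes T :: "real \<Rightarrow> real \<Rightarrow> real" and F :: "(complex \<Rightarrow> complex) \<Rightarrow> complex \<Rightarrow> complex"
  assumes F: "\<And>w. cbf w \<Longrightarrow> cbf (F w)"
    and FT: "\<And>w s. cbf w \<Longrightarrow> 0 < s \<Longrightarrow> F w (of_real s) = of_real (T s (Re (w (of_real s))))"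
    and mono: "\<And>s v w. 0 < s \<Longrightarrow> 0 < v \<Longrightarrow> v \<le> w \<Longrightarrow> T s v \<le> T s w"
    and cont: "\<And>s. 0 < s \<Longrightarrow> continuous_on {0<..} (T s)" and ws: "\<And>s. 0 < s \<Longrightarrow> 0 < ws s"
    and below: "\<And>s w. 0 < s \<Longrightarrow> 0 < w \<Longrightarrow> w < ws s \<Longrightarrow> w < T s w"
    and above: "\<And>s w. 0 < s \<Longrightarrow> ws s < w \<Longrightarrow> T s w < w"
  shows "\<exists>w. cbf w \<and> (\<forall>s>0. w (of_real s) = of_real (ws s))"
proof (rule cbf_limit)
  show c: "cbf ((F ^^ n) (\<lambda>z. z))" for n by (induction n) (auto intro: cbf_id F)
  show "(\<lambda>n. Re ((F ^^ n) (\<lambda>z. z) (of_real s))) \<longlonglongrightarrow> ws s" if s: "s > 0" for s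
  proof -
    have "Re ((F ^^ n) (\<lambda>z. z) (of_real s)) = (T s ^^ n) s" for n
      by (induction n) (simp_all add: FT[OF c s])
    then show ?thesis
      using monotone_iteration_tendsto[OF mono[OF s] cont[OF s] ws[OF s] s below[OF s] above[OF s]] by simp
  qed
qed (fact ws)

lemma eventually_small_tendsto_0:
  fixes w :: "real \<Rightarrow> real"
  assumes "\<And>s. 0 < s \<Longrightarrow> 0 < w s" "\<And>e. 0 < e \<Longrightarrow> \<forall>\<^sub>F s in at_right 0. w s < e"
  shows "(w \<longlongrightarrow> 0) (at_right 0)"
proof (rule tendstoI)
  fix e :: real assume "0 < e"
  from assms(2)[OF this] at_right_0_pos
  show "\<forall>\<^sub>F s in at_right 0. dist (w s) 0 < e"
  proof eventually_elim
    case (elim s) then show ?case using assms(1)[of s] by simp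
  qed
qed

lemma etr_mono: "mu \<in> Pplus \<Longrightarrow> mu \<noteq> delta0 \<Longrightarrow> 0 < s \<Longrightarrow> s \<le> t \<Longrightarrow> etr mu s \<le> etr mu t"
  using etr_strict_mono[of mu s t] by (cases "s = t") auto

text \<open>With \<open>k = etr mu w / w\<close>, the first subordination function at \<open>s\<close> is the solution \<open>w\<close> of
  \<open>etr nu (s * k) = etr mu w\<close>: the left-hand side decreases and the right-hand side increases in \<open>w\<close>.\<close>
lemma subordination_point:
  assumes mu: "mu \<in> Pplus" "mu \<noteq> delta0" and nu: "nu \<in> Pplus" "nu \<noteq> delta0" and s: "0 < s"
  obtains w where "0 < w" "etr nu (s * etr mu w / w) = etr mu w"
proof -
  define D where "D w = etr mu w - etr nu (s * etr mu w / w)" for w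
  have k: "0 < s * etr mu w / w" if "0 < w" for w using etr_pos[OF mu that] s that by simp
  have kanti: "s * etr mu v / v \<le> s * etr mu w / w" if "0 < w" "w \<le> v" for v w
    using mult_left_mono[OF etr_ratio_antimono[OF mu that], of s] s by simp
  have Dc: "continuous_on {0<..} D"
    unfolding D_def
    by (intro continuous_intros etr_continuous mu continuous_on_compose2[OF etr_continuous[OF nu(1)]]) (auto simp: k)
  have "\<forall>\<^sub>F w in at_right 0. etr mu w < etr nu (s * etr mu 1 / 1)"
    by (rule order_tendstoD(2)[OF etr_tendsto_0[OF mu(1)]]) (intro etr_pos nu k, simp)
  then obtain b where b: "b > 0" "\<And>w. 0 < w \<Longrightarrow> w < b \<Longrightarrow> etr mu w < etr nu (s * etr mu 1 / 1)"
    by (auto simp: eventually_at_right_field)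
  define l where "l = min 1 (b / 2)"
  have l: "0 < l" "l \<le> 1" "l < b" using b(1) by (auto simp: l_def)
  have "etr nu (s * etr mu 1 / 1) \<le> etr nu (s * etr mu l / l)"
    by (intro etr_mono nu k kanti l) simp
  then have Dl: "D l \<le> 0" using b(2)[OF l(1,3)] by (simp add: D_def)
  obtain h where h: "1 \<le> h" "0 \<le> D h"
  proof (cases "\<exists>h\<ge>1. etr nu (s * etr mu 1 / 1) \<le> etr mu h")
    case True
    then obtain h where h: "1 \<le> h" "etr nu (s * etr mu 1 / 1) \<le> etr mu h" by blast
    have "etr nu (s * etr mu h / h) \<le> etr nu (s * etr mu 1 / 1)"
      by (rule etr_mono[OF nu k kanti]) (use h in auto)
    then show thesis using that[of h] h by (simp add: D_def)
  next
    case False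
    define C where "C = etr nu (s * etr mu 1 / 1)"
    have C: "etr mu h < C" if "1 \<le> h" for h using False that unfolding C_def by (meson not_le)
    have e1: "0 < etr mu 1" by (rule etr_pos[OF mu]) simp
    have "\<forall>\<^sub>F w in at_right 0. etr nu w < etr mu 1"
      by (rule order_tendstoD(2)[OF etr_tendsto_0[OF nu(1)] e1])
    then obtain c where c: "c > 0" "\<And>w. 0 < w \<Longrightarrow> w < c \<Longrightarrow> etr nu w < etr mu 1"
      by (auto simp: eventually_at_right_field)
    have C0: "0 < C" using C[of 1] e1 by simp
    \<comment> \<open>While \<open>etr mu\<close> stays below C, the argument s * etr mu h / h is
      below s * C / h; this \<open>h\<close> is large enough to push it under c, where
      \<open>etr nu\<close> is below \<open>etr mu 1\<close>.\<close>
    define h where "h = max 1 (s * C / c)"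
    have h1: "1 \<le> h" by (simp add: h_def)
    have "s * C / c \<le> h" by (simp add: h_def)
    then have "s * C \<le> h * c" using c(1) by (simp add: pos_divide_le_eq)
    moreover have "s * etr mu h < s * C" using C[OF h1] s by simp
    ultimately have "s * etr mu h / h < c" using h1 by (simp add: pos_divide_less_eq mult.commute)
    then have "etr nu (s * etr mu h / h) < etr mu 1" using h1 by (intro c(2) k) auto
    also have "etr mu 1 \<le> etr mu h" using h1 by (intro etr_mono mu) auto
    finally show thesis using that[of h] h1 by (simp add: D_def)
  qed
  have "continuous_on {l..h} D" by (rule continuous_on_subset[OF Dc]) (use l in auto)
  then obtain w where "l \<le> w" "w \<le> h" "D w = 0" using IVT'[of D l 0 h] Dl h l by auto
  then show thesis using that[of w] l by (simp add: D_def)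
qed

text \<open>With y = s e_mu(w)/w, the expression s e_nu(y)/y equals w e_nu(y)/e_mu(w). So the
  equation e_nu(y) = e_mu(w) is the fixed-point equation w = s e_nu(y)/y, and comparing its two
  sides gives the sign that the iteration wants. The map is the basic step z f(w)/w applied twice,
  so it stays in the class. It is nondecreasing in w, since y is nonincreasing in w and e_nu(y)/y is
  nonincreasing in y.\<close>

theorem subordination_exists:
  assumes mu: "mu \<in> Pplus" "mu \<noteq> delta0" and nu: "nu \<in> Pplus" "nu \<noteq> delta0"
  obtains B where "B \<in> Pplus" "B \<noteq> delta0"
    "\<And>s. s > 0 \<Longrightarrow> etr nu (s * etr mu (etr B s) / etr B s) = etr mu (etr B s)"
proof -
  have "\<exists>w. 0 < w \<and> etr nu (s * etr mu w / w) = etr mu w" if "0 < s" for s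
    using subordination_point[OF mu nu that] by metis
  then obtain ws where ws: "\<And>s. 0 < s \<Longrightarrow> 0 < ws s" "\<And>s. 0 < s \<Longrightarrow> etr nu (s * etr mu (ws s) / ws s) = etr mu (ws s)"
    by metis
  have k: "0 < s * etr mu w / w" if "0 < s" "0 < w" for s w using etr_pos[OF mu that(2)] that by simp
  have kanti: "s * etr mu v / v \<le> s * etr mu w / w" if "0 < s" "0 < w" "w \<le> v" for s v w
    using mult_left_mono[OF etr_ratio_antimono[OF mu that(2,3)], of s] that(1) by simp
  have lt: "etr mu w < etr nu (s * etr mu w / w)" if "0 < s" "0 < w" "w < ws s" for s w
  proof -
    have "etr mu w < etr mu (ws s)" using that by (intro etr_strict_mono mu)
    also have "\<dots> = etr nu (s * etr mu (ws s) / ws s)" using ws(2)[OF that(1)] by simp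
    also have "\<dots> \<le> etr nu (s * etr mu w / w)"
      using that ws(1) by (intro etr_mono nu k kanti) auto
    finally show ?thesis .
  qed
  have gt: "etr nu (s * etr mu w / w) < etr mu w" if "0 < s" "ws s < w" for s w
  proof -
    have "etr nu (s * etr mu w / w) \<le> etr nu (s * etr mu (ws s) / ws s)"
      using that ws(1)[OF that(1)] by (intro etr_mono nu k kanti) auto
    also have "\<dots> = etr mu (ws s)" using ws(2)[OF that(1)] .
    also have "\<dots> < etr mu w" using that ws(1)[OF that(1)] by (intro etr_strict_mono mu)
    finally show ?thesis .
  qed
  define T where "T s w = s * etr nu (s * etr mu w / w) / (s * etr mu w / w)" for s w
  have T: "T s w = w * (etr nu (s * etr mu w / w) / etr mu w)" if "0 < s" for s w
    using that by (simp add: T_def)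
  define E where "E m z = Qtr m z - 1" for m z
  define F where "F w z = z * E nu (z * E mu (w z) / w z) / (z * E mu (w z) / w z)" for w :: "complex \<Rightarrow> complex" and z
  have E: "cbf (E mu)" "cbf (E nu)" unfolding E_def by (intro cbf_Etr mu nu)+
  have Er: "E mu (of_real x) = of_real (etr mu x)" "E nu (of_real x) = of_real (etr nu x)" for x
    by (simp_all add: E_def Etr_of_real mu nu)
  have "\<exists>w. cbf w \<and> (\<forall>s>0. w (of_real s) = of_real (ws s))"
  proof (rule cbf_fixed_point[where F = F and T = T])
    show "cbf (F w)" if "cbf w" for w
      unfolding F_def by (rule cbf_subordination_step[OF E(2) cbf_subordination_step[OF E(1) that]])
    show "F w (of_real s) = of_real (T s (Re (w (of_real s))))" if w: "cbf w" "0 < s" for w s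
    proof -
      define r where "r = Re (w (of_real s))"
      have r: "w (of_real s) = of_real r" unfolding r_def by (rule cbf_real(1)[OF w])
      define y where "y = s * etr mu r / r"
      have "of_real s * E mu (of_real r) / of_real r = of_real y" by (simp add: Er y_def)
      then have "F w (of_real s) = of_real s * E nu (of_real y) / of_real y"
        unfolding F_def r by (simp only:)
      also have "\<dots> = of_real (s * etr nu y / y)" by (simp add: Er)
      finally show ?thesis unfolding r Re_complex_of_real T_def y_def .
    qed
    show "T s v \<le> T s w" if "0 < s" "0 < v" "v \<le> w" for s v w
    proof -
      have w: "0 < w" using that by simp
      have "etr nu (s * etr mu v / v) / (s * etr mu v / v) \<le> etr nu (s * etr mu w / w) / (s * etr mu w / w)"
        by (rule etr_ratio_antimono[OF nu k[OF that(1) w] kanti[OF that]])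
      from mult_left_mono[OF this, of s] show ?thesis using that by (simp add: T_def)
    qed
    show "continuous_on {0<..} (T s)" if s: "0 < s" for s
    proof -
      have kc: "continuous_on {0<..} (\<lambda>w. s * etr mu w / w)"
        by (intro continuous_intros etr_continuous mu) auto
      have "continuous_on {0<..} (\<lambda>w. etr nu (s * etr mu w / w))"
        by (rule continuous_on_compose2[OF etr_continuous[OF nu(1)] kc]) (use k[OF s] in auto)
      then show ?thesis unfolding T_def
        by (rule continuous_on_divide[OF continuous_on_mult[OF continuous_on_const] kc])
           (use k[OF s] in force)
    qed
    show "w < T s w" if "0 < s" "0 < w" "w < ws s" for s w
      using lt[OF that] that etr_pos[OF mu that(2)] by (simp add: T less_divide_eq mult_less_cancel_left)
    show "T s w < w" if "0 < s" "ws s < w" for s w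
    proof -
      have w: "0 < w" using that ws(1)[OF that(1)] by simp
      then show ?thesis using gt[OF that] that etr_pos[OF mu w] by (simp add: T divide_less_eq mult_less_cancel_left)
    qed
  qed (fact ws)
  then obtain w where w: "cbf w" "\<And>s. 0 < s \<Longrightarrow> w (of_real s) = of_real (ws s)" by blast
  \<comment> \<open>If \<open>ws s\<close> were at least e, then
    \<open>etr nu (s * etr mu e / e)\<close> would be at least \<open>etr mu e\<close>, although it
    tends to 0 with s.\<close>
  have "(ws \<longlongrightarrow> 0) (at_right 0)"
  proof (rule eventually_small_tendsto_0[OF ws(1)])
    fix e :: real assume e: "0 < e"
    have "filterlim (\<lambda>s. s * etr mu e / e) (at_right 0) (at_right 0)"
    proof (rule filterlim_at_right_0I[OF _ k[OF _ e]])
      have "((\<lambda>s. s * etr mu e / e) \<longlongrightarrow> 0 * etr mu e / e) (at_right 0)" using e by (intro tendsto_intros) auto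
      then show "((\<lambda>s. s * etr mu e / e) \<longlongrightarrow> 0) (at_right 0)" by simp
    qed
    from filterlim_compose[OF etr_tendsto_0[OF nu(1)] this]
    have "((\<lambda>s. etr nu (s * etr mu e / e)) \<longlongrightarrow> 0) (at_right 0)" .
    from order_tendstoD(2)[OF this etr_pos[OF mu e]] at_right_0_pos
    show "\<forall>\<^sub>F s in at_right 0. ws s < e"
    proof eventually_elim
      case (elim s)
      show ?case
      proof (rule ccontr)
        assume c: "\<not> ws s < e"
        show False using lt[OF elim(2) e] ws(2)[OF elim(2)] elim(1) c by (cases "ws s = e") auto
      qed
    qed
  qed
  from Pplus_etr_cbf_exists[OF w this] obtain B where B: "B \<in> Pplus" "B \<noteq> delta0" "\<And>s. s > 0 \<Longrightarrow> etr B s = ws s"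
    by metis
  show thesis by (rule that[OF B(1,2)]) (simp add: B(3) ws(2))
qed

text \<open>Take u = e_B(s) and v = s e_mu(u)/u for the subordination measure B. Then e_mu(u) =
  e_nu(v) and u v = s e_mu(u), which is the product rule for the monotone convolution of mu with B.
  So this convolution is the free one, and B is \<open>Bmap mu nu\<close>.\<close>

lemma free_mult_conv_Bmap:
  assumes mu: "mu \<in> Pplus" "mu \<noteq> delta0" and nu: "nu \<in> Pplus" "nu \<noteq> delta0"
  shows "Bmap mu nu \<in> Pplus" "Bmap mu nu \<noteq> delta0"
    "free_mult_conv mu nu = mono_mult_conv mu (Bmap mu nu)"
    "\<And>s. s > 0 \<Longrightarrow> etr nu (s * etr mu (etr (Bmap mu nu) s) / etr (Bmap mu nu) s) = etr mu (etr (Bmap mu nu) s)"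
    "\<forall>\<^sub>F x in at_left 0. Sigmatr (free_mult_conv mu nu) x = Sigmatr mu x * Sigmatr nu x"
    "free_mult_conv mu nu \<in> Pplus" "free_mult_conv mu nu \<noteq> delta0"
proof -
  from subordination_exists[OF mu nu] obtain B where B: "B \<in> Pplus" "B \<noteq> delta0"
    and sub: "\<And>s. s > 0 \<Longrightarrow> etr nu (s * etr mu (etr B s) / etr B s) = etr mu (etr B s)" by metis
  define rho where "rho = mono_mult_conv mu B"
  have rho: "rho \<in> Pplus" "\<And>s. s > 0 \<Longrightarrow> etr rho s = etr mu (etr B s)"
    unfolding rho_def using mono_mult_conv_etr[OF mu(1) B(1)] by auto
  have "0 < etr rho 1" using rho(2)[of 1] etr_pos[OF mu etr_pos[OF B, of 1]] by simp
  then have rho0: "rho \<noteq> delta0" by auto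
  have ev: "\<forall>\<^sub>F x in at_left 0. Sigmatr rho x = Sigmatr mu x * Sigmatr nu x"
  proof (rule Sigmatr_product_I[OF mu nu rho(1) rho0])
    show "\<forall>\<^sub>F s in at_right 0. \<exists>u>0. \<exists>v>0. etr mu u = etr rho s \<and> etr nu v = etr rho s \<and> u * v = s * etr rho s"
      using at_right_0_pos
    proof eventually_elim
      case (elim s)
      have b: "0 < etr B s" by (rule etr_pos[OF B elim])
      show ?case
        by (rule exI[of _ "etr B s"], intro conjI b, rule exI[of _ "s * etr mu (etr B s) / etr B s"])
          (use b elim sub[OF elim] etr_pos[OF mu b] in \<open>simp add: rho\<close>)
    qed
  qed
  have conv: "free_mult_conv mu nu = rho" by (rule free_mult_conv_eqI[OF mu(2) nu(2) rho(1) rho0 ev])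
  have "Bmap mu nu = B" by (rule Bmap_eqI[OF mu B(1)]) (simp add: conv rho_def)
  with B sub conv rho rho0 ev show "Bmap mu nu \<in> Pplus" "Bmap mu nu \<noteq> delta0"
    "free_mult_conv mu nu = mono_mult_conv mu (Bmap mu nu)"
    "\<And>s. s > 0 \<Longrightarrow> etr nu (s * etr mu (etr (Bmap mu nu) s) / etr (Bmap mu nu) s) = etr mu (etr (Bmap mu nu) s)"
    "\<forall>\<^sub>F x in at_left 0. Sigmatr (free_mult_conv mu nu) x = Sigmatr mu x * Sigmatr nu x"
    "free_mult_conv mu nu \<in> Pplus" "free_mult_conv mu nu \<noteq> delta0"
    by (simp_all add: rho_def)
qed

lemma Bmap_delta0: assumes "mu \<in> Pplus" "mu \<noteq> delta0" shows "Bmap mu delta0 = delta0"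
proof (rule Bmap_eqI[OF assms delta0_Pplus])
  have "mono_mult_conv mu delta0 = delta0"
    by (rule mono_mult_conv_eqI) (use assms delta0_Pplus in auto)
  then show "free_mult_conv mu delta0 = mono_mult_conv mu delta0" by (simp add: free_mult_conv_delta0)
qed

section \<open>Free convolution powers and the beta law\<close>

text \<open>Let w be the point where e_mu takes the value e = e_rho(s). Then s/e = (w/e)^t reads s =
  w (w/e)^(t-1), that is, s = R w. With a = 1/t this is the fixed-point equation w = s^a
  e_mu(w)^(1-a), a geometric mean, so the iteration stays in the class. \<open>R\<close> is strictly
  increasing because w/e_mu(w) is nondecreasing.\<close>

theorem free_mult_pow_Pplus:
  assumes mu: "mu \<in> Pplus" "mu \<noteq> delta0" and t: "1 \<le> t"
  shows "free_mult_pow mu t \<in> Pplus" "free_mult_pow mu t \<noteq> delta0"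
    "\<forall>\<^sub>F x in at_left 0. Sigmatr (free_mult_pow mu t) x = Sigmatr mu x powr t"
proof -
  define a where "a = 1 / t"
  have a: "0 < a" "a \<le> 1" "a * t = 1" using t by (auto simp: a_def)
  define R where "R w = w * (w / etr mu w) powr (t - 1)" for w
  have ep: "0 < etr mu w" if "0 < w" for w by (rule etr_pos[OF mu that])
  have Rp: "0 < R w" if "0 < w" for w using that ep[OF that] by (simp add: R_def)
  have ratio: "v / etr mu v \<le> w / etr mu w" if "0 < v" "v \<le> w" for v w
  proof -
    have w: "0 < w" using that by simp
    have "etr mu w / w \<le> etr mu v / v" by (rule etr_ratio_antimono[OF mu that])
    then show ?thesis using that w ep[OF that(1)] ep[OF w] by (simp add: divide_simps mult.commute)
  qed
  have Rle: "w * (v / etr mu v) powr (t - 1) \<le> R w" if "0 < v" "v \<le> w" for v w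
    unfolding R_def using that t ep[OF that(1)] ratio[OF that] by (intro mult_left_mono powr_mono2) auto
  have Rge: "R v \<le> v * (w / etr mu w) powr (t - 1)" if "0 < v" "v \<le> w" for v w
    unfolding R_def using that t ep[OF that(1)] ratio[OF that] by (intro mult_left_mono powr_mono2) auto
  have Rmono: "R v < R w" if "0 < v" "v < w" for v w
  proof -
    have "R v < w * (v / etr mu v) powr (t - 1)"
      unfolding R_def using that ep[OF that(1)] by (intro mult_strict_right_mono) auto
    also have "\<dots> \<le> R w" using that by (intro Rle) auto
    finally show ?thesis .
  qed
  have Rc: "continuous_on {0<..} R"
    unfolding R_def using ep by (intro continuous_intros etr_continuous mu) (auto simp: less_imp_neq[symmetric])
  have "\<exists>w>0. R w = s" if s: "0 < s" for s
  proof -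
    \<comment> \<open>Comparing w / etr mu w with its value at 1 gives R w \<le> C w for w \<le> 1
      and R w \<ge> C w for w \<ge> 1; this brackets s between \<open>R l\<close> and
      \<open>R h\<close>.\<close>
    define C where "C = (1 / etr mu 1) powr (t - 1)"
    have C: "0 < C" using ep[of 1] by (simp add: C_def)
    define l h where "l = min 1 (s / C)" and "h = max 1 (s / C)"
    have l: "0 < l" "l \<le> 1" "l \<le> s / C" and h: "1 \<le> h" "s / C \<le> h" using s C by (auto simp: l_def h_def)
    have "R l \<le> l * C" unfolding C_def by (rule Rge[OF l(1,2)])
    also have "\<dots> \<le> s" using l(3) C by (simp add: pos_le_divide_eq)
    finally have 1: "R l \<le> s" .
    have "s \<le> h * C" using h(2) C by (simp add: pos_divide_le_eq)
    also have "\<dots> \<le> R h" unfolding C_def by (rule Rle) (use h in auto)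
    finally have 2: "s \<le> R h" .
    have "continuous_on {l..h} R" by (rule continuous_on_subset[OF Rc]) (use l in auto)
    then obtain w where "l \<le> w" "R w = s" using IVT'[of R l s h] 1 2 l(2) h(1) by (meson order_trans)
    then show ?thesis using l(1) by (intro exI[of _ w]) simp
  qed
  then obtain ws where ws: "\<And>s. 0 < s \<Longrightarrow> 0 < ws s" "\<And>s. 0 < s \<Longrightarrow> R (ws s) = s" by metis
  define T where "T s w = s powr a * etr mu w powr (1 - a)" for s w
  \<comment> \<open>In this form the sign of T s w - w is the sign of s - R w.\<close>
  have T: "T s w = w * (s / R w) powr a" if "0 < s" "0 < w" for s w
  proof -
    have "R w powr a = w powr a * (w / etr mu w) powr (1 - a)"
      unfolding R_def using that ep[OF that(2)] a(3) by (simp add: powr_mult powr_powr algebra_simps)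
    also have "\<dots> = (w powr a * w powr (1 - a)) / etr mu w powr (1 - a)"
      using that ep[OF that(2)] by (simp add: powr_divide)
    also have "w powr a * w powr (1 - a) = w" using that by (simp flip: powr_add)
    finally have "R w powr a = w / etr mu w powr (1 - a)" .
    then show ?thesis using that ep[OF that(2)] Rp[OF that(2)] by (simp add: T_def powr_divide)
  qed
  define E where "E z = Qtr mu z - 1" for z
  have E: "cbf E" unfolding E_def by (rule cbf_Etr[OF mu])
  have Er: "E (of_real x) = of_real (etr mu x)" for x by (simp add: E_def Etr_of_real mu)
  define F where "F w z = z powr of_real a * E (w z) powr of_real (1 - a)" for w :: "complex \<Rightarrow> complex" and z
  have "\<exists>w. cbf w \<and> (\<forall>s>0. w (of_real s) = of_real (ws s))"
  proof (rule cbf_fixed_point[where F = F and T = T])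
    show "cbf (F w)" if "cbf w" for w
      unfolding F_def using a by (intro cbf_geometric_mean[OF cbf_id cbf_comp[OF E that]]) auto
    show "F w (of_real s) = of_real (T s (Re (w (of_real s))))" if w: "cbf w" "0 < s" for w s
    proof -
      define r where "r = Re (w (of_real s))"
      have r: "w (of_real s) = of_real r" "0 < r" unfolding r_def by (rule cbf_real(1)[OF w], rule cbf_real(2)[OF w])
      have "complex_of_real s powr of_real a = of_real (s powr a)"
        "complex_of_real (etr mu r) powr of_real (1 - a) = of_real (etr mu r powr (1 - a))"
        using w(2) ep[OF r(2)] by (simp_all add: powr_of_real less_imp_le del: of_real_diff)
      then show ?thesis unfolding F_def r Re_complex_of_real T_def Er by (simp only: of_real_mult)
    qed
    show "T s v \<le> T s w" if "0 < s" "0 < v" "v \<le> w" for s v w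
      unfolding T_def using that a ep[OF that(2)] etr_mono[OF mu that(2,3)]
      by (intro mult_left_mono powr_mono2) auto
    show "continuous_on {0<..} (T s)" for s
      unfolding T_def using ep by (intro continuous_intros etr_continuous mu) (auto simp: less_imp_neq[symmetric])
    show "w < T s w" if "0 < s" "0 < w" "w < ws s" for s w
    proof -
      have "R w < s" using Rmono[OF that(2,3)] ws(2)[OF that(1)] by simp
      then have "1 < s / R w" using Rp[OF that(2)] by simp
      then have "1 < (s / R w) powr a" using a by (simp add: gr_one_powr)
      then show ?thesis using that by (simp add: T)
    qed
    show "T s w < w" if "0 < s" "ws s < w" for s w
    proof -
      have w: "0 < w" using that ws(1)[OF that(1)] by simp
      have "s < R w" using Rmono[OF ws(1)[OF that(1)] that(2)] ws(2)[OF that(1)] by simp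
      then have "s / R w < 1" "0 < s / R w" using Rp[OF w] that by auto
      then have "(s / R w) powr a < 1" using a powr_less_mono2[of a "s / R w" 1] by simp
      then show ?thesis using that w by (simp add: T mult_less_cancel_left2)
    qed
  qed (fact ws)
  then obtain w where w: "cbf w" "\<And>s. 0 < s \<Longrightarrow> w (of_real s) = of_real (ws s)" by blast
  have "filterlim ws (at_right 0) (at_right 0)"
  proof (rule filterlim_at_right_0I[OF eventually_small_tendsto_0 ws(1)])
    fix e :: real assume e: "0 < e"
    have "ws s < e" if s: "0 < s" "s < R e" for s
      using Rmono[OF e, of "ws s"] ws[OF s(1)] s(2) by (cases "ws s" e rule: linorder_cases) auto
    then show "\<forall>\<^sub>F s in at_right 0. ws s < e" using Rp[OF e] by (auto simp: eventually_at_right_field)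
  qed (fact ws(1))+
  from filterlim_compose[OF etr_tendsto_0[OF mu(1)] this]
  have lim: "((\<lambda>s. etr mu (ws s)) \<longlongrightarrow> 0) (at_right 0)" .
  have Ew: "cbf (\<lambda>z. E (w z))" by (rule cbf_comp[OF E w(1)])
  have "E (w (of_real s)) = of_real (etr mu (ws s))" if "0 < s" for s using w(2)[OF that] Er by simp
  from Pplus_etr_cbf_exists[OF Ew this lim]
  obtain rho where rho: "rho \<in> Pplus" "rho \<noteq> delta0" "\<And>s. s > 0 \<Longrightarrow> etr rho s = etr mu (ws s)" by metis
  have ev: "\<forall>\<^sub>F x in at_left 0. Sigmatr rho x = Sigmatr mu x powr t"
  proof (rule Sigmatr_power_I[OF mu rho(1,2)])
    show "\<forall>\<^sub>F s in at_right 0. \<exists>u>0. etr mu u = etr rho s \<and> s / etr rho s = (u / etr rho s) powr t"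
      using at_right_0_pos
    proof eventually_elim
      case (elim s)
      let ?u = "ws s" let ?e = "etr mu ?u"
      have u: "0 < ?u" "0 < ?e" using ws(1)[OF elim] ep by auto
      have "s / ?e = (?u / ?e) * (?u / ?e) powr (t - 1)" using ws(2)[OF elim] by (simp add: R_def)
      also have "\<dots> = (?u / ?e) powr t" using u powr_mult_base[of "?u / ?e" "t - 1"] by simp
      finally show ?case using u by (intro exI[of _ ?u]) (simp add: rho(3)[OF elim])
    qed
  qed
  have "free_mult_pow mu t = rho" by (rule free_mult_pow_eqI[OF mu(2) rho(1,2) ev])
  with rho ev show "free_mult_pow mu t \<in> Pplus" "free_mult_pow mu t \<noteq> delta0"
    "\<forall>\<^sub>F x in at_left 0. Sigmatr (free_mult_pow mu t) x = Sigmatr mu x powr t" by simp_all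
qed

section \<open>The transform of the beta law\<close>

text \<open>The substitution \<open>y = (1 + s) x / (1 + s x)\<close> reduces the integral to Euler's Beta integral.\<close>
lemma has_integral_beta_kernel:
  fixes a s :: real
  assumes a: "0 < a" "a < 1" and s: "0 \<le> s"
  shows "((\<lambda>x. x powr (a - 1) * (1 - x) powr (- a) * (1 / (1 + x * s))) has_integral
     ((1 + s) powr (- a) * Beta a (1 - a))) {0<..<1}"
proof -
  define f where "f y = y powr (a - 1) * (1 - y) powr (- a)" for y :: real
  define g where "g x = (1 + s) * x / (1 + x * s)" for x
  define g' where "g' x = (1 + s) / (1 + x * s)\<^sup>2" for x
  have d: "0 < 1 + x * s" if "0 \<le> x" for x using that s by (intro add_pos_nonneg) auto
  have fB: "(f has_integral Beta a (1 - a)) {0<..<1}"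
    using has_integral_Beta_real[of a "1 - a"] a unfolding f_def by (simp add: has_integral_Icc_iff_Ioo)
  have fabs: "f absolutely_integrable_on {0<..<1}"
    using fB by (intro nonnegative_absolutely_integrable_1) (auto simp: f_def)
  have img: "g ` {0<..<1} = {0<..<1}"
  proof (intro equalityI subsetI)
    fix y assume "y \<in> g ` {0<..<1}"
    then obtain x where x: "y = g x" "0 < x" "x < 1" by auto
    have "0 < (1 + s) * x" using x s by (intro mult_pos_pos) auto
    moreover have "(1 + s) * x < 1 + x * s" using x by (simp add: algebra_simps)
    ultimately show "y \<in> {0<..<1}" using d[of x] x by (simp add: g_def divide_less_eq)
  next
    fix y :: real assume y: "y \<in> {0<..<1}"
    have "0 \<le> s * (1 - y)" using y s by simp
    then have p: "0 < 1 + s - s * y" by (simp add: algebra_simps)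
    \<comment> \<open>The preimage comes from solving y (1 + x s) = (1 + s) x for x.\<close>
    have "g (y / (1 + s - s * y)) = y"
    proof -
      have "1 + y / (1 + s - s * y) * s = (1 + s) / (1 + s - s * y)" using p by (simp add: field_simps)
      then show ?thesis using p s by (simp add: g_def)
    qed
    moreover have "y / (1 + s - s * y) \<in> {0<..<1}"
    proof -
      have "0 < (1 + s) * (1 - y)" using y s by simp
      then have "y < 1 + s - s * y" by (simp add: algebra_simps)
      then show ?thesis using y p by simp
    qed
    ultimately show "y \<in> g ` {0<..<1}" by (metis imageI)
  qed
  have der: "(g has_field_derivative g' x) (at x within {0<..<1})" if "x \<in> {0<..<1}" for x
    unfolding g_def g'_def using d[of x] that
    by (auto intro!: derivative_eq_intros simp: power2_eq_square field_simps)
  have inj: "inj_on g {0<..<1}"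
  proof (rule inj_onI)
    fix x y assume xy: "x \<in> {0<..<1}" "y \<in> {0<..<1}" "g x = g y"
    then have "(1 + s) * (x * (1 + y * s)) = (1 + s) * (y * (1 + x * s))"
      using d[of x] d[of y] by (simp add: g_def frac_eq_eq mult.assoc)
    then have "x * (1 + y * s) = y * (1 + x * s)" using s by (simp only: mult_cancel_left) auto
    then show "x = y" by (simp add: algebra_simps)
  qed
  have "f absolutely_integrable_on g ` {0<..<1} \<and> integral (g ` {0<..<1}) f = Beta a (1 - a)"
    unfolding img using fabs fB by (simp add: integral_unique)
  then have ch: "(\<lambda>x. \<bar>g' x\<bar> * f (g x)) absolutely_integrable_on {0<..<1}"
     "integral {0<..<1} (\<lambda>x. \<bar>g' x\<bar> * f (g x)) = Beta a (1 - a)"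
    using has_absolute_integral_change_of_variables_1'[of "{0<..<1}" g g' f "Beta a (1 - a)"] der inj by auto
  have "((\<lambda>x. \<bar>g' x\<bar> * f (g x)) has_integral Beta a (1 - a)) {0<..<1}"
    using ch by (metis absolutely_integrable_on_def integrable_integral)
  then have "((\<lambda>x. (1 + s) powr (- a) * (\<bar>g' x\<bar> * f (g x))) has_integral ((1 + s) powr (- a) * Beta a (1 - a))) {0<..<1}"
    by (rule has_integral_mult_right)
  then show ?thesis
  proof (rule has_integral_eq[rotated])
    fix x :: real assume x: "x \<in> {0<..<1}"
    let ?d = "1 + x * s"
    have dx: "0 < ?d" using d[of x] x by simp
    have "1 - g x = (1 - x) / ?d" using dx by (simp add: g_def field_simps)
    then have "f (g x) = ((1 + s) powr (a - 1) * x powr (a - 1) / ?d powr (a - 1)) * ((1 - x) powr (- a) / ?d powr (- a))"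
      unfolding f_def using x s dx by (simp add: g_def powr_divide powr_mult)
    also have "\<dots> = (1 + s) powr (a - 1) * (x powr (a - 1) * (1 - x) powr (- a)) / (?d powr (a - 1) * ?d powr (- a))"
      by simp
    also have "?d powr (a - 1) * ?d powr (- a) = ?d powr (- 1)" by (simp flip: powr_add)
    also have "?d powr (- 1) = 1 / ?d" using dx by (simp add: powr_minus_divide)
    finally have fg: "f (g x) = (1 + s) powr (a - 1) * (x powr (a - 1) * (1 - x) powr (- a)) * ?d" by simp
    have s1: "(1 + s) powr (- a) * ((1 + s) * (1 + s) powr (a - 1)) = 1"
      using s by (simp add: powr_mult_base flip: powr_add)
    have "(1 + s) powr (- a) * (\<bar>g' x\<bar> * f (g x))
      = ((1 + s) powr (- a) * ((1 + s) * (1 + s) powr (a - 1))) * ((x powr (a - 1) * (1 - x) powr (- a)) * (?d / ?d\<^sup>2))"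
      unfolding fg using s by (simp add: g'_def)
    also have "?d / ?d\<^sup>2 = 1 / ?d" using dx by (simp add: power2_eq_square)
    finally show "(1 + s) powr (- a) * (\<bar>g' x\<bar> * f (g x)) = x powr (a - 1) * (1 - x) powr (- a) * (1 / (1 + x * s))"
      unfolding s1 by simp
  qed
qed

text \<open>The kernel integral at s = 0 gives total mass 1; at s > 0 it gives (1+s)^(-a), whose
  reciprocal is q. For a = 1 the law is the point mass at 1, with q = 1 + s.\<close>

lemma beta_law_Pplus:
  assumes a: "0 < a" "a \<le> 1"
  shows "beta_law a \<in> Pplus" "\<And>s. s > 0 \<Longrightarrow> qtr (beta_law a) s = (1 + s) powr a"
proof -
  have "beta_law a \<in> Pplus \<and> (\<forall>s>0. qtr (beta_law a) s = (1 + s) powr a)"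
  proof (cases "a = 1")
    case True
    have "qtr (return borel 1) s = 1 + s" if "s > 0" for s :: real
    proof -
      have "(\<integral>x. 1 / (1 + x * s) \<partial>(return borel 1)) = 1 / (1 + 1 * s)" by (rule integral_return) simp_all
      then show ?thesis by (simp add: qtr_def)
    qed
    moreover have "return borel (1::real) \<in> Pplus" by (auto simp: Pplus_def prob_space_return)
    ultimately show ?thesis using True by (simp add: beta_law_def)
  next
    case False
    then have a1: "a < 1" using a by simp
    have B: "0 < Beta a (1 - a)" using a a1 by (simp add: Beta_def Gamma_real_pos)
    define D where "D x = indicator {0<..<1} x * x powr (a - 1) * (1 - x) powr (- a) / Beta a (1 - a)" for x :: real
    have D0: "0 \<le> D x" for x using B by (auto simp: D_def indicator_def)
    have [measurable]: "D \<in> borel_measurable borel" unfolding D_def by measurable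
    have bl: "beta_law a = density lborel (\<lambda>x. ennreal (D x))"
      using False by (simp add: beta_law_def D_def)
    have nn: "(\<integral>\<^sup>+x. ennreal (D x * (1 / (1 + x * s))) \<partial>lborel) = ennreal ((1 + s) powr (- a))"
      and pos: "0 \<le> D x * (1 / (1 + x * s))" if s: "0 \<le> s" for s x
    proof -
      have k0: "0 \<le> D x * (1 / (1 + x * s))" for x
        using s D0[of x] by (cases "0 < x") (auto simp: D_def indicator_def less_imp_le[OF B] intro!: mult_nonneg_nonneg divide_nonneg_nonneg)
      then show "0 \<le> D x * (1 / (1 + x * s))" for x .
      have "((\<lambda>x. (if x \<in> {0<..<1} then x powr (a - 1) * (1 - x) powr (- a) * (1 / (1 + x * s)) else 0)) has_integral
     ((1 + s) powr (- a) * Beta a (1 - a))) UNIV"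
        using has_integral_beta_kernel[OF a(1) a1 s] by (simp only: has_integral_restrict_UNIV)
      then have "((\<lambda>x. (if x \<in> {0<..<1} then x powr (a - 1) * (1 - x) powr (- a) * (1 / (1 + x * s)) else 0) / Beta a (1 - a)) has_integral
     ((1 + s) powr (- a) * Beta a (1 - a) / Beta a (1 - a))) UNIV"
        by (rule has_integral_divide)
      also have "(1 + s) powr (- a) * Beta a (1 - a) / Beta a (1 - a) = (1 + s) powr (- a)" using B by simp
      also have "(\<lambda>x. (if x \<in> {0<..<1} then x powr (a - 1) * (1 - x) powr (- a) * (1 / (1 + x * s)) else 0) / Beta a (1 - a))
         = (\<lambda>x. D x * (1 / (1 + x * s)))"
        by (auto simp: D_def fun_eq_iff)
      finally have hi: "((\<lambda>x. D x * (1 / (1 + x * s))) has_integral (1 + s) powr (- a)) UNIV" .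
      show "(\<integral>\<^sup>+x. ennreal (D x * (1 / (1 + x * s))) \<partial>lborel) = ennreal ((1 + s) powr (- a))"
        by (rule nn_integral_has_integral_lborel[OF _ k0 hi]) measurable
    qed
    have "emeasure (beta_law a) (space (beta_law a)) = 1"
      unfolding bl using nn[of 0] by (simp add: emeasure_density)
    then interpret P: prob_space "beta_law a" by (rule prob_spaceI)
    have "(\<lambda>x. ennreal (D x) * indicator {..<0} x) = (\<lambda>x. 0)" by (auto simp: D_def indicator_def)
    then have "emeasure (beta_law a) {..<0} = 0"
      unfolding bl by (subst emeasure_density) (simp_all only:, simp_all)
    then have "beta_law a \<in> Pplus" using P.prob_space_axioms by (simp add: Pplus_def bl)
    moreover have "qtr (beta_law a) s = (1 + s) powr a" if s: "s > 0" for s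
    proof -
      have "(\<integral>x. 1 / (1 + x * s) \<partial>(beta_law a)) = (\<integral>x. D x * (1 / (1 + x * s)) \<partial>lborel)"
        unfolding bl by (subst integral_density) (auto simp: D0)
      also have "\<dots> = enn2real (\<integral>\<^sup>+x. ennreal (D x * (1 / (1 + x * s))) \<partial>lborel)"
        by (rule integral_eq_nn_integral) (measurable, rule AE_I2, rule pos[OF less_imp_le[OF s]])
      also have "\<dots> = (1 + s) powr (- a)" unfolding nn[OF less_imp_le[OF s]] by simp
      finally show ?thesis by (simp add: qtr_def powr_minus_divide)
    qed
    ultimately show ?thesis by blast
  qed
  then show "beta_law a \<in> Pplus" "\<And>s. s > 0 \<Longrightarrow> qtr (beta_law a) s = (1 + s) powr a" by auto
qed

section \<open>The maps M and U\<close>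

lemma powr_filterlim_at_right_0:
  assumes "0 < (a::real)" shows "filterlim (\<lambda>s. s powr a) (at_right 0) (at_right 0)"
proof (rule filterlim_at_right_0I)
  have "((\<lambda>s. s powr a) \<longlongrightarrow> 0 powr a) (at_right (0::real))"
    using assms by (intro tendsto_powr' tendsto_intros) (auto simp: eventually_at_filter)
  then show "((\<lambda>s. s powr a) \<longlongrightarrow> 0) (at_right 0)" by simp
qed simp

lemma powr_powr_inverse:
  assumes "0 < (a::real)" "0 \<le> x" shows "(x powr a) powr (1 / a) = x" "(x powr (1 / a)) powr a = x"
  using assms by (simp_all add: powr_powr)

lemma Pplus_qtr_eqI:
  assumes "mu \<in> Pplus" "nu \<in> Pplus" "\<And>s. s > 0 \<Longrightarrow> qtr mu s = qtr nu s" shows "mu = nu"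
  using assms by (intro Pplus_etr_eqI') (auto simp: etr_def)

text \<open>Candidate measures for both maps are built straight from the closed formulas; only
  afterwards are they identified with \<open>Mplus\<close> and \<open>Uplus\<close>, whose
  definitions pass through free convolution.\<close>

lemma qtr_power_conj_exists:
  assumes mu: "mu \<in> Pplus" and a: "0 < a" "a \<le> 1"
  obtains rho where "rho \<in> Pplus" "\<And>s. s > 0 \<Longrightarrow> qtr rho s = qtr mu (s powr a) powr (1 / a)"
proof -
  have c: "cbf (\<lambda>z. Qtr mu (z powr of_real a) powr of_real (1 / a))"
    by (rule cbf_power_conj[OF cbf_Qtr[OF mu] a])
  have v: "Qtr mu (of_real s powr of_real a) powr of_real (1 / a) = of_real (qtr mu (s powr a) powr (1 / a))"
    if s: "s > 0" for s
  proof -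
    have "0 \<le> qtr mu (s powr a)" using qtr_ge_1[OF mu, of "s powr a"] s by simp
    moreover have "complex_of_real s powr of_real a = of_real (s powr a)" using s by (simp add: powr_of_real)
    ultimately show ?thesis by (simp only: Qtr_of_real[OF mu] powr_of_real)
  qed
  have "((\<lambda>s. qtr mu (s powr a) powr (1 / a)) \<longlongrightarrow> 1 powr (1 / a)) (at_right 0)"
    using filterlim_compose[OF qtr_tendsto_0[OF mu] powr_filterlim_at_right_0[OF a(1)]] by (intro tendsto_intros) auto
  then have l: "((\<lambda>s. qtr mu (s powr a) powr (1 / a)) \<longlongrightarrow> 1) (at_right 0)" by simp
  have "((\<lambda>s. Re (Qtr mu (of_real s powr of_real a) powr of_real (1 / a))) \<longlongrightarrow> 1) (at_right 0)"
    by (rule Lim_transform_eventually[OF l])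
      (auto intro: eventually_at_right_0I simp: v simp del: of_real_divide)
  from Pplus_of_cbf[OF c this] show thesis using that v by (auto simp del: of_real_divide)
qed

lemma etr_power_conj_exists:
  assumes mu: "mu \<in> Pplus" and a: "0 < a" "a \<le> 1"
  obtains rho where "rho \<in> Pplus" "\<And>s. s > 0 \<Longrightarrow> etr rho s = etr mu (s powr a) powr (1 / a)"
proof (cases "mu = delta0")
  case True
  then show thesis using that[OF delta0_Pplus] by simp
next
  case False
  have c: "cbf (\<lambda>z. (Qtr mu (z powr of_real a) - 1) powr of_real (1 / a))"
    by (rule cbf_power_conj[OF cbf_Etr[OF mu False] a])
  have v: "(Qtr mu (of_real s powr of_real a) - 1) powr of_real (1 / a) = of_real (etr mu (s powr a) powr (1 / a))"
    if s: "s > 0" for s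
  proof -
    have "0 \<le> etr mu (s powr a)" using s by (intro etr_nonneg mu) simp
    moreover have "complex_of_real s powr of_real a = of_real (s powr a)" using s by (simp add: powr_of_real)
    ultimately show ?thesis by (simp only: Etr_of_real[OF mu] powr_of_real)
  qed
  have "filterlim (\<lambda>s. etr mu (s powr a) powr (1 / a)) (at_right 0) (at_right 0)"
    using a by (intro filterlim_compose[OF powr_filterlim_at_right_0] filterlim_compose[OF etr_filterlim[OF mu False]] powr_filterlim_at_right_0) auto
  then have "((\<lambda>s. etr mu (s powr a) powr (1 / a)) \<longlongrightarrow> 0) (at_right 0)" by (simp add: filterlim_at)
  from Pplus_etr_cbf_exists[OF c v this] show thesis using that by metis
qed

lemma Ftr_qtr_iff:
  assumes "rho \<in> Pplus"
  shows "(\<forall>x::real. x < 0 \<longrightarrow> Ftr rho (of_real x) = of_real (x * h (1 / (- x)))) \<longleftrightarrow> (\<forall>s>0. qtr rho s = h s)"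
proof
  assume l: "\<forall>x::real. x < 0 \<longrightarrow> Ftr rho (of_real x) = of_real (x * h (1 / (- x)))"
  show "\<forall>s>0. qtr rho s = h s"
  proof (intro allI impI)
    fix s :: real assume s: "s > 0"
    have "complex_of_real (- (1 / s) * qtr rho (1 / (- (- (1 / s))))) = of_real (- (1 / s) * h (1 / (- (- (1 / s)))))"
      using l[rule_format, of "- (1 / s)"] Ftr_neg[OF assms, of "- (1 / s)"] s by simp
    then have "- (1 / s) * qtr rho (1 / (- (- (1 / s)))) = - (1 / s) * h (1 / (- (- (1 / s))))" by (simp only: of_real_eq_iff)
    then show "qtr rho s = h s" using s by simp
  qed
next
  assume r: "\<forall>s>0. qtr rho s = h s"
  show "\<forall>x::real. x < 0 \<longrightarrow> Ftr rho (of_real x) = of_real (x * h (1 / (- x)))"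
  proof (intro allI impI)
    fix x :: real assume x: "x < 0"
    then have "qtr rho (1 / (- x)) = h (1 / (- x))" using r by simp
    then show "Ftr rho (of_real x) = of_real (x * h (1 / (- x)))" by (simp only: Ftr_neg[OF assms x])
  qed
qed

text \<open>The law arises by power conjugation from \<open>beta_law 1\<close>, the point mass at 1,
  whose q is 1 + s.\<close>

lemma monotone_stable_Pplus:
  assumes a: "0 < a" "a \<le> 1"
  shows "monotone_stable a \<in> Pplus" "\<And>s. s > 0 \<Longrightarrow> qtr (monotone_stable a) s = (1 + s powr a) powr (1 / a)"
proof -
  have d1: "beta_law 1 \<in> Pplus" "\<And>s. s > 0 \<Longrightarrow> qtr (beta_law 1) s = 1 + s"
    using beta_law_Pplus[of 1] by auto
  obtain rho where rho: "rho \<in> Pplus" "\<And>s. s > 0 \<Longrightarrow> qtr rho s = (1 + s powr a) powr (1 / a)"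
    using qtr_power_conj_exists[OF d1(1) a] d1(2) by (metis powr_gt_zero less_irrefl)
  have eq: "complex_of_real (- (((- x) powr a + 1) powr (1 / a))) = of_real (x * (1 + (1 / (- x)) powr a) powr (1 / a))"
    if x: "x < 0" for x
  proof -
    have "1 + (1 / (- x)) powr a = ((- x) powr a + 1) / (- x) powr a"
      using x by (simp add: powr_divide add_divide_distrib del: divide_minus_right)
    then have "(1 + (1 / (- x)) powr a) powr (1 / a) = ((- x) powr a + 1) powr (1 / a) / (- x)"
      using x a by (simp add: powr_divide powr_powr_inverse del: divide_minus_right)
    then show ?thesis using x by simp
  qed
  have iff: "(\<forall>x::real. x < 0 \<longrightarrow> Ftr r (of_real x) = of_real (- (((- x) powr a + 1) powr (1 / a))))
     \<longleftrightarrow> (\<forall>s>0. qtr r s = (1 + s powr a) powr (1 / a))" if "r \<in> Pplus" for r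
    using Ftr_qtr_iff[OF that, of "\<lambda>s. (1 + s powr a) powr (1 / a)"] eq by auto
  have "monotone_stable a = rho"
  proof -
    have "r = rho" if "r \<in> Pplus" "\<forall>s>0. qtr r s = (1 + s powr a) powr (1 / a)" for r
      using that rho by (intro Pplus_qtr_eqI) auto
    then show ?thesis unfolding monotone_stable_def using iff rho by (intro the_equality) blast+
  qed
  with rho show "monotone_stable a \<in> Pplus" "\<And>s. s > 0 \<Longrightarrow> qtr (monotone_stable a) s = (1 + s powr a) powr (1 / a)" by auto
qed

text \<open>The function z^a is the geometric mean of z and 1, hence in the class.\<close>

lemma boolean_stable_Pplus:
  assumes a: "0 < a" "a \<le> 1"
  shows "boolean_stable a \<in> Pplus" "\<And>s. s > 0 \<Longrightarrow> etr (boolean_stable a) s = s powr a"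
proof -
  have c: "cbf (\<lambda>z. z powr of_real a * 1 powr of_real (1 - a))"
    using a by (intro cbf_geometric_mean[OF cbf_id cbf_one]) auto
  have v: "complex_of_real s powr of_real a * 1 powr of_real (1 - a) = of_real (s powr a)" if "s > 0" for s
    using that by (simp add: powr_of_real)
  have l: "((\<lambda>s. s powr a) \<longlongrightarrow> 0) (at_right 0)" using powr_filterlim_at_right_0[OF a(1)] by (simp add: filterlim_at)
  obtain rho where rho: "rho \<in> Pplus" "\<And>s. s > 0 \<Longrightarrow> etr rho s = s powr a"
    using Pplus_etr_cbf_exists[OF c v l] by metis
  have "boolean_stable a = rho"
  proof -
    have "r = rho" if "r \<in> Pplus" "\<forall>s>0. etr r s = s powr a" for r
      using that rho by (intro Pplus_etr_eqI') auto
    then show ?thesis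
      unfolding boolean_stable_def using etatr_etr_cong[of _ "\<lambda>s. s powr a"] rho by (intro the_equality) blast+
  qed
  with rho show "boolean_stable a \<in> Pplus" "\<And>s. s > 0 \<Longrightarrow> etr (boolean_stable a) s = s powr a" by auto
qed

text \<open>This is \<open>Sigma_B = Sigma_mu o eta_sg\<close> at the point - y: as e_mu(w) =
  e_sg(y), the right-hand side is w/e_sg(y). The upper bound on \<open>y\<close> guarantees that it
  is a value of \<open>etr (Bmap sg mu)\<close>.\<close>

lemma Bmap_Sigmatr:
  assumes sg: "sg \<in> Pplus" "sg \<noteq> delta0" and mu: "mu \<in> Pplus" "mu \<noteq> delta0"
    and w: "0 < w" and y: "0 < y" "y \<le> etr (Bmap sg mu) 1" and eq: "etr mu w = etr sg y"
  shows "Sigmatr (Bmap sg mu) (- y) = w / etr sg y"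
proof -
  note B = free_mult_conv_Bmap[OF sg mu]
  obtain s where s: "0 < s" "etr (Bmap sg mu) s = y"
    using etr_surj_near_0[OF B(1,2) y, of thesis] by auto
  have p: "0 < etr sg y" by (rule etr_pos[OF sg y(1)])
  have "etr mu (s * etr sg y / y) = etr mu w" using B(4)[OF s(1)] s(2) eq by simp
  then have "s * etr sg y / y = w" using etr_inj[OF mu _ w] s y p by simp
  then have "s / y = w / etr sg y" using p y by (simp add: field_simps)
  then show ?thesis using Sigmatr_etr[OF B(1,2) s(1)] s(2) by simp
qed

text \<open>Put y = e_rho(s) and v = e_mu(s^a). Then 1 + y = (1 + v)^(1/a), so the beta law has e(y)
  = v and Sigma_B(-y) = s^a/v. The free power turns this into s/v^(1/a). The monotone stable law
  takes the value y at v^(1/a), so it contributes v^(1/a)/y. The product is s/y = Sigma_rho(-y): the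
  stable factor cancels v^(1/a).\<close>

lemma Mplus_Pplus:
  assumes mu: "mu \<in> Pplus" and a: "0 < a" "a \<le> 1"
  shows "Mplus a mu \<in> Pplus" "\<And>s. s > 0 \<Longrightarrow> qtr (Mplus a mu) s = qtr mu (s powr a) powr (1 / a)"
proof -
  obtain rho where rho: "rho \<in> Pplus" "\<And>s. s > 0 \<Longrightarrow> qtr rho s = qtr mu (s powr a) powr (1 / a)"
    using qtr_power_conj_exists[OF mu a] by metis
  note be = beta_law_Pplus[OF a]
  have be0: "beta_law a \<noteq> delta0"
    using be(2)[of 1] a qtr_delta0[of 1] gr_one_powr[of "2::real" a] by auto
  note ms = monotone_stable_Pplus[OF a]
  have ms0: "monotone_stable a \<noteq> delta0"
    using ms(2)[of 1] a qtr_delta0[of 1] gr_one_powr[of "2::real" "1 / a"] by auto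
  have "Mplus a mu = rho"
  proof (cases "mu = delta0")
    case True
    have "rho = delta0"
      by (rule Pplus_qtr_eqI[OF rho(1) delta0_Pplus]) (simp add: rho(2) True qtr_delta0)
    then show ?thesis
      using True by (simp add: Mplus_def Bmap_delta0[OF be(1) be0] free_mult_pow_delta0 free_mult_conv_delta0)
  next
    case False
    define B where "B = Bmap (beta_law a) mu"
    have B: "B \<in> Pplus" "B \<noteq> delta0"
      unfolding B_def using free_mult_conv_Bmap[OF be(1) be0 mu False] by auto
    have t: "1 \<le> 1 / a" using a by simp
    define P where "P = free_mult_pow B (1 / a)"
    note P = free_mult_pow_Pplus[OF B t, folded P_def]
    have rp: "1 < qtr rho s" if "0 < s" for s
    proof -
      have "1 < qtr mu (s powr a)" using etr_pos[OF mu False, of "s powr a"] that by (simp add: etr_def)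
      then show ?thesis using a that by (simp add: rho(2) gr_one_powr)
    qed
    have rho0: "rho \<noteq> delta0" using qtr_delta0[of 1] rp[OF zero_less_one] by auto
    \<comment> \<open>For small s the value \<open>etr rho s\<close> lies in the range of
      \<open>etr B\<close>, where the Sigma-transform of \<open>B\<close> is known.\<close>
    have small: "\<forall>\<^sub>F s in at_right 0. etr rho s < etr B 1"
      using order_tendstoD(2)[OF etr_tendsto_0[OF rho(1)] etr_pos[OF B]] by simp
    have "\<forall>\<^sub>F s in at_right 0. Sigmatr P (- etr rho s) = Sigmatr B (- etr rho s) powr (1 / a)"
      using P(3) unfolding eventually_at_left_0_etr[OF rho(1) rho0] .
    with small at_right_0_pos
    have "\<forall>\<^sub>F s in at_right 0. Sigmatr rho (- etr rho s) = Sigmatr P (- etr rho s) * Sigmatr (monotone_stable a) (- etr rho s)"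
    proof eventually_elim
      case (elim s)
      define y where "y = etr rho s"
      define v where "v = etr mu (s powr a)"
      have s: "0 < s" "0 < s powr a" using elim by auto
      have v: "0 < v" unfolding v_def by (rule etr_pos[OF mu False s(2)])
      have y: "0 < y" "1 + y = (1 + v) powr (1 / a)"
        unfolding y_def v_def using etr_pos[OF rho(1) rho0 s(1)] by (auto simp: etr_def rho(2)[OF s(1)])
      have be_y: "etr (beta_law a) y = v"
        using y v a by (simp add: etr_def be(2) powr_powr_inverse)
      have SB: "Sigmatr B (- y) = s powr a / v"
        using Bmap_Sigmatr[OF be(1) be0 mu False s(2) y(1)] elim(1) be_y
        by (simp add: B_def y_def v_def)
      have "etr (monotone_stable a) (v powr (1 / a)) = y"
        using y v a by (simp add: etr_def ms(2) powr_powr_inverse)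
      then have Sm: "Sigmatr (monotone_stable a) (- y) = v powr (1 / a) / y"
        using Sigmatr_etr[OF ms(1) ms0, of "v powr (1 / a)"] v by simp
      have "(s powr a / v) powr (1 / a) = s / v powr (1 / a)"
        using s v a by (simp add: powr_divide powr_powr_inverse)
      then show ?case
        using Sigmatr_etr[OF rho(1) rho0 s(1)] elim(3) v by (simp add: y_def[symmetric] SB Sm)
    qed
    then have "\<forall>\<^sub>F x in at_left 0. Sigmatr rho x = Sigmatr P x * Sigmatr (monotone_stable a) x"
      unfolding eventually_at_left_0_etr[OF rho(1) rho0] .
    then show ?thesis
      unfolding Mplus_def B_def[symmetric] P_def[symmetric] by (rule free_mult_conv_eqI[OF P(2) ms0 rho(1) rho0])
  qed
  with rho show "Mplus a mu \<in> Pplus" "\<And>s. s > 0 \<Longrightarrow> qtr (Mplus a mu) s = qtr mu (s powr a) powr (1 / a)" by auto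
qed

text \<open>With v = e_mu(s^a), y = e_rho(s) is v^(1/a) itself, and the Boolean law has e(y) = y^a =
  v. So Sigma_B(-y) = s^a/v, whose power 1/a is already s/y = Sigma_rho(-y): the free power alone
  suffices.\<close>

lemma Uplus_Pplus:
  assumes mu: "mu \<in> Pplus" and a: "0 < a" "a \<le> 1"
  shows "Uplus a mu \<in> Pplus" "\<And>s. s > 0 \<Longrightarrow> etr (Uplus a mu) s = etr mu (s powr a) powr (1 / a)"
proof -
  obtain rho where rho: "rho \<in> Pplus" "\<And>s. s > 0 \<Longrightarrow> etr rho s = etr mu (s powr a) powr (1 / a)"
    using etr_power_conj_exists[OF mu a] by metis
  note bs = boolean_stable_Pplus[OF a]
  have bs0: "boolean_stable a \<noteq> delta0" using bs(2)[of 1] by auto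
  have "Uplus a mu = rho"
  proof (cases "mu = delta0")
    case True
    have "rho = delta0"
      by (rule Pplus_etr_eqI'[OF rho(1) delta0_Pplus]) (simp add: rho(2) True)
    then show ?thesis
      using True by (simp add: Uplus_def Bmap_delta0[OF bs(1) bs0] free_mult_pow_delta0)
  next
    case False
    define B where "B = Bmap (boolean_stable a) mu"
    have B: "B \<in> Pplus" "B \<noteq> delta0"
      unfolding B_def using free_mult_conv_Bmap[OF bs(1) bs0 mu False] by auto
    have rp: "0 < etr rho s" if "0 < s" for s
      using etr_pos[OF mu False, of "s powr a"] that by (simp add: rho(2))
    have rho0: "rho \<noteq> delta0" using rp[OF zero_less_one] by auto
    have small: "\<forall>\<^sub>F s in at_right 0. etr rho s < etr B 1"
      using order_tendstoD(2)[OF etr_tendsto_0[OF rho(1)] etr_pos[OF B]] by simp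
    with at_right_0_pos
    have "\<forall>\<^sub>F s in at_right 0. Sigmatr rho (- etr rho s) = Sigmatr B (- etr rho s) powr (1 / a)"
    proof eventually_elim
      case (elim s)
      define y where "y = etr rho s"
      define v where "v = etr mu (s powr a)"
      have s: "0 < s" "0 < s powr a" using elim by auto
      have v: "0 < v" unfolding v_def by (rule etr_pos[OF mu False s(2)])
      have y: "0 < y" "y = v powr (1 / a)"
        unfolding y_def v_def using rp[OF s(1)] by (auto simp: rho(2)[OF s(1)])
      have bs_y: "etr (boolean_stable a) y = v"
        using bs(2)[OF y(1)] y v a by (simp add: powr_powr_inverse)
      have SB: "Sigmatr B (- y) = s powr a / v"
        using Bmap_Sigmatr[OF bs(1) bs0 mu False s(2) y(1)] elim(2) bs_y
        by (simp add: B_def y_def v_def)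
      have "(s powr a / v) powr (1 / a) = s / y"
        using s v a y by (simp add: powr_divide powr_powr_inverse)
      then show ?case
        using Sigmatr_etr[OF rho(1) rho0 s(1)] by (simp add: y_def[symmetric] SB)
    qed
    then have "\<forall>\<^sub>F x in at_left 0. Sigmatr rho x = Sigmatr B x powr (1 / a)"
      unfolding eventually_at_left_0_etr[OF rho(1) rho0] .
    then show ?thesis
      unfolding Uplus_def B_def[symmetric] by (rule free_mult_pow_eqI[OF B(2) rho(1) rho0])
  qed
  with rho show "Uplus a mu \<in> Pplus" "\<And>s. s > 0 \<Longrightarrow> etr (Uplus a mu) s = etr mu (s powr a) powr (1 / a)" by auto
qed

section \<open>Closed formulas in the complex variable, and additive monotone convolution\<close>

text \<open>With r = (-x)^a one has F_mu(-r) = - r q_mu(1/r), and the outer power turns the factor r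
  into -x.\<close>

lemma Mplus_formula:
  assumes mu: "mu \<in> Pplus" and a: "0 < a" and x: "x < 0"
  shows "- ((- Ftr mu (of_real (- ((- x) powr a)))) powr of_real (1 / a))
     = of_real (x * (qtr mu ((1 / (- x)) powr a) powr (1 / a)))"
proof -
  define r where "r = (- x) powr a"
  have r: "0 < r" "r powr (1 / a) = - x" using x a by (auto simp: r_def powr_powr_inverse)
  have q: "1 \<le> qtr mu (1 / r)" using r by (intro qtr_ge_1 mu) simp
  have "- Ftr mu (of_real (- r)) = of_real (r * qtr mu (1 / r))"
    using Ftr_neg[OF mu, of "- r"] r by simp
  then have "(- Ftr mu (of_real (- r))) powr of_real (1 / a) = of_real ((r * qtr mu (1 / r)) powr (1 / a))"
    using r q by (simp only: powr_of_real mult_nonneg_nonneg order_trans[OF zero_le_one q] less_imp_le[OF r(1)])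
  also have "(r * qtr mu (1 / r)) powr (1 / a) = (- x) * qtr mu (1 / r) powr (1 / a)"
    using r q by (simp add: powr_mult)
  also have "1 / r = (1 / (- x)) powr a" using x by (simp add: r_def powr_divide del: divide_minus_right)
  finally show ?thesis unfolding r_def by simp
qed

lemma Uplus_formula:
  assumes mu: "mu \<in> Pplus" and a: "0 < a" and x: "x < 0"
  shows "- ((- etatr mu (of_real (- ((- x) powr a)))) powr of_real (1 / a))
     = of_real (- (etr mu ((- x) powr a) powr (1 / a)))"
proof -
  have e: "0 \<le> etr mu ((- x) powr a)" by (intro etr_nonneg mu) simp
  have "- etatr mu (of_real (- ((- x) powr a))) = of_real (etr mu ((- x) powr a))"
    using etatr_neg[OF mu, of "(- x) powr a"] by simp
  then show ?thesis by (simp only: powr_of_real[OF e]) simp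
qed

text \<open>The substitution w = -1/z preserves the upper half-plane and gives F_nu(z) = z Q_nu(w)
  and -1/F_nu(z) = w/Q_nu(w), so the composition of F-transforms becomes z K(w). The upper
  half-plane and the positive axis both determine a holomorphic function on the slit plane, so the
  condition may be tested on either.\<close>

lemma mono_add_conv_iff:
  assumes rho: "rho \<in> Pplus" and mu: "mu \<in> Pplus" and nu: "nu \<in> Pplus"
  shows "(\<forall>z. Im z > 0 \<longrightarrow> Ftr rho z = Ftr mu (Ftr nu z)) \<longleftrightarrow> (\<forall>s>0. qtr rho s = qtr nu s * qtr mu (s / qtr nu s))"
proof -
  define K where "K w = Qtr nu w * Qtr mu (w / Qtr nu w)" for w
  note Q = cbf_Qtr[OF rho] cbf_Qtr[OF mu] cbf_Qtr[OF nu]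
  note wQ = cbf_quotient[OF Q(3)]
  have K: "K holomorphic_on slit"
    unfolding K_def[abs_def] by (rule holomorphic_on_mult[OF cbf_holo[OF Q(3)] cbf_holo[OF cbf_comp[OF Q(2) wQ]]])
  have F: "Ftr rho z = Ftr mu (Ftr nu z) \<longleftrightarrow> Qtr rho (- (1 / z)) = K (- (1 / z))" if z: "Im z > 0" for z
  proof -
    have nz: "z \<noteq> 0" using z by auto
    have sl: "- (1 / z) \<in> slit" using z by (auto simp: slit_iff Im_divide)
    have Qn: "Qtr nu (- (1 / z)) \<noteq> 0" by (rule cbf_nz[OF Q(3) sl])
    have "Ftr mu (Ftr nu z) = (z * Qtr nu (- (1 / z))) * Qtr mu (- (1 / (z * Qtr nu (- (1 / z)))))"
      using nz Qn by (simp add: Ftr_eq_Qtr)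
    also have "- (1 / (z * Qtr nu (- (1 / z)))) = - (1 / z) / Qtr nu (- (1 / z))" by simp
    finally have "Ftr mu (Ftr nu z) = z * K (- (1 / z))" by (simp add: K_def mult.assoc)
    then show ?thesis using nz by (simp add: Ftr_eq_Qtr)
  qed
  have real: "Qtr rho (of_real s) = K (of_real s) \<longleftrightarrow> qtr rho s = qtr nu s * qtr mu (s / qtr nu s)" for s
    unfolding K_def Qtr_of_real[OF rho] Qtr_of_real[OF nu] of_real_divide[symmetric] Qtr_of_real[OF mu]
      of_real_mult[symmetric] of_real_eq_iff ..
  show ?thesis
  proof
    assume l: "\<forall>z. Im z > 0 \<longrightarrow> Ftr rho z = Ftr mu (Ftr nu z)"
    have "Qtr rho w = K w" if w: "w \<in> {w. 0 < Im w}" for w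
    proof -
      have "w \<noteq> 0" "0 < Im (- (1 / w))" using w by (auto simp: Im_divide intro!: divide_pos_pos simp: sum_power2_gt_zero_iff)
      then show ?thesis using F[of "- (1 / w)"] l by simp
    qed
    then have "Qtr rho w = K w" if "w \<in> slit" for w
      using that by (intro analytic_continuation_open[of "{w. 0 < Im w}" slit "Qtr rho" K w])
        (auto simp: open_halfspace_Im_gt open_slit connected_slit K slit_iff intro: cbf_holo Q exI[of _ \<i>])
    then have "Qtr rho (of_real s) = K (of_real s)" if "s > 0" for s using that by simp
    then show "\<forall>s>0. qtr rho s = qtr nu s * qtr mu (s / qtr nu s)" using real by blast
  next
    assume r: "\<forall>s>0. qtr rho s = qtr nu s * qtr mu (s / qtr nu s)"
    have "Qtr rho w = K w" if "w \<in> slit" for w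
    proof (rule slit_identity[OF cbf_holo[OF Q(1)] K _ that])
      show "\<forall>\<^sub>F s in at_right 0. Qtr rho (of_real s) = K (of_real s)"
        by (rule eventually_at_right_0I) (use r real in blast)
    qed
    moreover have "- (1 / z) \<in> slit" if "Im z > 0" for z using that by (auto simp: slit_iff Im_divide)
    ultimately show "\<forall>z. Im z > 0 \<longrightarrow> Ftr rho z = Ftr mu (Ftr nu z)" using F by blast
  qed
qed

text \<open>With w = s/q_nu(s), the product q_nu(s) q_mu(s/q_nu(s)) is s q_mu(w)/w, the basic step
  of the class applied to z/Q_nu(z).\<close>

lemma mono_add_conv_Pplus:
  assumes mu: "mu \<in> Pplus" and nu: "nu \<in> Pplus"
  shows "mono_add_conv mu nu \<in> Pplus"
    "\<And>s. s > 0 \<Longrightarrow> qtr (mono_add_conv mu nu) s = qtr nu s * qtr mu (s / qtr nu s)"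
proof -
  note Q = cbf_Qtr[OF mu] cbf_Qtr[OF nu]
  note wQ = cbf_quotient[OF Q(2)]
  define f where "f z = z * Qtr mu (z / Qtr nu z) / (z / Qtr nu z)" for z
  have c: "cbf f" unfolding f_def by (rule cbf_subordination_step[OF Q(1) wQ])
  have qn: "0 < qtr nu s" if "0 < s" for s using qtr_ge_1[OF nu that] by simp
  have v: "f (of_real s) = of_real (qtr nu s * qtr mu (s / qtr nu s))" if s: "0 < s" for s
  proof -
    have "f (of_real s) = of_real (s * qtr mu (s / qtr nu s) / (s / qtr nu s))"
      unfolding f_def Qtr_of_real[OF nu] of_real_divide[symmetric] Qtr_of_real[OF mu] of_real_mult[symmetric] ..
    then show ?thesis using s qn[OF s] by simp
  qed
  have "filterlim (\<lambda>s. s / qtr nu s) (at_right 0) (at_right 0)"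
  proof (rule filterlim_at_right_0I)
    have "((\<lambda>s. s / qtr nu s) \<longlongrightarrow> 0 / 1) (at_right 0)" by (intro tendsto_intros qtr_tendsto_0 nu) auto
    then show "((\<lambda>s. s / qtr nu s) \<longlongrightarrow> 0) (at_right 0)" by simp
  qed (simp add: qn)
  from tendsto_mult[OF qtr_tendsto_0[OF nu] filterlim_compose[OF qtr_tendsto_0[OF mu] this]]
  have lim: "((\<lambda>s. qtr nu s * qtr mu (s / qtr nu s)) \<longlongrightarrow> 1) (at_right 0)" by simp
  have "((\<lambda>s. Re (f (of_real s))) \<longlongrightarrow> 1) (at_right 0)"
    by (rule Lim_transform_eventually[OF lim])
      (auto intro: eventually_at_right_0I simp: v)
  from Pplus_of_cbf[OF c this] obtain rho where rho: "rho \<in> Pplus" "\<And>s. s > 0 \<Longrightarrow> qtr rho s = qtr nu s * qtr mu (s / qtr nu s)"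
    using v by auto
  have "mono_add_conv mu nu = rho"
  proof -
    have "r = rho" if "r \<in> Pplus" "\<forall>s>0. qtr r s = qtr nu s * qtr mu (s / qtr nu s)" for r
      using that rho by (intro Pplus_qtr_eqI) auto
    then show ?thesis
      unfolding mono_add_conv_def using mono_add_conv_iff[OF _ mu nu] rho(1) rho(2)
      by (intro the_equality) (metis (no_types, lifting))+
  qed
  with rho show "mono_add_conv mu nu \<in> Pplus"
    "\<And>s. s > 0 \<Longrightarrow> qtr (mono_add_conv mu nu) s = qtr nu s * qtr mu (s / qtr nu s)" by auto
qed

section \<open>Semigroup and homomorphism identities\<close>

lemma Mplus_compose:
  assumes mu: "mu \<in> Pplus" and a: "0 < a" "a \<le> 1" and b: "0 < b" "b \<le> 1"
  shows "Mplus a (Mplus b mu) = Mplus (a * b) mu"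
proof -
  have ab: "0 < a * b" "a * b \<le> 1" using a b by (auto simp: mult_le_one)
  note Mb = Mplus_Pplus[OF mu b]
  show ?thesis
    by (rule Pplus_qtr_eqI[OF Mplus_Pplus(1)[OF Mb(1) a] Mplus_Pplus(1)[OF mu ab]])
      (simp add: Mplus_Pplus(2)[OF Mb(1) a] Mplus_Pplus(2)[OF mu ab] Mb(2) powr_powr mult.commute)
qed

lemma Uplus_compose:
  assumes mu: "mu \<in> Pplus" and a: "0 < a" "a \<le> 1" and b: "0 < b" "b \<le> 1"
  shows "Uplus a (Uplus b mu) = Uplus (a * b) mu"
proof -
  have ab: "0 < a * b" "a * b \<le> 1" using a b by (auto simp: mult_le_one)
  note Ub = Uplus_Pplus[OF mu b]
  show ?thesis
    by (rule Pplus_etr_eqI'[OF Uplus_Pplus(1)[OF Ub(1) a] Uplus_Pplus(1)[OF mu ab]])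
      (simp add: Uplus_Pplus(2)[OF Ub(1) a] Uplus_Pplus(2)[OF mu ab] Ub(2) powr_powr mult.commute)
qed

text \<open>On the right-hand side q_mu is evaluated at the power a of s/q_nu(s^a)^(1/a), which is
  s^a/q_nu(s^a), the same point as on the left; the outer power 1/a distributes over the
  product.\<close>

lemma Mplus_mono_add_conv:
  assumes mu: "mu \<in> Pplus" and nu: "nu \<in> Pplus" and a: "0 < a" "a \<le> 1"
  shows "Mplus a (mono_add_conv mu nu) = mono_add_conv (Mplus a mu) (Mplus a nu)"
proof -
  note MA = mono_add_conv_Pplus[OF mu nu]
  note Mm = Mplus_Pplus[OF mu a] and Mn = Mplus_Pplus[OF nu a]
  note AM = mono_add_conv_Pplus[OF Mm(1) Mn(1)]
  show ?thesis
  proof (rule Pplus_qtr_eqI[OF Mplus_Pplus(1)[OF MA(1) a] AM(1)])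
    fix s :: real assume s: "s > 0"
    have sa: "0 < s powr a" using s by simp
    have q: "1 \<le> qtr nu (s powr a)" by (rule qtr_ge_1[OF nu sa])
    have p: "0 < s / qtr nu (s powr a) powr (1 / a)" using s q by simp
    have e: "(s / qtr nu (s powr a) powr (1 / a)) powr a = s powr a / qtr nu (s powr a)"
      using s q a by (simp add: powr_divide powr_powr_inverse)
    have "1 \<le> qtr mu (s powr a / qtr nu (s powr a))" using sa q by (intro qtr_ge_1 mu) simp
    then show "qtr (Mplus a (mono_add_conv mu nu)) s = qtr (mono_add_conv (Mplus a mu) (Mplus a nu)) s"
      using q by (simp add: Mplus_Pplus(2)[OF MA(1) a s] MA(2)[OF sa] AM(2)[OF s] Mn(2)[OF s] Mm(2)[OF p] e powr_mult)
  qed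
qed

text \<open>U conjugates e by the power map s^a, and conjugation respects composition. The inner
  value 0 is separate because the formula for U is available only at s > 0.\<close>

lemma Uplus_mono_mult_conv:
  assumes mu: "mu \<in> Pplus" and nu: "nu \<in> Pplus" and a: "0 < a" "a \<le> 1"
  shows "Uplus a (mono_mult_conv mu nu) = mono_mult_conv (Uplus a mu) (Uplus a nu)"
proof -
  note UA = mono_mult_conv_etr[OF mu nu]
  note Um = Uplus_Pplus[OF mu a] and Un = Uplus_Pplus[OF nu a]
  note AU = mono_mult_conv_etr[OF Um(1) Un(1)]
  show ?thesis
  proof (rule Pplus_etr_eqI'[OF Uplus_Pplus(1)[OF UA(1) a] AU(1)])
    fix s :: real assume s: "s > 0"
    have sa: "0 < s powr a" using s by simp
    have e: "0 \<le> etr nu (s powr a)" using sa by (intro etr_nonneg nu) simp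
    show "etr (Uplus a (mono_mult_conv mu nu)) s = etr (mono_mult_conv (Uplus a mu) (Uplus a nu)) s"
    proof (cases "etr nu (s powr a) = 0")
      case True
      then show ?thesis using mu Um(1) by (simp add: Uplus_Pplus(2)[OF UA(1) a s] UA(2)[OF sa] AU(2)[OF s] Un(2)[OF s])
    next
      case False
      then have "0 < etr nu (s powr a) powr (1 / a)" using e by simp
      then show ?thesis
        using e a by (simp add: Uplus_Pplus(2)[OF UA(1) a s] UA(2)[OF sa] AU(2)[OF s] Un(2)[OF s] Um(2) powr_powr_inverse)
    qed
  qed
qed

lemma Uplus_delta0_iff:
  assumes mu: "mu \<in> Pplus" and a: "0 < a" "a \<le> 1"
  shows "Uplus a mu = delta0 \<longleftrightarrow> mu = delta0"
proof
  assume U: "Uplus a mu = delta0"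
  show "mu = delta0"
  proof (rule ccontr)
    assume "mu \<noteq> delta0"
    from etr_pos[OF mu this, of 1] Uplus_Pplus(2)[OF mu a, of 1] U show False by simp
  qed
next
  assume "mu = delta0"
  then show "Uplus a mu = delta0"
    using Uplus_Pplus[OF delta0_Pplus a] by (intro Pplus_etr_eqI') (auto simp: delta0_Pplus)
qed

text \<open>Witnesses u, v of the product rule at s^a, with common value y and u v = s^a y, turn
  into the witnesses u^(1/a), v^(1/a) at s: their common value is y^(1/a) and their product is s
  y^(1/a). Subordination supplies u and v for every s > 0.\<close>

lemma Uplus_free_mult_conv:
  assumes mu: "mu \<in> Pplus" and nu: "nu \<in> Pplus" and a: "0 < a" "a \<le> 1"
  shows "Uplus a (free_mult_conv mu nu) = free_mult_conv (Uplus a mu) (Uplus a nu)"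
proof (cases "mu = delta0 \<or> nu = delta0")
  case True
  then show ?thesis
    using Uplus_delta0_iff[OF mu a] Uplus_delta0_iff[OF nu a] Uplus_delta0_iff[OF delta0_Pplus a]
    by (simp add: free_mult_conv_delta0)
next
  case False
  then have m0: "mu \<noteq> delta0" and n0: "nu \<noteq> delta0" by auto
  define B where "B = Bmap mu nu"
  define kap where "kap = free_mult_conv mu nu"
  note C = free_mult_conv_Bmap[OF mu m0 nu n0, folded B_def, folded kap_def]
  have ek: "etr kap s = etr mu (etr B s)" if "s > 0" for s
    unfolding C(3) using mono_mult_conv_etr(2)[OF mu C(1) that] .
  note Um = Uplus_Pplus[OF mu a] and Un = Uplus_Pplus[OF nu a] and Uk = Uplus_Pplus[OF C(6) a]
  have U0: "Uplus a mu \<noteq> delta0" "Uplus a nu \<noteq> delta0" "Uplus a kap \<noteq> delta0"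
    using Uplus_delta0_iff mu nu a m0 n0 C(6,7) by auto
  have "\<forall>\<^sub>F x in at_left 0. Sigmatr (Uplus a kap) x = Sigmatr (Uplus a mu) x * Sigmatr (Uplus a nu) x"
  proof (rule Sigmatr_product_I[OF Um(1) U0(1) Un(1) U0(2) Uk(1) U0(3)])
    show "\<forall>\<^sub>F s in at_right 0. \<exists>u>0. \<exists>v>0. etr (Uplus a mu) u = etr (Uplus a kap) s \<and>
        etr (Uplus a nu) v = etr (Uplus a kap) s \<and> u * v = s * etr (Uplus a kap) s"
      using at_right_0_pos
    proof eventually_elim
      case (elim s)
      define y where "y = etr kap (s powr a)"
      define u where "u = etr B (s powr a)"
      define v where "v = s powr a * y / u"
      have sa: "0 < s powr a" using elim by simp
      have p: "0 < y" "0 < u" unfolding y_def u_def using etr_pos[OF C(6,7) sa] etr_pos[OF C(1,2) sa] by auto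
      have v: "0 < v" using p sa by (simp add: v_def)
      have eu: "etr mu u = y" using ek[OF sa] by (simp add: u_def y_def)
      have ev: "etr nu v = y" using C(4)[OF sa] eu by (simp add: u_def[symmetric] v_def)
      have "u powr (1 / a) * v powr (1 / a) = (u * v) powr (1 / a)" using p v by (simp add: powr_mult)
      also have "u * v = s powr a * y" using p by (simp add: v_def)
      also have "(s powr a * y) powr (1 / a) = s * y powr (1 / a)" using p elim a by (simp add: powr_mult powr_powr_inverse)
      finally have uv: "u powr (1 / a) * v powr (1 / a) = s * y powr (1 / a)" .
      show ?case
        by (rule exI[of _ "u powr (1 / a)"], intro conjI, use p in simp, rule exI[of _ "v powr (1 / a)"])
          (use p v a elim uv in \<open>simp add: Um(2) Un(2) Uk(2) powr_powr_inverse eu ev y_def[symmetric]\<close>)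
    qed
  qed
  from free_mult_conv_eqI[OF U0(1,2) Uk(1) U0(3) this] show ?thesis by (simp add: kap_def)
qed

theorem mainTheorem7:
  fixes a b :: real and mu nu :: "real measure"
  assumes "0 < a" "a \<le> 1" "0 < b" "b \<le> 1"
    and "mu \<in> Pplus" "nu \<in> Pplus"
  shows
   "(Mplus a mu \<in> Pplus \<and>
     (\<forall>x::real. x < 0 \<longrightarrow> Ftr (Mplus a mu) (complex_of_real x) =
        - ((- Ftr mu (complex_of_real (- ((- x) powr a)))) powr complex_of_real (1 / a))) \<and>
     (\<forall>rho\<in>Pplus. (\<forall>x::real. x < 0 \<longrightarrow> Ftr rho (complex_of_real x) =
        - ((- Ftr mu (complex_of_real (- ((- x) powr a)))) powr complex_of_real (1 / a)))
        \<longrightarrow> rho = Mplus a mu) \<and>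
     Mplus a (Mplus b mu) = Mplus (a * b) mu \<and>
     Mplus a (mono_add_conv mu nu) = mono_add_conv (Mplus a mu) (Mplus a nu))
  \<and>
   (Uplus a mu \<in> Pplus \<and>
     (\<forall>x::real. x < 0 \<longrightarrow> etatr (Uplus a mu) (complex_of_real x) =
        - ((- etatr mu (complex_of_real (- ((- x) powr a)))) powr complex_of_real (1 / a))) \<and>
     (\<forall>rho\<in>Pplus. (\<forall>x::real. x < 0 \<longrightarrow> etatr rho (complex_of_real x) =
        - ((- etatr mu (complex_of_real (- ((- x) powr a)))) powr complex_of_real (1 / a)))
        \<longrightarrow> rho = Uplus a mu) \<and>
     Uplus a (Uplus b mu) = Uplus (a * b) mu \<and>
     Uplus a (mono_mult_conv mu nu) = mono_mult_conv (Uplus a mu) (Uplus a nu) \<and>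
     Uplus a (free_mult_conv mu nu) = free_mult_conv (Uplus a mu) (Uplus a nu))"
proof -
  note a = assms(1,2) and b = assms(3,4) and mu = assms(5) and nu = assms(6)
  note M = Mplus_Pplus[OF mu a] and U = Uplus_Pplus[OF mu a]
  \<comment> \<open>The formula for M and its uniqueness within \<open>Pplus\<close> both come from
    this equivalence with an equation on the positive axis; U is treated in the same way.\<close>
  have Miff: "(\<forall>x::real. x < 0 \<longrightarrow> Ftr rho (complex_of_real x) =
        - ((- Ftr mu (complex_of_real (- ((- x) powr a)))) powr complex_of_real (1 / a)))
     \<longleftrightarrow> (\<forall>s>0. qtr rho s = qtr mu (s powr a) powr (1 / a))" if "rho \<in> Pplus" for rho
    using Ftr_qtr_iff[OF that, of "\<lambda>s. qtr mu (s powr a) powr (1 / a)"] Mplus_formula[OF mu a(1)] by metis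
  have Uiff: "(\<forall>x::real. x < 0 \<longrightarrow> etatr rho (complex_of_real x) =
        - ((- etatr mu (complex_of_real (- ((- x) powr a)))) powr complex_of_real (1 / a)))
     \<longleftrightarrow> (\<forall>s>0. etr rho s = etr mu (s powr a) powr (1 / a))" if "rho \<in> Pplus" for rho
    using etatr_etr_cong[OF that, of "\<lambda>s. etr mu (s powr a) powr (1 / a)"] Uplus_formula[OF mu a(1)] by metis
  have Muniq: "rho = Mplus a mu" if "rho \<in> Pplus" "\<forall>s>0. qtr rho s = qtr mu (s powr a) powr (1 / a)" for rho
    by (rule Pplus_qtr_eqI[OF that(1) M(1)]) (use that(2) M(2) in simp)
  have Uuniq: "rho = Uplus a mu" if "rho \<in> Pplus" "\<forall>s>0. etr rho s = etr mu (s powr a) powr (1 / a)" for rho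
    by (rule Pplus_etr_eqI'[OF that(1) U(1)]) (use that(2) U(2) in simp)
  have M1: "\<forall>s>0. qtr (Mplus a mu) s = qtr mu (s powr a) powr (1 / a)" using M(2) by blast
  have U1: "\<forall>s>0. etr (Uplus a mu) s = etr mu (s powr a) powr (1 / a)" using U(2) by blast
  show ?thesis
    by (intro conjI M(1) U(1) Miff[OF M(1), THEN iffD2, OF M1] Uiff[OF U(1), THEN iffD2, OF U1] ballI impI
        Muniq Uuniq Mplus_compose[OF mu a b] Mplus_mono_add_conv[OF mu nu a]
        Uplus_compose[OF mu a b] Uplus_mono_mult_conv[OF mu nu a] Uplus_free_mult_conv[OF mu nu a])
      (assumption | rule Miff[THEN iffD1] | rule Uiff[THEN iffD1])+
qed

end
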